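(* Let $R$ be a unital commutative ring such that all finitely-generated stably-free $R$-modules are free, and let $\mathfrak{Ass}$ be the (non-unital) associative operad in $R$-modules. The kernel of the natural transformation of functors of $V\in\mathrm{Ob}\,\mathcal{S}(R)$ $$\mathrm{Der}^+(\mathfrak{Ass}(V))/\mathrm{Der}^{(1)}_{\mathrm{Lie}}(\mathfrak{Ass}(V))\to|\mathrm{Der}_\bullet^+(\mathfrak{Ass}(R\oplus V))|/\mathbf{Im}^{\mathfrak{Ass}}_{\mathrm{special}}(V)\cong|\overline{T}(V)|\otimes|\overline{T}(V)^{\mathrm{op}}|$$ induced by the generalized divergence is $4$-torsion.
   Context: Take $\mathscr{O}=\mathfrak{Ass}$, the operad in $R$-modules encoding non-unital associative algebras. $T(V)$ is the tensor algebra and $\overline{T}(V)=\mathfrak{Ass}(V)$ its augmentation ideal. Free algebras. $\mathscr{O}(V)=\bigoplus_n\mathscr{O}_n(V)$, $\mathscr{O}_n(V)=\mathscr{O}(n)\otimes_{\mathfrak{S}_n}V^{\otimes n}$, is the free $\mathscr{O}$-algebra on $V$; $\mathscr{O}(V;W)=\bigoplus_{n\ge1}\mathscr{O}(n)\otimes_{\mathfrak{S}_{n-1}}(V^{\otimes n-1}\otimes W)$ is the summand of $\mathscr{O}(V\oplus W)$ of terms linear in $W$. The category $\mathcal{S}(R)$ has objects the free $R$-modules of finite rank and morphisms $V\to W$ the pairs $(i:V\to W,\ r:W\to V)$ of $R$-linear maps with $r\circ i=\mathrm{id}_V$. Derivations. For $V$ free of finite rank, $\mathrm{Der}(\mathscr{O}(V))$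 is the module of derivations of the $\mathscr{O}$-algebra $\mathscr{O}(V)$; restriction to $V$ gives $\mathrm{Der}(\mathscr{O}(V))\cong\mathrm{Hom}_R(V,\mathscr{O}(V))\cong\mathscr{O}(V)\otimes V^\sharp$, where $V^\sharp=\mathrm{Hom}_R(V,R)$. It is graded with $\mathrm{Hom}_R(V,\mathscr{O}_n(V))$ in degree $n-1$; $\mathrm{Der}^+$ is the part of positive degree. It is a functor on $\mathcal{S}(R)$: $(i,r)$ sends $d$ to the derivation whose restriction to $W$ is $\mathscr{O}(i)\circ d|_V\circ r$. The preLie product is $(d\lhd e)|_V=e\circ(d|_V)$, with Lie bracket $[d,e]=d\lhd e-e\lhd d$. $\mathrm{Der}^{(1)}_{\mathrm{Lie}}(\mathscr{O}(V))$ is the sub Lie algebra of $\mathrm{Der}(\mathscr{O}(V))$ generated by the degree one part $\mathrm{Hom}_R(V,\mathscr{O}_2(V))$. Pointed derivations. $\mathrm{Der}_\bullet(\mathscr{O}(R\oplus V)):=\mathrm{Hom}_R(R,\mathscr{O}(V;R))\cong\mathscr{O}(V;R)$, a submodule of $\mathrm{Der}(\mathscr{O}(R\oplus V))$ via $R\oplus V\twoheadrightarrow R$ and $\mathscr{O}(V;R)\subset\mathscr{O}(R\oplus V)$; $\lhd$ restricts to an associative unital product on it (for $\mathscr{O}=\mathfrak{Ass}$ this algebra is $T(V)\otimes T(V)^{\mathrm{op}}$). $\mathrm{Der}^+_\bullet(\mathscr{O}(R\oplus V))$ is its intersection with $\mathrm{Der}^+(\mathscr{O}(R\oplus V))$.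 For an associative (possibly non-unital) algebra $A$, $|A|=A/[A,A]$ with $[A,A]$ the submodule generated by commutators. The Lie algebra $\mathrm{Der}(\mathscr{O}(V))$ acts on the right on $\mathrm{Der}_\bullet(\mathscr{O}(R\oplus V))$ and $\mathrm{Der}^+_\bullet(\mathscr{O}(R\oplus V))$ by $x\cdot e=x\lhd e$, where $e$ is extended to $\mathscr{O}(R\oplus V)$ by $0$ on $R$. Special part. $\mathrm{Der}_\bullet^{\mathrm{special}}(\mathscr{O}(R\oplus V))$ is the sub $\mathrm{Der}(\mathscr{O}(V))$-module of $\mathrm{Der}^+_\bullet(\mathscr{O}(R\oplus V))$ generated by the degree one part $\mathscr{O}_2(V;R):=\mathscr{O}(V;R)\cap\mathscr{O}_2(R\oplus V)$, and $\mathbf{Im}^{\mathscr{O}}_{\mathrm{special}}(V)$ is its image in $|\mathrm{Der}^+_\bullet(\mathscr{O}(R\oplus V))|$. Divergence. Let $\delta_V:\mathscr{O}(V)\to\mathscr{O}(V;V)$ send $\mu(v_1,\dots,v_n)$ to $\sum_i\mu(v_1,\dots,\overline{v_i},\dots,v_n)$, with $\overline{v_i}$ in the linear argument. $\Phi^{\mathscr{O}}_V:\mathrm{Der}(\mathscr{O}(V))\cong\mathscr{O}(V)\otimes V^\sharp\to\mathscr{O}(V;R)\cong\mathrm{Der}_\bullet(\mathscr{O}(R\oplus V))$ is $x\otimes f\mapsto\mathscr{O}(V;f)(\delta_V(x))$. $\mathsf{Div}^{\mathscr{O}}_V:\mathrm{Der}^+(\mathscr{O}(V))\to|\mathrm{Der}^+_\bullet(\mathscr{O}(R\oplus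 V))|$ is the restriction of $\Phi^{\mathscr{O}}_V$ followed by the quotient map; it maps $\mathrm{Der}^{(1)}_{\mathrm{Lie}}(\mathscr{O}(V))$ into $\mathbf{Im}^{\mathscr{O}}_{\mathrm{special}}(V)$. Torsion. A functor $F:\mathcal{S}(R)\to R\text{-modules}$ is $n$-torsion ($n\in\mathbb{N}$) if for every $V$ the map $F(j_n):F(V)\to F(V\oplus R^n)$ is zero, where $j_n$ is the canonical split inclusion. *)

theory Defs
  imports
    "HOL-Algebra.Module"
    "HOL-Algebra.AbelCoset"
    "HOL-Library.Poly_Mapping"
    HOL.Hull
begin

section \<open>Modules over a commutative ring\<close>

text \<open>
  The ground ring R is a type \<open>'r\<close> of class \<^class>\<open>comm_ring_1\<close>; R-modules are records of type
  \<^typ>\<open>('r, 'm) module\<close>. The fields \<open>one\<close> and (except for algebras) \<open>mult\<close> are irrelevant and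
  left \<open>undefined\<close>; \<open>mult\<close> is used for (not necessarily unital or associative) R-algebras.
\<close>

definition scalars :: "'r::comm_ring_1 ring" where
  "scalars = \<lparr>carrier = UNIV, mult = (*), one = 1, zero = 0, add = (+)\<rparr>"

definition gen_submodule :: "('r::comm_ring_1, 'm) module \<Rightarrow> 'm set \<Rightarrow> 'm set" where
  "gen_submodule M S = (\<lambda>N. submodule N scalars M) hull S"

definition lin_maps :: "('r::comm_ring_1, 'm) module \<Rightarrow> ('r, 'n) module \<Rightarrow> ('m \<Rightarrow> 'n) set" where
  "lin_maps M N = {f \<in> carrier M \<rightarrow> carrier N.
     (\<forall>x\<in>carrier M. \<forall>y\<in>carrier M. f (x \<oplus>\<^bsub>M\<^esub> y) = f x \<oplus>\<^bsub>N\<^esub> f y) \<and>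
     (\<forall>a. \<forall>x\<in>carrier M. f (a \<odot>\<^bsub>M\<^esub> x) = a \<odot>\<^bsub>N\<^esub> f x)}"

definition lin_isos :: "('r::comm_ring_1, 'm) module \<Rightarrow> ('r, 'n) module \<Rightarrow> ('m \<Rightarrow> 'n) set" where
  "lin_isos M N = {f \<in> lin_maps M N. bij_betw f (carrier M) (carrier N)}"

definition direct_sum ::
  "('r::comm_ring_1, 'm) module \<Rightarrow> ('r, 'n) module \<Rightarrow> ('r, 'm \<times> 'n) module" where
  "direct_sum M N = \<lparr>carrier = carrier M \<times> carrier N, mult = undefined, one = undefined,
     zero = (\<zero>\<^bsub>M\<^esub>, \<zero>\<^bsub>N\<^esub>),
     add = (\<lambda>(x, y) (x', y'). (x \<oplus>\<^bsub>M\<^esub> x', y \<oplus>\<^bsub>N\<^esub> y')),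
     smult = (\<lambda>a (x, y). (a \<odot>\<^bsub>M\<^esub> x, a \<odot>\<^bsub>N\<^esub> y))\<rparr>"

definition quot_module :: "('r::comm_ring_1, 'm) module \<Rightarrow> 'm set \<Rightarrow> ('r, 'm set) module" where
  "quot_module M N = \<lparr>carrier = a_rcosets\<^bsub>M\<^esub> N, mult = undefined, one = undefined,
     zero = N, add = set_add M, smult = (\<lambda>a X. \<Union>x\<in>X. N +>\<^bsub>M\<^esub> (a \<odot>\<^bsub>M\<^esub> x))\<rparr>"

text \<open>The map out of a quotient induced by \<open>f\<close>, with values in the quotient of \<open>M'\<close> by \<open>N'\<close>:
  all the cosets in the union agree when \<open>f\<close> is compatible with the submodules.\<close>

definition quot_map ::
  "('r::comm_ring_1, 'n) module \<Rightarrow> 'n set \<Rightarrow> ('m \<Rightarrow> 'n) \<Rightarrow> 'm set \<Rightarrow> 'n set" where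
  "quot_map M' N' f X = (\<Union>x\<in>X. N' +>\<^bsub>M'\<^esub> f x)"

definition scale :: "'r::comm_ring_1 \<Rightarrow> ('x \<Rightarrow>\<^sub>0 'r) \<Rightarrow> ('x \<Rightarrow>\<^sub>0 'r)" where
  "scale a p = Poly_Mapping.map ((*) a) p"

definition free_mod :: "'x set \<Rightarrow> ('r::comm_ring_1, 'x \<Rightarrow>\<^sub>0 'r) module" where
  "free_mod B = \<lparr>carrier = {p. Poly_Mapping.keys p \<subseteq> B}, mult = undefined, one = undefined,
     zero = 0, add = (+), smult = scale\<rparr>"

text \<open>The linear map of free modules induced by a map of bases.\<close>

definition push :: "('x \<Rightarrow> 'y) \<Rightarrow> ('x \<Rightarrow>\<^sub>0 'r::comm_ring_1) \<Rightarrow> ('y \<Rightarrow>\<^sub>0 'r)" where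
  "push h p = (\<Sum>x\<in>Poly_Mapping.keys p. Poly_Mapping.single (h x) (Poly_Mapping.lookup p x))"

definition tensor_rels ::
  "('r::comm_ring_1, 'm) module \<Rightarrow> ('r, 'n) module \<Rightarrow> ('m \<times> 'n \<Rightarrow>\<^sub>0 'r) set" where
  "tensor_rels M N =
     {Poly_Mapping.single (x \<oplus>\<^bsub>M\<^esub> x', y) 1 - Poly_Mapping.single (x, y) 1
        - Poly_Mapping.single (x', y) 1 | x x' y.
        x \<in> carrier M \<and> x' \<in> carrier M \<and> y \<in> carrier N} \<union>
     {Poly_Mapping.single (x, y \<oplus>\<^bsub>N\<^esub> y') 1 - Poly_Mapping.single (x, y) 1
        - Poly_Mapping.single (x, y') 1 | x y y'.
        x \<in> carrier M \<and> y \<in> carrier N \<and> y' \<in> carrier N} \<union>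
     {Poly_Mapping.single (a \<odot>\<^bsub>M\<^esub> x, y) 1 - Poly_Mapping.single (x, y) a | a x y.
        x \<in> carrier M \<and> y \<in> carrier N} \<union>
     {Poly_Mapping.single (x, a \<odot>\<^bsub>N\<^esub> y) 1 - Poly_Mapping.single (x, y) a | a x y.
        x \<in> carrier M \<and> y \<in> carrier N}"

definition tensor_sub ::
  "('r::comm_ring_1, 'm) module \<Rightarrow> ('r, 'n) module \<Rightarrow> ('m \<times> 'n \<Rightarrow>\<^sub>0 'r) set" where
  "tensor_sub M N = gen_submodule (free_mod (carrier M \<times> carrier N)) (tensor_rels M N)"

definition tensor_product ::
  "('r::comm_ring_1, 'm) module \<Rightarrow> ('r, 'n) module \<Rightarrow> ('r, ('m \<times> 'n \<Rightarrow>\<^sub>0 'r) set) module" where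
  "tensor_product M N = quot_module (free_mod (carrier M \<times> carrier N)) (tensor_sub M N)"

definition pure_tensor ::
  "('r::comm_ring_1, 'm) module \<Rightarrow> ('r, 'n) module \<Rightarrow> 'm \<Rightarrow> 'n \<Rightarrow> ('m \<times> 'n \<Rightarrow>\<^sub>0 'r) set" where
  "pure_tensor M N x y =
     tensor_sub M N +>\<^bsub>free_mod (carrier M \<times> carrier N)\<^esub> Poly_Mapping.single (x, y) 1"


subsection \<open>The condition on the ground ring\<close>

definition fin_gen :: "('r::comm_ring_1, 'm) module \<Rightarrow> bool" where
  "fin_gen M \<longleftrightarrow> (\<exists>S\<subseteq>carrier M. finite S \<and> gen_submodule M S = carrier M)"

definition stably_free :: "('r::comm_ring_1, 'm) module \<Rightarrow> bool" where
  "stably_free M \<longleftrightarrow> (\<exists>m n. lin_isos (direct_sum M (free_mod {..<m::nat} :: ('r, _) module))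
                                   (free_mod {..<n::nat} :: ('r, _) module) \<noteq> {})"

definition is_free :: "('r::comm_ring_1, 'm) module \<Rightarrow> bool" where
  "is_free M \<longleftrightarrow> (\<exists>I :: 'm set. lin_isos (free_mod I :: ('r, _) module) M \<noteq> {})"

text \<open>A finitely generated module is a quotient of some \<open>R\<^sup>n\<close>, so it has an isomorphic copy with
  carrier a subset of \<^typ>\<open>nat \<Rightarrow>\<^sub>0 'r\<close>: no generality is lost by fixing this type.\<close>

definition fg_stably_free_imp_free :: "'r::comm_ring_1 itself \<Rightarrow> bool" where
  "fg_stably_free_imp_free _ \<longleftrightarrow>
     (\<forall>M :: ('r, nat \<Rightarrow>\<^sub>0 'r) module.
        module scalars M \<and> fin_gen M \<and> stably_free M \<longrightarrow> is_free M)"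


subsection \<open>The quotient of an algebra by its commutators\<close>

definition commutator_sub :: "('r::comm_ring_1, 'm) module \<Rightarrow> 'm set" where
  "commutator_sub A = gen_submodule A
     {(x \<otimes>\<^bsub>A\<^esub> y) \<ominus>\<^bsub>A\<^esub> (y \<otimes>\<^bsub>A\<^esub> x) | x y. x \<in> carrier A \<and> y \<in> carrier A}"

definition abs_quot :: "('r::comm_ring_1, 'm) module \<Rightarrow> ('r, 'm set) module" where
  "abs_quot A = quot_module A (commutator_sub A)"

definition opposite :: "('r::comm_ring_1, 'm) module \<Rightarrow> ('r, 'm) module" where
  "opposite A = A\<lparr>mult := (\<lambda>x y. y \<otimes>\<^bsub>A\<^esub> x)\<rparr>"


section \<open>The category S(R)\<close>

text \<open>
  A free module of finite rank V is given as \<open>R\<^sup>(\<^sup>B\<^sup>)\<close> = \<^term>\<open>free_mod B\<close> for a finite set \<open>B\<close>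
  of an arbitrary type. The direct sum of the modules on \<open>B\<close> and \<open>C\<close> is the module on the disjoint
  union \<^term>\<open>Sum_Type.Plus B C\<close>; R itself is the module on \<^term>\<open>{()}\<close>, and \<open>R\<^sup>n\<close> the one on
  \<^term>\<open>{..<n::nat}\<close>.
\<close>

definition S_hom :: "'b set \<Rightarrow> 'c set \<Rightarrow>
    ((('b \<Rightarrow>\<^sub>0 'r::comm_ring_1) \<Rightarrow> ('c \<Rightarrow>\<^sub>0 'r)) \<times> (('c \<Rightarrow>\<^sub>0 'r) \<Rightarrow> ('b \<Rightarrow>\<^sub>0 'r))) set" where
  "S_hom B C = {(i, r). i \<in> lin_maps (free_mod B) (free_mod C) \<and>
     r \<in> lin_maps (free_mod C) (free_mod B) \<and> (\<forall>v\<in>carrier (free_mod B). r (i v) = v)}"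

text \<open>The canonical split inclusion of V into \<open>V \<oplus> W\<close>, together with the projection.\<close>

definition split_incl ::
  "(('b \<Rightarrow>\<^sub>0 'r::comm_ring_1) \<Rightarrow> ('b + 'c \<Rightarrow>\<^sub>0 'r)) \<times> (('b + 'c \<Rightarrow>\<^sub>0 'r) \<Rightarrow> ('b \<Rightarrow>\<^sub>0 'r))" where
  "split_incl = (push Inl, Poly_Mapping.map_key Inl)"

lemma lookup_scale: "Poly_Mapping.lookup (scale a p) x = a * Poly_Mapping.lookup p x"
  by (simp add: scale_def Poly_Mapping.map.rep_eq when_def)

lemma lookup_push:
  "Poly_Mapping.lookup (push h p) y =
     (\<Sum>x\<in>Poly_Mapping.keys p. (Poly_Mapping.lookup p x when h x = y))"
  by (simp add: push_def lookup_sum lookup_single)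

lemma lookup_push_inj:
  assumes "inj h"
  shows "Poly_Mapping.lookup (push h p) (h x) = Poly_Mapping.lookup p x"
proof -
  have "Poly_Mapping.lookup (push h p) (h x) =
    (\<Sum>z\<in>Poly_Mapping.keys p. (if z = x then Poly_Mapping.lookup p x else 0))"
    unfolding lookup_push using assms by (intro sum.cong) (auto simp: when_def inj_eq)
  then show ?thesis
    by (simp add: in_keys_iff)
qed

lemma lookup_push_notin:
  assumes "y \<notin> range h"
  shows "Poly_Mapping.lookup (push h p) y = 0"
  unfolding lookup_push using assms by (auto intro!: sum.neutral simp: when_def)

lemma lookup_push_Inl:
  "Poly_Mapping.lookup (push Inl p) (Inl b) = Poly_Mapping.lookup p b"
  "Poly_Mapping.lookup (push Inl p) (Inr c) = 0"
  by (simp add: lookup_push_inj) (rule lookup_push_notin, auto)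

lemma lookup_map_key_Inl:
  "Poly_Mapping.lookup (Poly_Mapping.map_key Inl p) b = Poly_Mapping.lookup p (Inl b)"
  by (simp add: map_key.rep_eq)

lemma split_incl_in_S_hom: "split_incl \<in> S_hom B (Sum_Type.Plus B C)"
proof -
  have in_Plus: "Poly_Mapping.keys (push Inl p) \<subseteq> Sum_Type.Plus B C"
    if "Poly_Mapping.keys p \<subseteq> B" for p :: "'a \<Rightarrow>\<^sub>0 'b"
  proof
    fix y assume "y \<in> Poly_Mapping.keys (push Inl p :: 'a + 'c \<Rightarrow>\<^sub>0 'b)"
    with that show "y \<in> Sum_Type.Plus B C"
      by (cases y) (auto simp: in_keys_iff lookup_push_Inl subset_iff)
  qed
  have add: "push Inl (p + q) = push Inl p + (push Inl q :: 'a + 'c \<Rightarrow>\<^sub>0 'b)" for p q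
  proof (rule poly_mapping_eqI)
    fix y show "Poly_Mapping.lookup (push Inl (p + q) :: 'a + 'c \<Rightarrow>\<^sub>0 'b) y =
      Poly_Mapping.lookup (push Inl p + push Inl q) y"
      by (cases y) (simp_all add: lookup_push_Inl lookup_add)
  qed
  have smult: "push Inl (scale a p) = scale a (push Inl p :: 'a + 'c \<Rightarrow>\<^sub>0 'b)" for a p
  proof (rule poly_mapping_eqI)
    fix y show "Poly_Mapping.lookup (push Inl (scale a p) :: 'a + 'c \<Rightarrow>\<^sub>0 'b) y =
      Poly_Mapping.lookup (scale a (push Inl p)) y"
      by (cases y) (simp_all add: lookup_push_Inl lookup_scale)
  qed
  show ?thesis
    using in_Plus
    by (auto simp: S_hom_def split_incl_def lin_maps_def free_mod_def add smult in_keys_iff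
        lookup_map_key_Inl lookup_push_Inl lookup_add lookup_scale subset_iff
        intro!: poly_mapping_eqI)
qed


section \<open>Tensor algebras\<close>

text \<open>
  The tensor algebra of \<^term>\<open>free_mod B\<close> is the free module on the words in \<open>B\<close>, multiplied by
  concatenation. With words as an additive monoid, the convolution product on
  \<^typ>\<open>'b list \<Rightarrow>\<^sub>0 'r\<close> provided by \<^theory>\<open>HOL-Library.Poly_Mapping\<close> is exactly this product.
\<close>

instantiation list :: (type) monoid_add
begin

definition "0 = []"
definition "xs + ys = xs @ ys"

instance
  by standard (simp_all add: zero_list_def plus_list_def)

end

type_synonym ('b, 'r) tens = "'b list \<Rightarrow>\<^sub>0 'r"

text \<open>\<open>ass_alg B\<close> is the non-unital algebra of noncommutative polynomials without constant term.\<close>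

definition ass_alg :: "'b set \<Rightarrow> ('r::comm_ring_1, ('b, 'r) tens) module" where
  "ass_alg B = \<lparr>carrier = {p. Poly_Mapping.keys p \<subseteq> lists B - {[]}}, mult = (*), one = undefined,
     zero = 0, add = (+), smult = scale\<rparr>"

definition ass_homog :: "nat \<Rightarrow> 'b set \<Rightarrow> ('b, 'r::comm_ring_1) tens set" where
  "ass_homog n B = {p \<in> carrier (ass_alg B). \<forall>w\<in>Poly_Mapping.keys p. length w = n}"

definition incl :: "('b \<Rightarrow>\<^sub>0 'r::comm_ring_1) \<Rightarrow> ('b, 'r) tens" where
  "incl = push (\<lambda>b. [b])"

text \<open>The algebra map induced by a linear map \<open>f\<close>: it sends a word \<open>b\<^sub>1 \<dots> b\<^sub>n\<close> to the product
  \<open>f(b\<^sub>1) \<dots> f(b\<^sub>n)\<close>.\<close>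

definition ass_map ::
  "(('b \<Rightarrow>\<^sub>0 'r::comm_ring_1) \<Rightarrow> ('c \<Rightarrow>\<^sub>0 'r)) \<Rightarrow> ('b, 'r) tens \<Rightarrow> ('c, 'r) tens" where
  "ass_map f p = (\<Sum>w\<in>Poly_Mapping.keys p. scale (Poly_Mapping.lookup p w)
     (prod_list (map (\<lambda>b. incl (f (Poly_Mapping.single b 1))) w)))"

text \<open>\<open>ass_lin B C\<close> is the part of the free algebra on \<open>W \<oplus> V\<close>, for V and W with bases \<open>B\<close> and \<open>C\<close>,
  that is linear in W. The linear argument is put first, to match \<open>R \<oplus> V\<close>.\<close>

definition ass_lin :: "'b set \<Rightarrow> 'c set \<Rightarrow> ('c + 'b, 'r::comm_ring_1) tens set" where
  "ass_lin B C = {p \<in> carrier (ass_alg (Sum_Type.Plus C B)).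
     \<forall>w\<in>Poly_Mapping.keys p. length (filter isl w) = 1}"


section \<open>Derivations\<close>

text \<open>Derivations are maps on a carrier; they are made to vanish outside it, so that equality of
  derivations is equality of functions.\<close>

definition Der :: "'b set \<Rightarrow> (('b, 'r::comm_ring_1) tens \<Rightarrow> ('b, 'r) tens) set" where
  "Der B = {D \<in> lin_maps (ass_alg B) (ass_alg B).
     (\<forall>p\<in>carrier (ass_alg B). \<forall>q\<in>carrier (ass_alg B). D (p * q) = D p * q + p * D q) \<and>
     (\<forall>p. p \<notin> carrier (ass_alg B) \<longrightarrow> D p = 0)}"

text \<open>The derivation with prescribed restriction \<open>f\<close> to V, for \<open>f\<close> a linear map from V to the free
  algebra on V.\<close>

definition der_ext :: "'b set \<Rightarrow> (('b \<Rightarrow>\<^sub>0 'r::comm_ring_1) \<Rightarrow> ('b, 'r) tens) \<Rightarrow>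
    (('b, 'r) tens \<Rightarrow> ('b, 'r) tens)" where
  "der_ext B f = (THE D. D \<in> Der B \<and> (\<forall>v\<in>carrier (free_mod B). D (incl v) = f v))"

definition prelie :: "'b set \<Rightarrow> (('b, 'r::comm_ring_1) tens \<Rightarrow> ('b, 'r) tens) \<Rightarrow>
    (('b, 'r) tens \<Rightarrow> ('b, 'r) tens) \<Rightarrow> (('b, 'r) tens \<Rightarrow> ('b, 'r) tens)" where
  "prelie B d e = der_ext B (\<lambda>v. e (d (incl v)))"

definition der_mod ::
  "'b set \<Rightarrow> ('r::comm_ring_1, ('b, 'r) tens \<Rightarrow> ('b, 'r) tens) module" where
  "der_mod B = \<lparr>carrier = Der B, mult = prelie B, one = undefined, zero = (\<lambda>_. 0),
     add = (\<lambda>d e p. d p + e p), smult = (\<lambda>a d p. scale a (d p))\<rparr>"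

definition Der_deg :: "nat \<Rightarrow> 'b set \<Rightarrow> (('b, 'r::comm_ring_1) tens \<Rightarrow> ('b, 'r) tens) set" where
  "Der_deg k B = {D \<in> Der B. \<forall>v\<in>carrier (free_mod B). D (incl v) \<in> ass_homog (k + 1) B}"

definition Der_plus :: "'b set \<Rightarrow> (('b, 'r::comm_ring_1) tens \<Rightarrow> ('b, 'r) tens) set" where
  "Der_plus B = gen_submodule (der_mod B) (\<Union>k\<in>{1..}. Der_deg k B)"

definition der_plus_mod ::
  "'b set \<Rightarrow> ('r::comm_ring_1, ('b, 'r) tens \<Rightarrow> ('b, 'r) tens) module" where
  "der_plus_mod B = (der_mod B)\<lparr>carrier := Der_plus B\<rparr>"

definition der_bracket :: "'b set \<Rightarrow> (('b, 'r::comm_ring_1) tens \<Rightarrow> ('b, 'r) tens) \<Rightarrow>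
    (('b, 'r) tens \<Rightarrow> ('b, 'r) tens) \<Rightarrow> (('b, 'r) tens \<Rightarrow> ('b, 'r) tens)" where
  "der_bracket B d e = prelie B d e \<ominus>\<^bsub>der_mod B\<^esub> prelie B e d"

definition Der_Lie1 :: "'b set \<Rightarrow> (('b, 'r::comm_ring_1) tens \<Rightarrow> ('b, 'r) tens) set" where
  "Der_Lie1 B = (\<lambda>L. submodule L scalars (der_mod B) \<and>
     (\<forall>d\<in>L. \<forall>e\<in>L. der_bracket B d e \<in> L)) hull Der_deg 1 B"

definition der_quot ::
  "'b set \<Rightarrow> ('r::comm_ring_1, (('b, 'r) tens \<Rightarrow> ('b, 'r) tens) set) module" where
  "der_quot B = quot_module (der_plus_mod B) (Der_Lie1 B)"

definition der_map :: "'c set \<Rightarrow>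
    (('b \<Rightarrow>\<^sub>0 'r::comm_ring_1) \<Rightarrow> ('c \<Rightarrow>\<^sub>0 'r)) \<times> (('c \<Rightarrow>\<^sub>0 'r) \<Rightarrow> ('b \<Rightarrow>\<^sub>0 'r)) \<Rightarrow>
    (('b, 'r) tens \<Rightarrow> ('b, 'r) tens) \<Rightarrow> (('c, 'r) tens \<Rightarrow> ('c, 'r) tens)" where
  "der_map C = (\<lambda>(i, r) d. der_ext C (\<lambda>w. ass_map i (d (incl (r w)))))"

definition der_quot_map :: "'c set \<Rightarrow>
    (('b \<Rightarrow>\<^sub>0 'r::comm_ring_1) \<Rightarrow> ('c \<Rightarrow>\<^sub>0 'r)) \<times> (('c \<Rightarrow>\<^sub>0 'r) \<Rightarrow> ('b \<Rightarrow>\<^sub>0 'r)) \<Rightarrow>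
    (('b, 'r) tens \<Rightarrow> ('b, 'r) tens) set \<Rightarrow> (('c, 'r) tens \<Rightarrow> ('c, 'r) tens) set" where
  "der_quot_map C f = quot_map (der_plus_mod C) (Der_Lie1 C) (der_map C f)"


section \<open>Pointed derivations\<close>

abbreviation pt :: "'b set \<Rightarrow> (unit + 'b) set" where
  "pt B \<equiv> Sum_Type.Plus {()} B"

text \<open>A linear map from R to \<^term>\<open>ass_lin B {()}\<close>, extended by 0 on V.\<close>

definition Der_pt ::
  "'b set \<Rightarrow> ((unit + 'b, 'r::comm_ring_1) tens \<Rightarrow> (unit + 'b, 'r) tens) set" where
  "Der_pt B = {D \<in> Der (pt B).
     (\<forall>x\<in>carrier (free_mod {()}). D (incl (push Inl x)) \<in> ass_lin B {()}) \<and>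
     (\<forall>v\<in>carrier (free_mod B). D (incl (push Inr v)) = 0)}"

text \<open>The identification of \<^term>\<open>ass_lin B {()}\<close> with \<^term>\<open>Der_pt B\<close>.\<close>

definition pt_der :: "'b set \<Rightarrow> (unit + 'b, 'r::comm_ring_1) tens \<Rightarrow>
    ((unit + 'b, 'r) tens \<Rightarrow> (unit + 'b, 'r) tens)" where
  "pt_der B y = der_ext (pt B) (\<lambda>u. scale (Poly_Mapping.lookup u (Inl ())) y)"

definition Der_pt_plus ::
  "'b set \<Rightarrow> ((unit + 'b, 'r::comm_ring_1) tens \<Rightarrow> (unit + 'b, 'r) tens) set" where
  "Der_pt_plus B = Der_pt B \<inter> Der_plus (pt B)"

definition pt_plus_alg :: "'b set \<Rightarrow>
    ('r::comm_ring_1, (unit + 'b, 'r) tens \<Rightarrow> (unit + 'b, 'r) tens) module" where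
  "pt_plus_alg B = (der_mod (pt B))\<lparr>carrier := Der_pt_plus B\<rparr>"

definition pt_action :: "'b set \<Rightarrow> ((unit + 'b, 'r::comm_ring_1) tens \<Rightarrow> (unit + 'b, 'r) tens) \<Rightarrow>
    (('b, 'r) tens \<Rightarrow> ('b, 'r) tens) \<Rightarrow> ((unit + 'b, 'r) tens \<Rightarrow> (unit + 'b, 'r) tens)" where
  "pt_action B x e = prelie (pt B) x
     (der_ext (pt B) (\<lambda>u. ass_map (push Inr) (e (incl (Poly_Mapping.map_key Inr u)))))"

definition Der_special ::
  "'b set \<Rightarrow> ((unit + 'b, 'r::comm_ring_1) tens \<Rightarrow> (unit + 'b, 'r) tens) set" where
  "Der_special B = (\<lambda>N. submodule N scalars (pt_plus_alg B) \<and>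
     (\<forall>x\<in>N. \<forall>e\<in>Der B. pt_action B x e \<in> N)) hull (Der_pt B \<inter> Der_deg 1 (pt B))"

definition abs_class :: "'b set \<Rightarrow> ((unit + 'b, 'r::comm_ring_1) tens \<Rightarrow> (unit + 'b, 'r) tens) \<Rightarrow>
    ((unit + 'b, 'r) tens \<Rightarrow> (unit + 'b, 'r) tens) set" where
  "abs_class B x = commutator_sub (pt_plus_alg B) +>\<^bsub>pt_plus_alg B\<^esub> x"

definition Im_special ::
  "'b set \<Rightarrow> ((unit + 'b, 'r::comm_ring_1) tens \<Rightarrow> (unit + 'b, 'r) tens) set set" where
  "Im_special B = abs_class B ` Der_special B"

definition pt_quot :: "'b set \<Rightarrow>
    ('r::comm_ring_1, ((unit + 'b, 'r) tens \<Rightarrow> (unit + 'b, 'r) tens) set set) module" where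
  "pt_quot B = quot_module (abs_quot (pt_plus_alg B)) (Im_special B)"


section \<open>The generalized divergence\<close>

definition delta_word :: "'b list \<Rightarrow> ('b + 'b) list \<Rightarrow>\<^sub>0 'r::comm_ring_1" where
  "delta_word w = (\<Sum>i<length w. Poly_Mapping.single
     (map Inr (take i w) @ [Inl (w ! i)] @ map Inr (drop (Suc i) w)) 1)"

definition delta :: "('b, 'r::comm_ring_1) tens \<Rightarrow> ('b + 'b, 'r) tens" where
  "delta p = (\<Sum>w\<in>Poly_Mapping.keys p. scale (Poly_Mapping.lookup p w) (delta_word w))"

text \<open>The map induced by a linear form \<open>f\<close> on the linear argument.\<close>

definition ass_lin_map ::
  "(('b \<Rightarrow>\<^sub>0 'r::comm_ring_1) \<Rightarrow> 'r) \<Rightarrow> ('b + 'b, 'r) tens \<Rightarrow> (unit + 'b, 'r) tens" where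
  "ass_lin_map f = ass_map (\<lambda>u.
     Poly_Mapping.single (Inl ()) (f (Poly_Mapping.map_key Inl u)) +
     push Inr (Poly_Mapping.map_key Inr u))"

text \<open>Under the isomorphism of \<^term>\<open>Der B\<close> with the tensor product of the free algebra and the dual
  of V, a derivation \<open>d\<close> is the sum over \<open>b \<in> B\<close> of \<open>d(b) \<otimes> b\<^sup>*\<close>, where \<open>b\<^sup>*\<close> is the dual basis.\<close>

definition Phi :: "'b set \<Rightarrow> (('b, 'r::comm_ring_1) tens \<Rightarrow> ('b, 'r) tens) \<Rightarrow>
    (unit + 'b, 'r) tens" where
  "Phi B d = (\<Sum>b\<in>B. ass_lin_map (\<lambda>v. Poly_Mapping.lookup v b)
     (delta (d (incl (Poly_Mapping.single b 1)))))"

definition Div :: "'b set \<Rightarrow> (('b, 'r::comm_ring_1) tens \<Rightarrow> ('b, 'r) tens) \<Rightarrow>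
    ((unit + 'b, 'r) tens \<Rightarrow> (unit + 'b, 'r) tens) set" where
  "Div B d = abs_class B (pt_der B (Phi B d))"

definition div_quot :: "'b set \<Rightarrow> (('b, 'r::comm_ring_1) tens \<Rightarrow> ('b, 'r) tens) set \<Rightarrow>
    ((unit + 'b, 'r) tens \<Rightarrow> (unit + 'b, 'r) tens) set set" where
  "div_quot B = quot_map (abs_quot (pt_plus_alg B)) (Im_special B) (Div B)"


section \<open>The target of the divergence\<close>

definition bi_abs :: "'b set \<Rightarrow>
    ('r::comm_ring_1, (('b, 'r) tens set \<times> ('b, 'r) tens set \<Rightarrow>\<^sub>0 'r) set) module" where
  "bi_abs B = tensor_product (abs_quot (ass_alg B)) (abs_quot (opposite (ass_alg B)))"

definition bi_abs_pure :: "'b set \<Rightarrow> ('b, 'r::comm_ring_1) tens \<Rightarrow> ('b, 'r) tens \<Rightarrow>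
    (('b, 'r) tens set \<times> ('b, 'r) tens set \<Rightarrow>\<^sub>0 'r) set" where
  "bi_abs_pure B p q = pure_tensor (abs_quot (ass_alg B)) (abs_quot (opposite (ass_alg B)))
     (commutator_sub (ass_alg B) +>\<^bsub>ass_alg B\<^esub> p)
     (commutator_sub (opposite (ass_alg B)) +>\<^bsub>opposite (ass_alg B)\<^esub> q)"

text \<open>The class of the pointed derivation that sends the generator \<open>x\<close> of R to \<open>p x q\<close>, that is, of the
  element \<open>p \<otimes> q\<close> of \<open>T(V) \<otimes> T(V)\<^sup>o\<^sup>p\<close>.\<close>

definition pt_quot_class :: "'b set \<Rightarrow> ('b, 'r::comm_ring_1) tens \<Rightarrow> ('b, 'r) tens \<Rightarrow>
    ((unit + 'b, 'r) tens \<Rightarrow> (unit + 'b, 'r) tens) set set" where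
  "pt_quot_class B p q = Im_special B +>\<^bsub>abs_quot (pt_plus_alg B)\<^esub>
     abs_class B (pt_der B (ass_map (push Inr) p * incl (Poly_Mapping.single (Inl ()) 1) *
       ass_map (push Inr) q))"

end

theory Submission
  imports Defs
begin

text \<open>
  Words are a basis of the tensor algebra, so every derivation of the free algebra on \<open>B\<close> is a combination
  of elementary ones, written \<open>b \<mapsto> w\<close>, that send the letter \<open>b\<close> to the word \<open>w\<close> and the other letters
  to \<open>0\<close>. Let \<open>L\<close> be the Lie algebra generated in degree one, over an alphabet that has a few letters
  more than those of \<open>B\<close>. The torsion statement comes from one bracket: if the letter \<open>y\<close> is different
  from \<open>b\<close> and does not occur in \<open>u\<close> and \<open>v\<close>, then the bracket of \<open>b \<mapsto> u y v\<close> and \<open>y \<mapsto> w\<close> is the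
  difference of \<open>b \<mapsto> u w v\<close> and the derivation that sends \<open>y\<close> to the sum of all words obtained from \<open>w\<close> by
  replacing one occurrence of \<open>b\<close> by \<open>u y v\<close>. It has the following consequences, where \<open>y\<close>, \<open>z\<close> are spare
  letters and congruence is modulo \<open>L\<close>.

  If \<open>w\<close> has at least two letters and \<open>b\<close> is not one of them, then \<open>b \<mapsto> w\<close> lies in \<open>L\<close> (\<open>lie_at_fresh\<close>). Therefore one may take the bracket of
  \<open>z \<mapsto> u y v\<close> and \<open>y \<mapsto> p z q\<close>, which shows that \<open>z \<mapsto> u p z q v\<close> is congruent to \<open>y \<mapsto> p u y v q\<close>. So the class
  of \<open>y \<mapsto> p y q\<close>, as a function of the element \<open>p \<otimes> q\<close> of \<open>T(V) \<otimes> T(V)\<^sup>o\<^sup>p\<close>, kills commutators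
  (\<open>lie_commutator\<close>). For nonempty words it also kills \<open>p \<otimes> 1\<close> and
  \<open>1 \<otimes> q\<close> (\<open>lie_ends\<close>), which span the special part. Finally \<open>b \<mapsto> w\<close> is
  congruent to the sum of \<open>y \<mapsto> p y q\<close> over all factorisations \<open>w = p b q\<close> (\<open>lie_divergence\<close>). This sum is the
  divergence of \<open>b \<mapsto> w\<close>, with \<open>y\<close> in the place of the marked letter. Hence after stabilisation the class of a
  derivation modulo \<open>L\<close> is determined by the class of its divergence, and is \<open>0\<close> when the latter is
  (\<open>stable_kernel\<close>). The spare letters come from the basis of the added summand.

  For the target, pointed derivations of positive degree form the augmentation ideal of
  \<open>T(V) \<otimes> T(V)\<^sup>o\<^sup>p\<close>. The special part is the span of the elements \<open>p \<otimes> 1\<close> and \<open>1 \<otimes> q\<close> (\<open>Der_special_eq\<close>), so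
  what remains is spanned by \<open>p \<otimes> q\<close> with both factors in the augmentation ideal of \<open>T(V)\<close>. There the
  commutators of the big algebra are spanned by \<open>[p, p'] \<otimes> q\<close> and \<open>q \<otimes> [p, p']\<close>
  (\<open>around_star_commutator_null\<close>, \<open>to_tensor_null\<close>), and dividing by them gives the tensor product of the two
  quotients by commutators (\<open>target_iso\<close>).
\<close>

section \<open>Linear extension and the tensor algebra\<close>

abbreviation cf :: "('x \<Rightarrow>\<^sub>0 'r::comm_ring_1) \<Rightarrow> 'x \<Rightarrow> 'r" where "cf \<equiv> Poly_Mapping.lookup"
abbreviation supp :: "('x \<Rightarrow>\<^sub>0 'r::comm_ring_1) \<Rightarrow> 'x set" where "supp \<equiv> Poly_Mapping.keys"
abbreviation trm :: "'x \<Rightarrow> 'r::comm_ring_1 \<Rightarrow> 'x \<Rightarrow>\<^sub>0 'r" where "trm \<equiv> Poly_Mapping.single"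
abbreviation mon :: "'x \<Rightarrow> 'x \<Rightarrow>\<^sub>0 'r::comm_ring_1" where "mon x \<equiv> trm x 1"

lemma scale_add_right: "scale a (p + q) = scale a p + scale a q"
  by (rule poly_mapping_eqI) (simp add: lookup_scale lookup_add algebra_simps)
lemma scale_add_left: "scale (a + b) p = scale a p + scale b p"
  by (rule poly_mapping_eqI) (simp add: lookup_scale lookup_add algebra_simps)
lemma scale_scale: "scale a (scale b p) = scale (a * b) p"
  by (rule poly_mapping_eqI) (simp add: lookup_scale algebra_simps)
lemma scale_one [simp]: "scale 1 p = p"
  by (rule poly_mapping_eqI) (simp add: lookup_scale)
lemma scale_zero_left [simp]: "scale 0 p = 0"
  by (rule poly_mapping_eqI) (simp add: lookup_scale)
lemma scale_zero_right [simp]: "scale a 0 = 0"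
  by (rule poly_mapping_eqI) (simp add: lookup_scale)
lemma scale_uminus_left: "scale (- a) p = - scale a p"
  by (rule poly_mapping_eqI) (simp add: lookup_scale)
lemma scale_diff_right: "scale a (p - q) = scale a p - scale a q"
  by (rule poly_mapping_eqI) (simp add: lookup_scale lookup_minus algebra_simps)
lemma scale_trm [simp]: "scale a (trm x b) = trm x (a * b)"
  by (rule poly_mapping_eqI) (simp add: lookup_scale lookup_single when_def)
lemma scale_sum: "scale a (sum f A) = (\<Sum>x\<in>A. scale a (f x))"
  by (induction A rule: infinite_finite_induct) (simp_all add: scale_add_right)

lemma sum_of_terms: "(\<Sum>x\<in>supp p. trm x (cf p x)) = p"
proof (rule poly_mapping_eqI)
  fix y
  have "cf (\<Sum>x\<in>supp p. trm x (cf p x)) y = (\<Sum>x\<in>supp p. if x = y then cf p y else 0)"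
    by (simp add: lookup_sum lookup_single when_def cong: if_cong)
  then show "cf (\<Sum>x\<in>supp p. trm x (cf p x)) y = cf p y"
    by (simp add: in_keys_iff)
qed

lemma supp_induct [consumes 1, case_names zero add trm]:
  assumes "supp p \<subseteq> X" "P 0" "\<And>p q. P p \<Longrightarrow> P q \<Longrightarrow> P (p + q)" "\<And>x a. x \<in> X \<Longrightarrow> P (trm x a)"
  shows "P p"
proof -
  have "P (\<Sum>x\<in>F. trm x (cf p x))" if "finite F" "F \<subseteq> X" for F
    using that by (induction F) (auto intro: assms(2-4))
  then show ?thesis
    using assms(1) sum_of_terms[of p] finite_keys[of p] by metis
qed

definition supported :: "'x set \<Rightarrow> ('x \<Rightarrow>\<^sub>0 'r::comm_ring_1) set" where
  "supported X = {p. supp p \<subseteq> X}"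

lemma supported_zero [simp, intro]: "0 \<in> supported X"
  by (simp add: supported_def)
lemma supported_add [simp, intro]: "p \<in> supported X \<Longrightarrow> q \<in> supported X \<Longrightarrow> p + q \<in> supported X"
  using keys_add[of p q] by (auto simp: supported_def)
lemma supported_scale [simp, intro]: "p \<in> supported X \<Longrightarrow> scale a p \<in> supported X"
  unfolding supported_def mem_Collect_eq subset_iff in_keys_iff lookup_scale by (metis mult_zero_right)
lemma supported_uminus [simp, intro]: "p \<in> supported X \<Longrightarrow> - p \<in> supported X"
  by (auto simp: supported_def in_keys_iff subset_iff)
lemma supported_diff [simp, intro]: "p \<in> supported X \<Longrightarrow> q \<in> supported X \<Longrightarrow> p - q \<in> supported X"
  by (metis supported_add supported_uminus diff_conv_add_uminus)
lemma supported_trm [simp, intro]: "x \<in> X \<Longrightarrow> trm x a \<in> supported X"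
  by (simp add: supported_def)
lemma supported_sum [intro]: "(\<And>i. i \<in> I \<Longrightarrow> f i \<in> supported X) \<Longrightarrow> sum f I \<in> supported X"
  by (induction I rule: infinite_finite_induct) auto
lemma supported_mono: "p \<in> supported X \<Longrightarrow> X \<subseteq> Y \<Longrightarrow> p \<in> supported Y"
  by (auto simp: supported_def)
lemma supported_UNIV [simp]: "p \<in> supported UNIV"
  by (simp add: supported_def)
lemma mon_supported_iff [simp]: "(mon x :: 'x \<Rightarrow>\<^sub>0 'r::comm_ring_1) \<in> supported X \<longleftrightarrow> x \<in> X"
  by (simp add: supported_def)

lemma supported_induct [consumes 1, case_names zero add trm]:
  assumes "p \<in> supported X" "P 0"
    "\<And>p q. p \<in> supported X \<Longrightarrow> q \<in> supported X \<Longrightarrow> P p \<Longrightarrow> P q \<Longrightarrow> P (p + q)"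
    "\<And>x a. x \<in> X \<Longrightarrow> P (trm x a)"
  shows "P p"
proof -
  have "p \<in> supported X \<and> P p"
  proof (rule supp_induct[where X = X and P = "\<lambda>p. p \<in> supported X \<and> P p"])
    show "supp p \<subseteq> X" using assms(1) by (simp add: supported_def)
  qed (use assms(2-4) in auto)
  then show ?thesis ..
qed

definition lin_ext :: "('x \<Rightarrow> ('y \<Rightarrow>\<^sub>0 'r::comm_ring_1)) \<Rightarrow> ('x \<Rightarrow>\<^sub>0 'r) \<Rightarrow> ('y \<Rightarrow>\<^sub>0 'r)" where
  "lin_ext h p = (\<Sum>x\<in>supp p. scale (cf p x) (h x))"

lemma lin_ext_superset:
  assumes "finite A" "supp p \<subseteq> A"
  shows "lin_ext h p = (\<Sum>x\<in>A. scale (cf p x) (h x))"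
  unfolding lin_ext_def using assms by (intro sum.mono_neutral_left) (auto simp: in_keys_iff)

lemma lin_ext_add: "lin_ext h (p + q) = lin_ext h p + lin_ext h q"
proof -
  let ?A = "supp p \<union> supp q"
  have "lin_ext h (p + q) = (\<Sum>x\<in>?A. scale (cf (p + q) x) (h x))"
    by (rule lin_ext_superset) (use keys_add[of p q] in auto)
  also have "\<dots> = (\<Sum>x\<in>?A. scale (cf p x) (h x)) + (\<Sum>x\<in>?A. scale (cf q x) (h x))"
    by (simp add: lookup_add scale_add_left sum.distrib)
  also have "\<dots> = lin_ext h p + lin_ext h q"
    by (subst (1 2) lin_ext_superset[where A = ?A]) auto
  finally show ?thesis .
qed

lemma lin_ext_zero [simp]: "lin_ext h 0 = 0"
  by (simp add: lin_ext_def)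

lemma lin_ext_scale: "lin_ext h (scale a p) = scale a (lin_ext h p)"
proof -
  have "lin_ext h (scale a p) = (\<Sum>x\<in>supp p. scale (cf (scale a p) x) (h x))"
    by (rule lin_ext_superset) (auto simp: in_keys_iff lookup_scale)
  then show ?thesis by (simp add: lin_ext_def lookup_scale scale_sum scale_scale)
qed

lemma lin_ext_trm [simp]: "lin_ext h (trm x a) = scale a (h x)"
  by (subst lin_ext_superset[where A = "{x}"]) auto

lemma lin_ext_uminus: "lin_ext h (- p) = - lin_ext h p"
  using lin_ext_scale[of h "-1" p] by (simp add: scale_uminus_left)

lemma lin_ext_diff: "lin_ext h (p - q) = lin_ext h p - lin_ext h q"
  using lin_ext_add[of h p "- q"] by (simp add: lin_ext_uminus)

lemma lin_ext_sum: "lin_ext h (sum f A) = (\<Sum>x\<in>A. lin_ext h (f x))"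
  by (induction A rule: infinite_finite_induct) (simp_all add: lin_ext_add)

lemma lin_ext_supported:
  assumes "p \<in> supported X" "\<And>x. x \<in> X \<Longrightarrow> h x \<in> supported Y"
  shows "lin_ext h p \<in> supported Y"
  using assms(1) by (induction rule: supported_induct) (auto simp: lin_ext_add assms(2))

lemma lin_ext_cong:
  assumes "p \<in> supported X" "\<And>x. x \<in> X \<Longrightarrow> h x = k x"
  shows "lin_ext h p = lin_ext k p"
  using assms by (auto simp: lin_ext_def supported_def intro!: sum.cong)

lemma lin_ext_lin_ext: "lin_ext h (lin_ext k p) = lin_ext (\<lambda>x. lin_ext h (k x)) p"
  by (simp add: lin_ext_def[of k] lin_ext_sum lin_ext_scale) (simp add: lin_ext_def)

lemma push_eq: "push h p = lin_ext (\<lambda>x. mon (h x)) p"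
  by (simp add: push_def lin_ext_def)

lemma incl_eq: "incl p = lin_ext (\<lambda>x. mon [x]) p"
  by (simp add: incl_def push_eq)

lemma ass_map_eq: "ass_map f p = lin_ext (\<lambda>w. prod_list (map (\<lambda>b. incl (f (mon b))) w)) p"
  by (simp add: ass_map_def lin_ext_def)

lemma delta_eq: "delta p = lin_ext delta_word p"
  by (simp add: delta_def lin_ext_def)

lemma mon_mult_mon: "(mon u :: ('b, 'r::comm_ring_1) tens) * mon v = mon (u @ v)"
  by (simp add: mult_single plus_list_def)

lemma mon_mult_mon_left: "(mon u :: ('b, 'r::comm_ring_1) tens) * (mon v * p) = mon (u @ v) * p"
  by (simp add: mon_mult_mon flip: mult.assoc)

lemma trm_mult_trm: "(trm u a :: ('b, 'r::comm_ring_1) tens) * trm v b = trm (u @ v) (a * b)"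
  by (simp add: mult_single plus_list_def)

lemma mon_Nil [simp]: "(mon [] :: ('b, 'r::comm_ring_1) tens) = 1"
  using single_one[where 'a = "'b list" and 'b = 'r] by (simp add: zero_list_def)

lemma scale_eq_mult: "scale a p = trm [] a * (p :: ('b, 'r::comm_ring_1) tens)"
  by (simp add: scale_def mult_map_scale_conv_mult zero_list_def)

lemma scale_mult_left: "scale a p * q = scale a (p * q)" for p :: "('b, 'r::comm_ring_1) tens"
  by (simp add: scale_eq_mult mult.assoc)

lemma scale_mult_right: "p * scale a q = scale a (p * q)" for p :: "('b, 'r::comm_ring_1) tens"
proof -
  have "p * trm [] a = trm [] a * p"
    using supported_UNIV[of p]
    by (induction rule: supported_induct) (simp_all add: distrib_left distrib_right trm_mult_trm mult.commute)
  then show ?thesis by (simp add: scale_eq_mult flip: mult.assoc)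
qed

lemma mult_supported:
  fixes p q :: "('b, 'r::comm_ring_1) tens"
  assumes "p \<in> supported X" "q \<in> supported Y" "\<And>u v. u \<in> X \<Longrightarrow> v \<in> Y \<Longrightarrow> u @ v \<in> Z"
  shows "p * q \<in> supported Z"
  using assms(1)
proof (induction rule: supported_induct)
  case (trm u a)
  show ?case using assms(2)
    by (induction rule: supported_induct) (auto simp: distrib_left trm_mult_trm assms(3) trm)
qed (simp_all add: distrib_right)

lemma carrier_free_mod: "carrier (free_mod B) = supported B"
  by (simp add: free_mod_def supported_def)
lemma carrier_ass_alg: "carrier (ass_alg B) = supported (lists B - {[]})"
  by (simp add: ass_alg_def supported_def)
lemma ass_alg_simps [simp]: "add (ass_alg B) = (+)" "zero (ass_alg B) = 0" "smult (ass_alg B) = scale"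
   "mult (ass_alg B) = (*)"
  by (simp_all add: ass_alg_def)
lemma free_mod_simps [simp]: "add (free_mod B) = (+)" "zero (free_mod B) = 0" "smult (free_mod B) = scale"
  by (simp_all add: free_mod_def)
lemma der_mod_simps [simp]: "carrier (der_mod B) = Der B" "add (der_mod B) = (\<lambda>d e p. d p + e p)"
  "zero (der_mod B) = (\<lambda>_. 0)" "smult (der_mod B) = (\<lambda>a d p. scale a (d p))" "mult (der_mod B) = prelie B"
  by (simp_all add: der_mod_def)

section \<open>Derivations with prescribed values on letters\<close>

text \<open>
  The Leibniz rule on a word, for a derivation whose value on each letter \<open>b\<close> is \<open>g b\<close>. It needs no
  basis set, so \<open>dmap\<close> below is defined on all of the tensor algebra; \<open>dext\<close> cuts it down to the map
  that vanishes outside the free algebra on \<open>B\<close>, the normal form used by \<open>Der\<close>.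
\<close>

fun dword :: "('b \<Rightarrow> ('b, 'r::comm_ring_1) tens) \<Rightarrow> 'b list \<Rightarrow> ('b, 'r) tens" where
  "dword g [] = 0"
| "dword g (b # w) = g b * mon w + mon [b] * dword g w"

definition dmap :: "('b \<Rightarrow> ('b, 'r::comm_ring_1) tens) \<Rightarrow> ('b, 'r) tens \<Rightarrow> ('b, 'r) tens" where
  "dmap g = lin_ext (dword g)"

definition dext :: "'b set \<Rightarrow> ('b \<Rightarrow> ('b, 'r::comm_ring_1) tens) \<Rightarrow> ('b, 'r) tens \<Rightarrow> ('b, 'r) tens" where
  "dext B g p = (if p \<in> carrier (ass_alg B) then dmap g p else 0)"

lemma dword_append: "dword g (u @ v) = dword g u * mon v + mon u * dword g v"
  by (induction u) (simp_all add: distrib_left distrib_right mult.assoc mon_mult_mon mon_mult_mon_left)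

lemma dmap_mon [simp]: "dmap g (mon w) = dword g w"
  by (simp add: dmap_def)

lemma dmap_add: "dmap g (p + q) = dmap g p + dmap g q"
  by (simp add: dmap_def lin_ext_add)

lemma dmap_scale: "dmap g (scale a p) = scale a (dmap g p)"
  by (simp add: dmap_def lin_ext_scale)

lemma dmap_mult: "dmap g (p * q) = dmap g p * q + p * dmap g q"
  using supported_UNIV[of p]
proof (induction rule: supported_induct)
  case (trm u a)
  show ?case using supported_UNIV[of q]
  proof (induction rule: supported_induct)
    case (trm v b)
    have u: "trm u a = scale a (mon u)" and v: "trm v b = scale b (mon v)"
      by simp_all
    show ?case
      unfolding u v scale_mult_left scale_mult_right dmap_scale
      by (simp only: mon_mult_mon dmap_mon dword_append scale_add_right scale_scale mult.commute[of b a])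
  qed (simp_all add: dmap_add algebra_simps, simp add: dmap_def)
qed (simp_all add: dmap_add algebra_simps, simp add: dmap_def)

lemma dword_sum:
  "dword g w = (\<Sum>i<length w. mon (take i w) * g (w ! i) * mon (drop (Suc i) w))"
proof (induction w)
  case (Cons b w)
  have "(\<Sum>i<length (b # w). mon (take i (b # w)) * g ((b # w) ! i) * mon (drop (Suc i) (b # w))) =
    g b * mon w + (\<Sum>i<length w. mon [b] * (mon (take i w) * g (w ! i) * mon (drop (Suc i) w)))"
    by (simp add: sum.lessThan_Suc_shift mult.assoc mon_mult_mon_left del: sum.lessThan_Suc)
  then show ?case by (simp add: Cons sum_distrib_left)
qed simp

lemma dword_cong: "(\<And>b. b \<in> set w \<Longrightarrow> g b = h b) \<Longrightarrow> dword g w = dword h w"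
  by (induction w) auto

lemma dword_zero [simp]: "dword (\<lambda>_. 0) w = 0"
  by (induction w) auto

lemma dmap_zero [simp]: "dmap g 0 = 0"
  by (simp add: dmap_def)

lemma dmap_trm: "dmap g (trm w a) = scale a (dword g w)"
  by (simp add: dmap_def)

lemma dword_add_left: "dword (\<lambda>b. g b + h b) w = dword g w + dword h w"
  by (induction w) (simp_all add: algebra_simps)

lemma dmap_add_left: "dmap (\<lambda>b. g b + h b) p = dmap g p + dmap h p"
  using supported_UNIV[of p]
  by (induction rule: supported_induct) (simp_all add: dmap_add dmap_trm dword_add_left scale_add_right algebra_simps)

lemma dword_scale_left: "dword (\<lambda>b. scale a (g b)) w = scale a (dword g w)"
  by (induction w) (simp_all add: scale_add_right scale_mult_left scale_mult_right)

lemma dmap_scale_left: "dmap (\<lambda>b. scale a (g b)) p = scale a (dmap g p)"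
  using supported_UNIV[of p]
  by (induction rule: supported_induct) (simp_all add: dmap_add dmap_trm dword_scale_left scale_add_right scale_scale mult.commute)

text \<open>
  The degree filtration: a derivation has positive degree when its values on letters lie in
  \<open>words 2\<close>.
\<close>

definition words :: "nat \<Rightarrow> 'b set \<Rightarrow> 'b list set" where
  "words k B = {w \<in> lists B. k \<le> length w}"

lemma carrier_ass_alg_words: "carrier (ass_alg B) = supported (words (Suc 0) B)"
  unfolding carrier_ass_alg words_def by (rule arg_cong[where f = supported]) (auto simp: Suc_le_eq)

lemma words_mono: "j \<le> k \<Longrightarrow> words k B \<subseteq> words j B"
  by (auto simp: words_def)

lemma words_append: "u \<in> words j B \<Longrightarrow> v \<in> words k B \<Longrightarrow> u @ v \<in> words (j + k) B"
  by (auto simp: words_def)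

lemma mult_supported_words:
  fixes p q :: "('b, 'r::comm_ring_1) tens"
  shows "p \<in> supported (words j B) \<Longrightarrow> q \<in> supported (words k B) \<Longrightarrow> p * q \<in> supported (words (j + k) B)"
  by (rule mult_supported) (auto intro: words_append)

text \<open>If the values of \<open>g\<close> have length at least \<open>k + 1\<close>, then \<open>g\<close> raises lengths by at least \<open>k\<close>.\<close>

lemma dword_supported:
  fixes g :: "'b \<Rightarrow> ('b, 'r::comm_ring_1) tens"
  assumes "\<And>b. b \<in> B \<Longrightarrow> g b \<in> supported (words (Suc k) B)" "w \<in> lists B"
  shows "dword g w \<in> supported (words (k + length w) B)"
  using assms(2)
proof (induction w)
  case (Cons b w)
  have "g b * mon w \<in> supported (words (Suc k + length w) B)"
    using Cons assms(1) by (intro mult_supported_words) (auto simp: words_def)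
  moreover have "mon [b] * dword g w \<in> supported (words (Suc 0 + (k + length w)) B)"
    using Cons by (intro mult_supported_words) (auto simp: words_def)
  ultimately show ?case by auto
qed simp

lemma dmap_supported:
  fixes g :: "'b \<Rightarrow> ('b, 'r::comm_ring_1) tens"
  assumes "\<And>b. b \<in> B \<Longrightarrow> g b \<in> supported (words (Suc k) B)" "p \<in> supported (words j B)"
  shows "dmap g p \<in> supported (words (k + j) B)"
  unfolding dmap_def using assms(2)
proof (rule lin_ext_supported)
  fix w assume "w \<in> words j B"
  then show "dword g w \<in> supported (words (k + j) B)"
    using dword_supported[of B g k w] assms(1) words_mono[of "k + j" "k + length w" B]
    by (auto simp: words_def supported_def)
qed

lemma dext_in_Der:
  fixes g :: "'b \<Rightarrow> ('b, 'r::comm_ring_1) tens"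
  assumes "\<And>b. b \<in> B \<Longrightarrow> g b \<in> supported (words (Suc 0) B)"
  shows "dext B g \<in> Der B"
proof -
  have val: "dmap g p \<in> supported (words (Suc 0) B)" if "p \<in> supported (words (Suc 0) B)" for p
    using dmap_supported[of B g 0 p "Suc 0"] that assms by simp
  have prod: "p * q \<in> supported (words (Suc 0) B)" if "p \<in> supported (words (Suc 0) B)" "q \<in> supported (words (Suc 0) B)"
    for p q :: "('b, 'r) tens"
    by (rule supported_mono[OF mult_supported_words[OF that] words_mono]) simp
  show ?thesis
    unfolding Der_def lin_maps_def carrier_ass_alg_words ass_alg_simps mem_Collect_eq
  proof (intro conjI ballI allI impI funcsetI)
    fix p q :: "('b, 'r) tens" assume p: "p \<in> supported (words (Suc 0) B)"
    then show "dext B g p \<in> supported (words (Suc 0) B)" by (simp add: dext_def carrier_ass_alg_words val)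
    show "dext B g (scale a p) = scale a (dext B g p)" for a
      using p by (simp add: dext_def carrier_ass_alg_words dmap_scale)
    assume q: "q \<in> supported (words (Suc 0) B)"
    show "dext B g (p + q) = dext B g p + dext B g q"
      using p q by (simp add: dext_def carrier_ass_alg_words dmap_add)
    show "dext B g (p * q) = dext B g p * q + p * dext B g q"
      using p q prod[OF p q] by (simp add: dext_def carrier_ass_alg_words dmap_mult)
  qed (simp add: dext_def carrier_ass_alg_words)
qed

text \<open>
  Letters generate the free algebra: the Leibniz rule and induction on the length of a word leave
  no freedom once the values on letters are known.
\<close>

lemma Der_eq_dext:
  fixes D :: "('b, 'r::comm_ring_1) tens \<Rightarrow> ('b, 'r) tens"
  assumes D: "D \<in> Der B" and g: "\<And>b. b \<in> B \<Longrightarrow> D (mon [b]) = g b"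
  shows "D = dext B g"
proof
  fix p
  have add: "D (p + q) = D p + D q" and mult: "D (p * q) = D p * q + p * D q"
    if "p \<in> supported (words (Suc 0) B)" "q \<in> supported (words (Suc 0) B)" for p q
    using D that by (auto simp: Der_def lin_maps_def carrier_ass_alg_words)
  have scl: "D (scale a p) = scale a (D p)" if "p \<in> supported (words (Suc 0) B)" for p a
    using D that by (auto simp: Der_def lin_maps_def carrier_ass_alg_words)
  have word: "D (mon w) = dword g w" if "w \<in> words (Suc 0) B" for w
    using that
  proof (induction w)
    case (Cons b w)
    show ?case
    proof (cases "w = []")
      case False
      then have "w \<in> words (Suc 0) B" "[b] \<in> words (Suc 0) B"
        using Cons.prems by (auto simp: words_def Suc_le_eq)
      with Cons g mult[of "mon [b]" "mon w"] show ?thesis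
        by (auto simp: mon_mult_mon words_def)
    qed (use Cons.prems g in \<open>auto simp: words_def\<close>)
  qed (simp add: words_def)
  show "D p = dext B g p"
  proof (cases "p \<in> supported (words (Suc 0) B)")
    case True
    then have "D p = dmap g p"
    proof (induction rule: supported_induct)
      case zero
      then show ?case using scl[of 0 0] by simp
    next
      case (trm w a)
      then show ?case using scl[of "mon w" a] word[of w] by (simp add: dmap_trm)
    qed (simp add: add dmap_add)
    with True show ?thesis by (simp add: dext_def carrier_ass_alg_words)
  qed (use D in \<open>auto simp: Der_def dext_def carrier_ass_alg_words\<close>)
qed

lemma dext_mon: "b \<in> B \<Longrightarrow> dext B g (mon [b]) = g b"
  by (simp add: dext_def carrier_ass_alg_words words_def)

lemma dext_apply: "p \<in> supported (words (Suc 0) B) \<Longrightarrow> dext B g p = dmap g p"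
  by (simp add: dext_def carrier_ass_alg_words)

lemma dext_cong:
  assumes "\<And>b. b \<in> B \<Longrightarrow> g b = h b" shows "dext B g = dext B h"
proof
  fix p
  show "dext B g p = dext B h p"
    unfolding dext_def dmap_def carrier_ass_alg using assms
    by (auto intro!: lin_ext_cong dword_cong)
qed

lemma Der_values:
  assumes "D \<in> Der B" "p \<in> supported (words (Suc 0) B)" shows "D p \<in> supported (words (Suc 0) B)"
  using assms by (auto simp: Der_def lin_maps_def carrier_ass_alg_words)

lemma Der_eqI:
  assumes "D \<in> Der B" "E \<in> Der B" "\<And>b. b \<in> B \<Longrightarrow> D (mon [b]) = E (mon [b])"
  shows "D = E"
  using Der_eq_dext[OF assms(1,3)] Der_eq_dext[OF assms(2) refl] by metis

lemma incl_trm: "incl (trm b a) = trm [b] a"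
  by (simp add: incl_eq)

lemma incl_supported: "v \<in> supported B \<Longrightarrow> incl v \<in> supported (words (Suc 0) B)"
  unfolding incl_eq by (erule lin_ext_supported) (auto simp: words_def)

lemma incl_add: "incl (p + q) = incl p + incl q" and incl_scale: "incl (scale a p) = scale a (incl p)"
  by (simp_all add: incl_eq lin_ext_add lin_ext_scale)

lemma der_ext_eq:
  fixes f :: "('b \<Rightarrow>\<^sub>0 'r::comm_ring_1) \<Rightarrow> ('b, 'r) tens"
  assumes f: "f \<in> lin_maps (free_mod B) (ass_alg B)"
  shows "der_ext B f = dext B (\<lambda>b. f (mon b))"
  unfolding der_ext_def
proof (rule the_equality)
  have val: "f (mon b) \<in> supported (words (Suc 0) B)" if "b \<in> B" for b
    using f that by (auto simp: lin_maps_def carrier_ass_alg_words carrier_free_mod)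
  have D: "dext B (\<lambda>b. f (mon b)) \<in> Der B"
    using val by (rule dext_in_Der)
  have "dext B (\<lambda>b. f (mon b)) (incl v) = f v" if "v \<in> supported B" for v
    unfolding dext_apply[OF incl_supported[OF that]] using that
  proof (induction rule: supported_induct)
    case zero
    have "f (scale 0 0) = scale 0 (f 0)"
      using f by (simp add: lin_maps_def carrier_free_mod del: scale_zero_left scale_zero_right)
    then show ?case by (simp add: incl_eq)
  next
    case (add p q)
    then show ?case using f by (simp add: incl_add dmap_add lin_maps_def carrier_free_mod)
  next
    case (trm b a)
    have "f (scale a (mon b)) = scale a (f (mon b))"
      using f trm by (simp add: lin_maps_def carrier_free_mod del: scale_trm)
    then show ?case by (simp add: incl_trm dmap_trm)
  qed
  with D show "dext B (\<lambda>b. f (mon b)) \<in> Der B \<and>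
      (\<forall>v\<in>carrier (free_mod B). dext B (\<lambda>b. f (mon b)) (incl v) = f v)"
    by (simp add: carrier_free_mod)
next
  fix D assume "D \<in> Der B \<and> (\<forall>v\<in>carrier (free_mod B). D (incl v) = f v)"
  then have D: "D \<in> Der B" and eq: "D (incl v) = f v" if "v \<in> supported B" for v
    using that by (auto simp: carrier_free_mod)
  have "D (mon [b]) = f (mon b)" if "b \<in> B" for b
    using eq[of "mon b"] that by (simp add: incl_trm)
  with D show "D = dext B (\<lambda>b. f (mon b))"
    by (intro Der_eq_dext) auto
qed

lemma prelie_dext:
  fixes g h :: "'b \<Rightarrow> ('b, 'r::comm_ring_1) tens"
  assumes g: "\<And>b. b \<in> B \<Longrightarrow> g b \<in> supported (words (Suc 0) B)"
    and h: "\<And>b. b \<in> B \<Longrightarrow> h b \<in> supported (words (Suc 0) B)"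
  shows "prelie B (dext B g) (dext B h) = dext B (\<lambda>b. dmap h (g b))"
proof -
  have val: "dmap g (incl v) \<in> supported (words (Suc 0) B)" if "v \<in> supported B" for v
    using dmap_supported[of B g 0 "incl v" "Suc 0"] g incl_supported[OF that] by simp
  have val2: "dmap h p \<in> supported (words (Suc 0) B)" if "p \<in> supported (words (Suc 0) B)" for p
    using dmap_supported[of B h 0 p "Suc 0"] h that by simp
  have "(\<lambda>v. dext B h (dext B g (incl v))) \<in> lin_maps (free_mod B) (ass_alg B)"
    by (auto simp: lin_maps_def carrier_free_mod carrier_ass_alg_words dext_apply incl_supported
      incl_add incl_scale dmap_add dmap_scale val val2)
  then show ?thesis
    unfolding prelie_def
    by (subst der_ext_eq) (auto simp: incl_trm dext_mon dext_apply g intro: dext_cong)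
qed

section \<open>Modules and submodules\<close>

lemma scalars_simps [simp]: "carrier scalars = UNIV" "add scalars = (+)" "mult scalars = (*)"
  "zero scalars = 0" "one scalars = 1"
  by (simp_all add: scalars_def)

lemma cring_scalars: "cring (scalars :: 'r::comm_ring_1 ring)"
proof (rule cringI)
  show "abelian_group (scalars :: 'r ring)"
  proof (rule abelian_groupI)
    fix x :: 'r show "\<exists>y\<in>carrier scalars. y \<oplus>\<^bsub>scalars\<^esub> x = \<zero>\<^bsub>scalars\<^esub>"
      by (auto intro: exI[of _ "- x"])
  qed (simp_all add: algebra_simps)
  show "Group.comm_monoid (scalars :: 'r ring)"
    by (rule comm_monoidI) (simp_all add: algebra_simps)
qed (simp add: algebra_simps)

lemma scalar_moduleI:
  fixes M :: "('r::comm_ring_1, 'm) module" (structure)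
  assumes "\<And>x y. x \<in> carrier M \<Longrightarrow> y \<in> carrier M \<Longrightarrow> x \<oplus> y \<in> carrier M" "\<zero> \<in> carrier M"
    "\<And>a x. x \<in> carrier M \<Longrightarrow> a \<odot> x \<in> carrier M"
    "\<And>x y z. x \<in> carrier M \<Longrightarrow> y \<in> carrier M \<Longrightarrow> z \<in> carrier M \<Longrightarrow> (x \<oplus> y) \<oplus> z = x \<oplus> (y \<oplus> z)"
    "\<And>x y. x \<in> carrier M \<Longrightarrow> y \<in> carrier M \<Longrightarrow> x \<oplus> y = y \<oplus> x"
    "\<And>x. x \<in> carrier M \<Longrightarrow> \<zero> \<oplus> x = x"
    "\<And>x. x \<in> carrier M \<Longrightarrow> (-1) \<odot> x \<oplus> x = \<zero>"
    "\<And>a b x. x \<in> carrier M \<Longrightarrow> (a + b) \<odot> x = a \<odot> x \<oplus> b \<odot> x"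
    "\<And>a x y. x \<in> carrier M \<Longrightarrow> y \<in> carrier M \<Longrightarrow> a \<odot> (x \<oplus> y) = a \<odot> x \<oplus> a \<odot> y"
    "\<And>a b x. x \<in> carrier M \<Longrightarrow> (a * b) \<odot> x = a \<odot> (b \<odot> x)"
    "\<And>x. x \<in> carrier M \<Longrightarrow> 1 \<odot> x = x"
  shows "module scalars M"
proof (rule moduleI[OF cring_scalars])
  show "abelian_group M"
  proof (rule abelian_groupI)
    fix x assume "x \<in> carrier M"
    then show "\<exists>y\<in>carrier M. y \<oplus> x = \<zero>" using assms(3,7) by blast
  qed (use assms in auto)
qed (use assms in auto)

lemma module_minus_one:
  fixes M :: "('r::comm_ring_1, 'm) module"
  assumes "module scalars M" "x \<in> carrier M"
  shows "\<ominus>\<^bsub>M\<^esub> x = (-1) \<odot>\<^bsub>M\<^esub> x"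
proof -
  interpret M: module scalars M by fact
  have "\<ominus>\<^bsub>scalars\<^esub> (1::'r) = -1"
    by (rule M.R.minus_equality) auto
  then show ?thesis using M.smult_l_minus[of 1 x] M.smult_one[OF assms(2)] assms(2) by simp
qed

lemma scalar_submoduleI:
  fixes M :: "('r::comm_ring_1, 'm) module"
  assumes M: "module scalars M" and "H \<subseteq> carrier M" "\<zero>\<^bsub>M\<^esub> \<in> H"
    "\<And>x y. x \<in> H \<Longrightarrow> y \<in> H \<Longrightarrow> x \<oplus>\<^bsub>M\<^esub> y \<in> H" "\<And>a x. x \<in> H \<Longrightarrow> a \<odot>\<^bsub>M\<^esub> x \<in> H"
  shows "submodule H scalars M"
  using assms by (intro module.submoduleI[OF M]) (auto simp: module_minus_one[OF M] subset_iff)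

lemma submoduleD:
  fixes M :: "('r::comm_ring_1, 'm) module"
  assumes "submodule H scalars M"
  shows "\<zero>\<^bsub>M\<^esub> \<in> H" "\<And>x y. x \<in> H \<Longrightarrow> y \<in> H \<Longrightarrow> x \<oplus>\<^bsub>M\<^esub> y \<in> H"
    "\<And>a x. x \<in> H \<Longrightarrow> a \<odot>\<^bsub>M\<^esub> x \<in> H" "H \<subseteq> carrier M"
    "\<And>x y. x \<in> H \<Longrightarrow> y \<in> H \<Longrightarrow> x \<ominus>\<^bsub>M\<^esub> y \<in> H"
proof -
  interpret submodule H scalars M by fact
  show "\<zero>\<^bsub>M\<^esub> \<in> H" "\<And>x y. x \<in> H \<Longrightarrow> y \<in> H \<Longrightarrow> x \<oplus>\<^bsub>M\<^esub> y \<in> H"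
    "\<And>a x. x \<in> H \<Longrightarrow> a \<odot>\<^bsub>M\<^esub> x \<in> H" "H \<subseteq> carrier M"
    using one_closed m_closed smult_closed subset by auto
  show "\<And>x y. x \<in> H \<Longrightarrow> y \<in> H \<Longrightarrow> x \<ominus>\<^bsub>M\<^esub> y \<in> H"
    using m_closed m_inv_closed by (simp add: a_minus_def a_inv_def)
qed

lemma submodule_Inter:
  fixes M :: "('r::comm_ring_1, 'm) module"
  assumes M: "module scalars M" and "\<H> \<noteq> {}" "\<And>H. H \<in> \<H> \<Longrightarrow> submodule H scalars M"
  shows "submodule (\<Inter>\<H>) scalars M"
proof (rule scalar_submoduleI[OF M])
  show "\<Inter>\<H> \<subseteq> carrier M" using assms(2) submoduleD(4)[OF assms(3)] by blast
qed (use submoduleD[OF assms(3)] in auto)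

lemma submodule_hull:
  fixes M :: "('r::comm_ring_1, 'm) module"
  assumes M: "module scalars M" and "\<And>N. P N \<Longrightarrow> submodule N scalars M" "P N" "S \<subseteq> N"
  shows "submodule (P hull S) scalars M"
  unfolding hull_def using assms by (intro submodule_Inter) auto

lemma gen_submodule_submodule:
  fixes M :: "('r::comm_ring_1, 'm) module"
  assumes "module scalars M" "S \<subseteq> carrier M"
  shows "submodule (gen_submodule M S) scalars M"
  unfolding gen_submodule_def
  using submodule_hull[of M "\<lambda>N. submodule N scalars M", OF assms(1)]
    module.carrier_is_submodule[OF assms(1)] assms(2) by blast

lemma gen_submodule_minimal: "submodule N scalars M \<Longrightarrow> S \<subseteq> N \<Longrightarrow> gen_submodule M S \<subseteq> N"
  unfolding gen_submodule_def by (rule hull_minimal)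

lemma gen_submodule_inc: "x \<in> S \<Longrightarrow> x \<in> gen_submodule M S"
  unfolding gen_submodule_def by (rule hull_inc)

lemma submodule_restrict:
  fixes M :: "('r::comm_ring_1, 'm) module"
  assumes "module scalars M" "submodule H scalars M"
  shows "module scalars (M\<lparr>carrier := H\<rparr>)"
  using submodule.submodule_is_module[OF assms(2,1)] .

section \<open>The module of derivations\<close>

lemma dext_zero: "dext B (\<lambda>_. 0) = (\<lambda>_. 0)"
proof
  fix p :: "('a, 'b) tens"
  show "dext B (\<lambda>_. 0) p = 0"
    by (simp add: dext_def dmap_def lin_ext_def)
qed

lemma dext_add: "(\<lambda>p. dext B g p + dext B h p) = dext B (\<lambda>b. g b + h b)"
  by (auto simp: dext_def fun_eq_iff dmap_add_left)

lemma dext_scale: "(\<lambda>p. scale a (dext B g p)) = dext B (\<lambda>b. scale a (g b))"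
  by (auto simp: dext_def fun_eq_iff dmap_scale_left)

lemma Der_dextE:
  fixes D :: "('b, 'r::comm_ring_1) tens \<Rightarrow> ('b, 'r) tens"
  assumes "D \<in> Der B"
  obtains g where "D = dext B g" "\<And>b. b \<in> B \<Longrightarrow> g b \<in> supported (words (Suc 0) B)"
    "\<And>b. b \<in> B \<Longrightarrow> D (mon [b]) = g b"
proof
  show "D = dext B (\<lambda>b. D (mon [b]))" by (rule Der_eq_dext[OF assms refl])
  show "D (mon [b]) \<in> supported (words (Suc 0) B)" if "b \<in> B" for b
    using that by (intro Der_values[OF assms]) (auto simp: words_def)
qed simp

lemma Der_add: "D \<in> Der B \<Longrightarrow> E \<in> Der B \<Longrightarrow> (\<lambda>p. D p + E p) \<in> Der B"
  by (elim Der_dextE) (auto simp: dext_add intro!: dext_in_Der)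

lemma Der_scale: "D \<in> Der B \<Longrightarrow> (\<lambda>p. scale a (D p)) \<in> Der B"
  by (elim Der_dextE) (auto simp: dext_scale intro!: dext_in_Der)

lemma Der_zero: "(\<lambda>_. 0) \<in> Der B"
  using dext_in_Der[of B "\<lambda>_. 0"] by (simp add: dext_zero)

lemma module_der_mod: "module scalars (der_mod B :: ('r::comm_ring_1, ('b, 'r) tens \<Rightarrow> ('b, 'r) tens) module)"
  by (rule scalar_moduleI)
    (auto simp: Der_add Der_scale Der_zero algebra_simps scale_add_left scale_add_right scale_scale
      scale_uminus_left fun_eq_iff)

lemma der_mod_minus:
  assumes "D \<in> Der B" "E \<in> Der B"
  shows "D \<ominus>\<^bsub>der_mod B\<^esub> E = (\<lambda>p. D p - E p)"
  using module_minus_one[OF module_der_mod, of E B] assms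
  by (simp add: a_minus_def fun_eq_iff scale_uminus_left)

lemma prelie_Der: "D \<in> Der B \<Longrightarrow> E \<in> Der B \<Longrightarrow> prelie B D E \<in> Der B"
proof (elim Der_dextE, goal_cases)
  case (1 g h)
  have "dmap h (g b) \<in> supported (words (Suc 0) B)" if "b \<in> B" for b
    using dmap_supported[of B h 0 "g b" "Suc 0"] 1 that by simp
  then show ?case using 1 by (simp add: prelie_dext dext_in_Der)
qed

lemma dext_diff: "(\<lambda>p. dext B g p - dext B h p) = dext B (\<lambda>b. g b - h b)"
proof -
  have "dext B (\<lambda>b. (g b - h b) + h b) = (\<lambda>p. dext B (\<lambda>b. g b - h b) p + dext B h p)"
    by (rule dext_add[symmetric])
  then show ?thesis by (auto simp: fun_eq_iff algebra_simps)
qed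

lemma bracket_dext:
  fixes g h :: "'b \<Rightarrow> ('b, 'r::comm_ring_1) tens"
  assumes "\<And>b. b \<in> B \<Longrightarrow> g b \<in> supported (words (Suc 0) B)"
    and "\<And>b. b \<in> B \<Longrightarrow> h b \<in> supported (words (Suc 0) B)"
  shows "der_bracket B (dext B g) (dext B h) = dext B (\<lambda>b. dmap h (g b) - dmap g (h b))"
proof -
  have Der: "dext B g \<in> Der B" "dext B h \<in> Der B"
    by (rule dext_in_Der, rule assms, assumption)+
  show ?thesis
    unfolding der_bracket_def der_mod_minus[OF prelie_Der[OF Der] prelie_Der[OF Der(2,1)]]
    by (simp add: assms prelie_dext dext_diff)
qed

lemma ass_homog_eq: "ass_homog (Suc n) B = supported {w \<in> lists B. length w = Suc n}"
  by (auto simp: ass_homog_def carrier_ass_alg supported_def)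

lemma dext_in_Der_deg:
  fixes g :: "'b \<Rightarrow> ('b, 'r::comm_ring_1) tens"
  assumes "\<And>b. b \<in> B \<Longrightarrow> g b \<in> supported {w \<in> lists B. length w = Suc k}"
  shows "dext B g \<in> Der_deg k B"
  unfolding Der_deg_def mem_Collect_eq
proof (intro conjI ballI)
  have "g b \<in> supported (words (Suc 0) B)" if "b \<in> B" for b
    by (rule supported_mono[OF assms[OF that]]) (auto simp: words_def)
  then show "dext B g \<in> Der B" by (rule dext_in_Der)
  fix v :: "'b \<Rightarrow>\<^sub>0 'r" assume "v \<in> carrier (free_mod B)"
  then have v: "v \<in> supported B" by (simp add: carrier_free_mod)
  have "dmap g (incl v) \<in> supported {w \<in> lists B. length w = Suc k}"
    using v by (induction rule: supported_induct)
      (auto simp: incl_add dmap_add incl_trm dmap_trm assms, simp add: incl_eq)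
  then show "dext B g (incl v) \<in> ass_homog (k + 1) B"
    using v by (simp add: dext_apply incl_supported ass_homog_eq)
qed

section \<open>The Lie algebra generated in degree one\<close>

text \<open>
  Brackets are computed on letters, so membership in the Lie algebra is expressed through the
  values on letters.
\<close>

definition lie :: "'b set \<Rightarrow> ('b \<Rightarrow> ('b, 'r::comm_ring_1) tens) \<Rightarrow> bool" where
  "lie C g \<longleftrightarrow> dext C g \<in> Der_Lie1 C"

lemma Der_Lie1_closed:
  shows "D \<in> Der_Lie1 C \<Longrightarrow> E \<in> Der_Lie1 C \<Longrightarrow> (\<lambda>p. D p + E p) \<in> Der_Lie1 C"
    and "D \<in> Der_Lie1 C \<Longrightarrow> (\<lambda>p. scale a (D p)) \<in> Der_Lie1 C"
    and "(\<lambda>_. 0) \<in> Der_Lie1 C"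
    and "D \<in> Der_Lie1 C \<Longrightarrow> E \<in> Der_Lie1 C \<Longrightarrow> der_bracket C D E \<in> Der_Lie1 C"
  unfolding Der_Lie1_def hull_def
  using submoduleD(1,2,3)[where M = "der_mod C", unfolded der_mod_simps] by blast+

lemma lie_add: "lie C g \<Longrightarrow> lie C h \<Longrightarrow> lie C (\<lambda>c. g c + h c)"
  unfolding lie_def by (subst dext_add[symmetric]) (rule Der_Lie1_closed)

lemma lie_scale: "lie C g \<Longrightarrow> lie C (\<lambda>c. scale a (g c))"
  unfolding lie_def by (subst dext_scale[symmetric]) (rule Der_Lie1_closed)

lemma lie_zero: "lie C (\<lambda>_. 0)"
  unfolding lie_def by (subst dext_zero) (rule Der_Lie1_closed)

lemma lie_diff: "lie C g \<Longrightarrow> lie C h \<Longrightarrow> lie C (\<lambda>c. g c - h c)"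
  using lie_add[of C g "\<lambda>c. scale (-1) (h c)"] lie_scale[of C h "-1"] by (simp add: scale_uminus_left)

lemma lie_sum: "(\<And>i. i \<in> I \<Longrightarrow> lie C (g i)) \<Longrightarrow> lie C (\<lambda>c. \<Sum>i\<in>I. g i c)"
  by (induction I rule: infinite_finite_induct) (auto simp: lie_zero lie_add)

lemma lie_cong: "(\<And>c. c \<in> C \<Longrightarrow> g c = h c) \<Longrightarrow> lie C g = lie C h"
  unfolding lie_def by (metis dext_cong)

lemma lie_degree_one:
  "(\<And>c. c \<in> C \<Longrightarrow> g c \<in> supported {w \<in> lists C. length w = 2}) \<Longrightarrow> lie C g"
  unfolding lie_def Der_Lie1_def
  by (intro hull_inc dext_in_Der_deg) (simp add: numeral_2_eq_2)

lemma lie_bracket: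
  assumes "lie C g" "lie C h" "\<And>c. c \<in> C \<Longrightarrow> g c \<in> supported (words (Suc 0) C)"
    "\<And>c. c \<in> C \<Longrightarrow> h c \<in> supported (words (Suc 0) C)"
  shows "lie C (\<lambda>c. dmap h (g c) - dmap g (h c))"
  using Der_Lie1_closed(4)[of "dext C g" C "dext C h"] assms
  unfolding lie_def by (simp add: bracket_dext)

section \<open>Elementary derivations and spare letters\<close>

text \<open>
  The values on letters of the elementary derivation \<open>b \<mapsto> p\<close>, which sends the letter \<open>b\<close> to \<open>p\<close> and
  every other letter to \<open>0\<close>.
\<close>

definition at :: "'b \<Rightarrow> ('b, 'r::comm_ring_1) tens \<Rightarrow> 'b \<Rightarrow> ('b, 'r) tens" where
  "at b p = (\<lambda>c. if c = b then p else 0)"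

lemma at_add: "at b (p + q) = (\<lambda>c. at b p c + at b q c)" by (auto simp: at_def)
lemma at_diff: "at b (p - q) = (\<lambda>c. at b p c - at b q c)" by (auto simp: at_def)
lemma at_scale: "at b (scale a p) = (\<lambda>c. scale a (at b p c))" by (auto simp: at_def)
lemma at_zero: "at b 0 = (\<lambda>_. 0)" by (auto simp: at_def)
lemma at_sum: "at b (sum f A) = (\<lambda>c. \<Sum>i\<in>A. at b (f i) c)"
  by (induction A rule: infinite_finite_induct) (auto simp: at_zero at_add)

lemma dword_at_fresh [simp]: "b \<notin> set w \<Longrightarrow> dword (at b p) w = 0"
  by (induction w) (auto simp: at_def)

lemma dword_at_once:
  assumes "b \<notin> set u" "b \<notin> set v"
  shows "dword (at b p) (u @ b # v) = mon u * p * mon v"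
  using assms by (simp add: dword_append mult.assoc) (simp add: at_def)

text \<open>
  The bracket of \<open>b \<mapsto> u\<close> and \<open>c \<mapsto> v\<close> substitutes \<open>v\<close> for each \<open>c\<close> in \<open>u\<close> in turn, and subtracts the
  derivation at \<open>c\<close> that substitutes \<open>u\<close> for each \<open>b\<close> in \<open>v\<close>. All relations below are instances in which
  one of the two letters occurs once.
\<close>

lemma lie_bracket_at:
  fixes u v :: "'b list" and U V :: "('b, 'r::comm_ring_1) tens"
  defines "U \<equiv> mon u" and "V \<equiv> mon v"
  assumes "b \<noteq> c" "u \<in> words (Suc 0) C" "v \<in> words (Suc 0) C"
    and "lie C (at b U)" "lie C (at c V)"
  shows "lie C (\<lambda>x. at b (dword (at c V) u) x - at c (dword (at b U) v) x)"
proof -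
  have "lie C (\<lambda>x. dmap (at c V) (at b U x) - dmap (at b U) (at c V x))"
    by (rule lie_bracket) (use assms in \<open>auto simp: at_def\<close>)
  also have "(\<lambda>x. dmap (at c V) (at b U x) - dmap (at b U) (at c V x)) =
    (\<lambda>x. at b (dword (at c V) u) x - at c (dword (at b U) v) x)"
  proof
    fix x
    have "at b U x = (if x = b then mon u else 0)" "at c V x = (if x = c then mon v else 0)"
      by (auto simp: at_def U_def V_def)
    then show "dmap (at c V) (at b U x) - dmap (at b U) (at c V x) =
        at b (dword (at c V) u) x - at c (dword (at b U) v) x"
      by (simp add: at_def)
  qed
  finally show ?thesis .
qed

lemma lie_at_degree_one: "u \<in> lists C \<Longrightarrow> length u = 2 \<Longrightarrow> lie C (at b (mon u))"
  by (rule lie_degree_one) (auto simp: at_def)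

text \<open>
  Split off the last letter \<open>a\<close> of the word \<open>w a\<close>: the bracket of \<open>b \<mapsto> y a\<close> and \<open>y \<mapsto> w\<close> is \<open>b \<mapsto> w a\<close>,
  since \<open>b\<close> does not occur in \<open>w\<close>. In the second factor \<open>b\<close> has become the letter to spare, so one extra
  letter suffices for the whole induction.
\<close>

lemma lie_at_fresh:
  assumes "b \<in> C" "y \<in> C" "y \<noteq> b" "w \<in> lists C" "2 \<le> length w" "b \<notin> set w" "y \<notin> set w"
  shows "lie C (at b (mon w :: ('b, 'r::comm_ring_1) tens))"
  using assms
proof (induction w arbitrary: b y rule: rev_induct)
  case (snoc a w)
  let ?m = "mon :: 'b list \<Rightarrow> ('b, 'r) tens"
  show ?case
  proof (cases "2 \<le> length w")
    case True
    have "lie C (at y (?m w))"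
      using snoc.prems True by (intro snoc.IH[of y b]) auto
    moreover have "lie C (at b (?m [y, a]))"
      using snoc.prems by (intro lie_at_degree_one) auto
    ultimately have "lie C (\<lambda>x. at b (dword (at y (?m w)) [y, a]) x - at y (dword (at b (?m [y, a])) w) x)"
      using snoc.prems True by (intro lie_bracket_at) (auto simp: words_def)
    moreover have "dword (at y (?m w)) [y, a] = ?m (w @ [a])"
      using dword_at_once[of y "[]" "[a]" "?m w"] snoc.prems by (simp add: mon_mult_mon)
    ultimately show ?thesis using snoc.prems by (simp add: at_zero)
  next
    case False
    then show ?thesis using snoc.prems by (intro lie_at_degree_one) auto
  qed
qed simp

text \<open>
  Words in \<open>X\<close> leave the letters \<open>y\<close>, \<open>z\<close> and \<open>t\<close> to spare. The letters \<open>y\<close> and \<open>z\<close> mark a place in a word;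
  \<open>t\<close> is the letter that \<open>lie_at_fresh\<close> still requires for words in which a mark occurs.
\<close>

locale three_free_letters =
  fixes X C :: "'b set" and y z t :: 'b
  assumes sub: "X \<subseteq> C" and free: "{y, z, t} \<subseteq> C - X" and distinct: "y \<noteq> z" "y \<noteq> t" "z \<noteq> t"
begin

lemma words_free: "w \<in> lists X \<Longrightarrow> y \<notin> set w \<and> z \<notin> set w \<and> t \<notin> set w \<and> w \<in> lists C"
  using sub free by (auto simp: subset_iff)

text \<open>
  This is the bracket of \<open>z \<mapsto> u y v\<close> and \<open>y \<mapsto> p z q\<close>. Each of these must have positive degree, which
  is why neither pair of words may be empty.
\<close>

lemma lie_transfer:
  assumes "p \<in> lists X" "q \<in> lists X" "u \<in> lists X" "v \<in> lists X" "p \<noteq> [] \<or> q \<noteq> []" "u \<noteq> [] \<or> v \<noteq> []"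
  shows "lie C (\<lambda>x. at z (mon (u @ p @ z # q @ v)) x - at y (mon (p @ u @ y # v @ q) :: ('b, 'r::comm_ring_1) tens) x)"
proof -
  let ?m = "mon :: 'b list \<Rightarrow> ('b, 'r) tens"
  have len: "2 \<le> length (r @ a # s)" if "r \<noteq> [] \<or> s \<noteq> []" for r s :: "'b list" and a
    using that by (cases r; cases s) auto
  note f = assms(1-4)[THEN words_free]
  have "lie C (at z (?m (u @ y # v)))"
    by (rule lie_at_fresh[where y = t]) (use f len[OF assms(6)] free distinct in auto)
  moreover have "lie C (at y (?m (p @ z # q)))"
    by (rule lie_at_fresh[where y = t]) (use f len[OF assms(5)] free distinct in auto)
  moreover have "u @ y # v \<in> words (Suc 0) C" "p @ z # q \<in> words (Suc 0) C"
    using f free by (auto simp: words_def)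
  ultimately have "lie C (\<lambda>x. at z (dword (at y (?m (p @ z # q))) (u @ y # v)) x -
      at y (dword (at z (?m (u @ y # v))) (p @ z # q)) x)"
    using distinct by (intro lie_bracket_at) auto
  then show ?thesis using f by (simp add: dword_at_once mon_mult_mon)
qed

text \<open>
  These derivations have divergence in the special part. They have degree one if \<open>q\<close> is a single
  letter, and are otherwise the brackets of \<open>y \<mapsto> y z\<close>, respectively \<open>y \<mapsto> z y\<close>, with \<open>z \<mapsto> q\<close>.
\<close>

lemma lie_ends:
  assumes "q \<in> lists X" "q \<noteq> []"
  shows "lie C (at y (mon (y # q) :: ('b, 'r::comm_ring_1) tens))" "lie C (at y (mon (q @ [y]) :: ('b, 'r) tens))"
proof -
  let ?m = "mon :: 'b list \<Rightarrow> ('b, 'r) tens"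
  note f = words_free[OF assms(1)]
  have "lie C (at y (?m (y # q))) \<and> lie C (at y (?m (q @ [y])))"
  proof (cases "2 \<le> length q")
    case True
    then have q: "lie C (at z (?m q))"
      using f free distinct by (intro lie_at_fresh[where y = y]) auto
    have "lie C (at y (?m [y, z]))" "lie C (at y (?m [z, y]))"
      using free by (auto intro!: lie_at_degree_one)
    then have "lie C (\<lambda>x. at y (dword (at z (?m q)) [y, z]) x - at z (dword (at y (?m [y, z])) q) x)"
      "lie C (\<lambda>x. at y (dword (at z (?m q)) [z, y]) x - at z (dword (at y (?m [z, y])) q) x)"
      using f q free distinct assms(2)
      by (intro lie_bracket_at; auto simp: words_def Suc_le_eq)+
    moreover have "dword (at z (?m q)) [y, z] = ?m (y # q)" "dword (at z (?m q)) [z, y] = ?m (q @ [y])"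
      using dword_at_once[of z "[y]" "[]" "?m q"] dword_at_once[of z "[]" "[y]" "?m q"] distinct
      by (simp_all add: mon_mult_mon)
    ultimately show ?thesis using f by (simp add: at_zero)
  next
    case False
    with assms(2) have "length q = 1" by (cases q; cases "tl q") auto
    then show ?thesis using f free by (auto intro!: lie_at_degree_one)
  qed
  then show "lie C (at y (?m (y # q)))" "lie C (at y (?m (q @ [y])))" by auto
qed

text \<open>
  Modulo the Lie algebra, \<open>y \<mapsto> p y q\<close> is a trace in the element \<open>p \<otimes> q\<close> of the algebra \<open>T(V) \<otimes> T(V)\<^sup>o\<^sup>p\<close>.
  When both sides of the mark are nonempty, \<open>lie_transfer\<close> rotates the word at the price of changing the
  mark from \<open>y\<close> to \<open>z\<close>; applied with trivial rotation it changes the mark back. When one side is empty,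
  both terms are covered by \<open>lie_ends\<close>.
\<close>

lemma lie_commutator:
  assumes "p \<in> lists X" "q \<in> lists X" "u \<in> lists X" "v \<in> lists X"
  shows "lie C (at y (mon (u @ p @ y # q @ v) - mon (p @ u @ y # v @ q) :: ('b, 'r::comm_ring_1) tens))"
proof -
  let ?m = "mon :: 'b list \<Rightarrow> ('b, 'r) tens"
  \<comment> \<open>The first four cases are those in which one of the elements is the unit or one side of the mark is empty.\<close>
  consider "p = []" "q = []" | "u = []" "v = []" | "u = []" "p = []" "q @ v \<noteq> []"
    | "q = []" "v = []" "u @ p \<noteq> []"
    | "u @ p \<noteq> []" "q @ v \<noteq> []" "p \<noteq> [] \<or> q \<noteq> []" "u \<noteq> [] \<or> v \<noteq> []" by auto
  then show ?thesis
  proof cases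
    case 3
    then show ?thesis
      using lie_diff[OF lie_ends(1) lie_ends(1), of "q @ v" "v @ q"] assms by (auto simp: at_diff)
  next
    case 4
    then show ?thesis
      using lie_diff[OF lie_ends(2) lie_ends(2), of "u @ p" "p @ u"] assms by (auto simp: at_diff)
  next
    case 5
    have "lie C (\<lambda>x. at z (?m (u @ p @ z # q @ v)) x - at y (?m (p @ u @ y # v @ q)) x)"
      using assms 5 by (intro lie_transfer) auto
    moreover have "lie C (\<lambda>x. at z (?m ([] @ (u @ p) @ z # [] @ (q @ v))) x -
        at y (?m ((u @ p) @ [] @ y # (q @ v) @ [])) x)"
      using assms 5 by (intro lie_transfer) auto
    ultimately have "lie C (\<lambda>x. (at z (?m (u @ p @ z # q @ v)) x - at y (?m (p @ u @ y # v @ q)) x) -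
      (at z (?m ([] @ (u @ p) @ z # [] @ (q @ v))) x -
        at y (?m ((u @ p) @ [] @ y # (q @ v) @ [])) x))"
      by (rule lie_diff)
    then show ?thesis by (simp add: at_diff)
  qed (auto simp: at_zero lie_zero)
qed

text \<open>
  The elementary derivation \<open>b \<mapsto> w\<close> is congruent to its divergence: the sum, over the occurrences of \<open>b\<close>
  in \<open>w = p b q\<close>, of \<open>y \<mapsto> p y q\<close>. Write \<open>w = w' a\<close>. The bracket of \<open>b \<mapsto> y a\<close> and \<open>y \<mapsto> w'\<close> replaces
  \<open>b \<mapsto> w\<close> by the same sum with the mark followed by the letter \<open>a\<close>, which \<open>lie_commutator\<close> moves to
  the end of the word. The occurrence of \<open>b\<close> at the place of \<open>a\<close>, if any, is absorbed by \<open>lie_ends\<close>.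
\<close>

lemma lie_divergence:
  assumes b: "b \<in> X" and w: "w \<in> lists X" "2 \<le> length w"
  shows "lie C (\<lambda>x. at b (mon w :: ('b, 'r::comm_ring_1) tens) x - at y (dword (at b (mon [y])) w) x)"
proof -
  let ?m = "mon :: 'b list \<Rightarrow> ('b, 'r) tens"
  have "w \<noteq> []" using w by auto
  then obtain w' a where wa: "w = w' @ [a]" by (meson rev_exhaust)
  have w': "w' \<in> lists X" "w' \<noteq> []" and a: "a \<in> X" using w wa by auto
  have bC: "b \<in> C" "b \<noteq> y" using b sub free by auto
  show ?thesis
  \<comment> \<open>The bracket with \<open>y \<mapsto> w'\<close> is available when this derivation has positive degree.\<close>
  proof (cases "2 \<le> length w'")
    case False
    then obtain c where "w' = [c]" using w'(2) by (cases w'; cases "tl w'") auto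
    then have "lie C (at b (?m w))" "lie C (at y (dword (at b (?m [y])) w))"
      using wa w words_free[OF w(1)] free
      by (auto intro!: lie_at_degree_one lie_degree_one simp: at_def mon_mult_mon)
    then show ?thesis by (rule lie_diff)
  next
    case True
    have "lie C (at y (?m w'))"
      using words_free[OF w'(1)] True free distinct by (intro lie_at_fresh[where y = z]) auto
    moreover have "lie C (at b (?m [y, a]))"
      using words_free[of "[a]"] a free by (intro lie_at_degree_one) auto
    ultimately have "lie C (\<lambda>x. at b (dword (at y (?m w')) [y, a]) x - at y (dword (at b (?m [y, a])) w') x)"
      using words_free[OF w'(1)] words_free[of "[a]"] bC free True a
      by (intro lie_bracket_at) (auto simp: words_def)
    moreover have "dword (at y (?m w')) [y, a] = ?m w"
      using dword_at_once[of y "[]" "[a]" "?m w'"] words_free[of "[a]"] a by (auto simp: mon_mult_mon wa)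
    ultimately have 1: "lie C (\<lambda>x. at b (?m w) x - at y (dword (at b (?m [y, a])) w') x)" by simp
    let ?f = "\<lambda>i. (if w' ! i = b then
       ?m (take i w' @ y # a # drop (Suc i) w') - ?m (take i w' @ y # drop (Suc i) w' @ [a]) else 0)"
    have "dword (at b (?m [y, a])) w' - dword (at b (?m [y])) w' * ?m [a] = (\<Sum>i<length w'. ?f i)"
      unfolding dword_sum sum_distrib_right sum_subtractf[symmetric]
      by (intro sum.cong refl) (auto simp: at_def mon_mult_mon mult.assoc)
    moreover have "lie C (at y (?f i))" if "i < length w'" for i
    proof -
      have "take i w' \<in> lists X" "drop (Suc i) w' \<in> lists X"
        using w'(1) by (auto dest: in_set_takeD in_set_dropD)
      then show ?thesis
        using lie_commutator[of "[]" "[a]" "take i w'" "drop (Suc i) w'"] a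
        by (auto simp: at_zero lie_zero)
    qed
    ultimately have 2: "lie C (at y (dword (at b (?m [y, a])) w' - dword (at b (?m [y])) w' * ?m [a]))"
      by (auto simp: at_sum intro: lie_sum)
    have 3: "lie C (at y (?m w' * at b (?m [y]) a))"
      using lie_ends(2)[OF w', where 'r = 'r] by (simp add: at_def[of b] mon_mult_mon at_zero lie_zero)
    have "dword (at b (?m [y])) w = dword (at b (?m [y])) w' * ?m [a] + ?m w' * at b (?m [y]) a"
      by (simp add: wa dword_append)
    then have "(\<lambda>x. at b (?m w) x - at y (dword (at b (?m [y])) w) x) =
      (\<lambda>x. ((at b (?m w) x - at y (dword (at b (?m [y, a])) w') x) +
        at y (dword (at b (?m [y, a])) w' - dword (at b (?m [y])) w' * ?m [a]) x) -
        at y (?m w' * at b (?m [y]) a) x)"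
      by (auto simp: at_diff at_add)
    then show ?thesis using lie_diff[OF lie_add[OF 1 2] 3] by simp
  qed
qed

end

section \<open>Quotient modules\<close>

lemma carrier_quot_module: "carrier (quot_module M N) = (\<lambda>x. N +>\<^bsub>M\<^esub> x) ` carrier M"
  by (auto simp: quot_module_def A_RCOSETS_def')

locale quotient =
  fixes M :: "('r::comm_ring_1, 'm) module" and N
  assumes M: "module scalars M" and N: "submodule N scalars M"
begin

sublocale M: module scalars M by (rule M)

lemma abelian_subgroup: "abelian_subgroup N M"
  using submodule.axioms(1)[OF N] M.abelian_group_axioms
  by (intro abelian_subgroupI3 additive_subgroup.intro)

lemma in_carrier: "x \<in> N \<Longrightarrow> x \<in> carrier M"
  using submoduleD(4)[OF N] by auto

lemma self_in_coset: "x \<in> carrier M \<Longrightarrow> x \<in> N +>\<^bsub>M\<^esub> x"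
  using abelian_subgroup.a_rcos_self[OF abelian_subgroup] .

lemma coset_mem: "y \<in> N +>\<^bsub>M\<^esub> x \<longleftrightarrow> (\<exists>n\<in>N. y = n \<oplus>\<^bsub>M\<^esub> x)"
  by (auto simp: a_r_coset_def')

lemma coset_memD: "y \<in> N +>\<^bsub>M\<^esub> x \<Longrightarrow> x \<in> carrier M \<Longrightarrow> y \<in> carrier M"
  by (auto simp: coset_mem in_carrier)

lemma coset_repr: "y \<in> N +>\<^bsub>M\<^esub> x \<Longrightarrow> x \<in> carrier M \<Longrightarrow> N +>\<^bsub>M\<^esub> y = N +>\<^bsub>M\<^esub> x"
  using M.M.a_repr_independence'[of y N x] submodule.axioms(1)[OF N] by (simp add: a_r_coset_def)

lemma coset_eq_iff:
  assumes "x \<in> carrier M" "y \<in> carrier M"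
  shows "N +>\<^bsub>M\<^esub> x = N +>\<^bsub>M\<^esub> y \<longleftrightarrow> x \<ominus>\<^bsub>M\<^esub> y \<in> N"
proof
  assume "N +>\<^bsub>M\<^esub> x = N +>\<^bsub>M\<^esub> y"
  then obtain n where n: "n \<in> N" "x = n \<oplus>\<^bsub>M\<^esub> y" using self_in_coset[OF assms(1)] coset_mem by blast
  then have "x \<ominus>\<^bsub>M\<^esub> y = n" using assms in_carrier[of n] by (simp add: a_minus_def M.M.add.m_assoc M.M.r_neg)
  with n show "x \<ominus>\<^bsub>M\<^esub> y \<in> N" by simp
next
  assume "x \<ominus>\<^bsub>M\<^esub> y \<in> N"
  moreover have "x = (x \<ominus>\<^bsub>M\<^esub> y) \<oplus>\<^bsub>M\<^esub> y"
    using assms by (simp add: a_minus_def M.M.add.m_assoc M.M.l_neg)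
  ultimately have "x \<in> N +>\<^bsub>M\<^esub> y" using coset_mem by blast
  then show "N +>\<^bsub>M\<^esub> x = N +>\<^bsub>M\<^esub> y"
    using coset_repr assms(2) by metis
qed

lemma coset_eq_self: "x \<in> N \<Longrightarrow> N +>\<^bsub>M\<^esub> x = N"
  using abelian_subgroup.a_rcos_const[OF abelian_subgroup] .

lemma coset_add:
  "x \<in> carrier M \<Longrightarrow> y \<in> carrier M \<Longrightarrow>
    (N +>\<^bsub>M\<^esub> x) \<oplus>\<^bsub>quot_module M N\<^esub> (N +>\<^bsub>M\<^esub> y) = N +>\<^bsub>M\<^esub> (x \<oplus>\<^bsub>M\<^esub> y)"
  using abelian_subgroup.a_rcos_sum[OF abelian_subgroup] by (simp add: quot_module_def)

lemma coset_smult: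
  assumes "x \<in> carrier M"
  shows "a \<odot>\<^bsub>quot_module M N\<^esub> (N +>\<^bsub>M\<^esub> x) = N +>\<^bsub>M\<^esub> (a \<odot>\<^bsub>M\<^esub> x)"
proof -
  have const: "N +>\<^bsub>M\<^esub> (a \<odot>\<^bsub>M\<^esub> y) = N +>\<^bsub>M\<^esub> (a \<odot>\<^bsub>M\<^esub> x)" if y: "y \<in> N +>\<^bsub>M\<^esub> x" for y
  proof -
    obtain n where n: "n \<in> N" "y = n \<oplus>\<^bsub>M\<^esub> x" using y coset_mem by blast
    have "a \<odot>\<^bsub>M\<^esub> y \<in> N +>\<^bsub>M\<^esub> (a \<odot>\<^bsub>M\<^esub> x)"
      unfolding coset_mem n(2) using n assms in_carrier[OF n(1)] submoduleD(3)[OF N n(1)]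
      by (intro bexI[of _ "a \<odot>\<^bsub>M\<^esub> n"]) (simp_all add: M.smult_r_distr)
    then show ?thesis
      by (rule coset_repr) (use assms M.smult_closed in simp)
  qed
  have "(\<Union>y\<in>N +>\<^bsub>M\<^esub> x. N +>\<^bsub>M\<^esub> (a \<odot>\<^bsub>M\<^esub> y)) = N +>\<^bsub>M\<^esub> (a \<odot>\<^bsub>M\<^esub> x)"
    by (rule SUP_eq_const[OF _ const]) (use self_in_coset[OF assms] in auto)
  then show ?thesis by (simp add: quot_module_def)
qed

lemma coset_carrier: "x \<in> carrier M \<Longrightarrow> N +>\<^bsub>M\<^esub> x \<in> carrier (quot_module M N)"
  by (simp add: carrier_quot_module)

lemma coset_zero: "\<zero>\<^bsub>quot_module M N\<^esub> = N +>\<^bsub>M\<^esub> \<zero>\<^bsub>M\<^esub>"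
  using coset_eq_self[OF submoduleD(1)[OF N]] by (simp add: quot_module_def)

lemma module_quot: "module scalars (quot_module M N)"
proof -
  note [simp] = coset_add coset_smult coset_zero
  have [simp]: "a \<odot>\<^bsub>M\<^esub> x \<in> carrier M" if "x \<in> carrier M" for a x using that M.smult_closed by simp
  have inv: "(-1) \<odot>\<^bsub>M\<^esub> x \<oplus>\<^bsub>M\<^esub> x = \<zero>\<^bsub>M\<^esub>" if "x \<in> carrier M" for x
    using module_minus_one[OF M that] that by (metis M.M.l_neg)
  have laws: "x \<oplus>\<^bsub>M\<^esub> y = y \<oplus>\<^bsub>M\<^esub> x" "(a + b) \<odot>\<^bsub>M\<^esub> x = a \<odot>\<^bsub>M\<^esub> x \<oplus>\<^bsub>M\<^esub> b \<odot>\<^bsub>M\<^esub> x"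
    "a \<odot>\<^bsub>M\<^esub> (x \<oplus>\<^bsub>M\<^esub> y) = a \<odot>\<^bsub>M\<^esub> x \<oplus>\<^bsub>M\<^esub> a \<odot>\<^bsub>M\<^esub> y" "(a * b) \<odot>\<^bsub>M\<^esub> x = a \<odot>\<^bsub>M\<^esub> (b \<odot>\<^bsub>M\<^esub> x)"
    "1 \<odot>\<^bsub>M\<^esub> x = x"
    if "x \<in> carrier M" "y \<in> carrier M" for a b x y
    using that M.M.a_comm[of x y] M.smult_l_distr[of a b x] M.smult_r_distr[of a x y]
      M.smult_assoc1[of a b x] M.smult_one[of x] by simp_all
  show ?thesis
    by (rule scalar_moduleI)
      (auto simp add: carrier_quot_module inv M.M.a_assoc laws(2-5) simp del: laws(1), simp_all add: laws(1))
qed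

lemma quot_minus:
  assumes "x \<in> carrier M" "y \<in> carrier M"
  shows "(N +>\<^bsub>M\<^esub> x) \<ominus>\<^bsub>quot_module M N\<^esub> (N +>\<^bsub>M\<^esub> y) = N +>\<^bsub>M\<^esub> (x \<ominus>\<^bsub>M\<^esub> y)"
proof -
  have "(-1) \<odot>\<^bsub>M\<^esub> y \<in> carrier M" using assms(2) M.smult_closed by simp
  then show ?thesis
    using assms module_minus_one[OF module_quot coset_carrier[OF assms(2)]] module_minus_one[OF M assms(2)]
    by (simp add: a_minus_def coset_smult coset_add)
qed

end

section \<open>Algebra maps induced by maps of letters\<close>

definition wmap :: "('b \<Rightarrow> 'c) \<Rightarrow> ('b, 'r::comm_ring_1) tens \<Rightarrow> ('c, 'r) tens" where
  "wmap f = lin_ext (\<lambda>w. mon (map f w))"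

lemma wmap_mon [simp]: "wmap f (mon w) = mon (map f w)"
  by (simp add: wmap_def)

lemma wmap_trm [simp]: "wmap f (trm w a) = trm (map f w) a"
  by (simp add: wmap_def)

lemma wmap_add: "wmap f (p + q) = wmap f p + wmap f q"
  and wmap_diff: "wmap f (p - q) = wmap f p - wmap f q"
  and wmap_scale: "wmap f (scale a p) = scale a (wmap f p)"
  and wmap_sum: "wmap f (sum h A) = (\<Sum>i\<in>A. wmap f (h i))"
  and wmap_zero [simp]: "wmap f 0 = 0"
  by (simp_all add: wmap_def lin_ext_add lin_ext_diff lin_ext_scale lin_ext_sum)

lemma wmap_mult: "wmap f (p * q) = wmap f p * wmap f q"
  using supported_UNIV[of p]
proof (induction rule: supported_induct)
  case (trm u a)
  show ?case using supported_UNIV[of q]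
    by (induction rule: supported_induct)
      (auto simp: distrib_left wmap_add trm_mult_trm)
qed (auto simp: distrib_right wmap_add)

lemma wmap_supported: "p \<in> supported X \<Longrightarrow> (\<And>w. w \<in> X \<Longrightarrow> map f w \<in> Y) \<Longrightarrow> wmap f p \<in> supported Y"
  unfolding wmap_def by (rule lin_ext_supported) auto

lemma wmap_words: "p \<in> supported (words k B) \<Longrightarrow> f ` B \<subseteq> C \<Longrightarrow> wmap f p \<in> supported (words k C)"
  by (erule wmap_supported) (auto simp: words_def image_subset_iff)

lemma prod_list_mon: "prod_list (map (\<lambda>b. mon [f b]) w) = (mon (map f w) :: ('c, 'r::comm_ring_1) tens)"
  by (induction w) (simp_all add: mon_mult_mon)

lemma push_mon [simp]: "push f (mon b) = mon (f b)"
  by (simp add: push_eq)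

lemma ass_map_push: "ass_map (push f) = wmap f"
  by (simp add: fun_eq_iff ass_map_eq wmap_def incl_trm prod_list_mon)

lemma dword_map:
  assumes "\<And>b. b \<in> set w \<Longrightarrow> g (f b) = wmap f (h b)"
  shows "dword g (map f w) = wmap f (dword h w)"
  using assms by (induction w) (auto simp: wmap_add wmap_mult)

section \<open>Pointed derivations\<close>

abbreviation star :: "unit + 'b" where "star \<equiv> Inl ()"

lemma Inl_in_Plus [simp]: "Inl a \<in> Sum_Type.Plus A B \<longleftrightarrow> a \<in> A"
  and Inr_in_Plus [simp]: "Inr b \<in> Sum_Type.Plus A B \<longleftrightarrow> b \<in> B"
  by auto

text \<open>
  The word with the marked letter between \<open>u\<close> and \<open>v\<close>; it stands for \<open>u \<otimes> v\<close> in \<open>T(V) \<otimes> T(V)\<^sup>o\<^sup>p\<close>.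
\<close>

definition pw :: "'b list \<Rightarrow> 'b list \<Rightarrow> (unit + 'b) list" where
  "pw u v = map Inr u @ star # map Inr v"

definition lin_words :: "nat \<Rightarrow> 'b set \<Rightarrow> (unit + 'b) list set" where
  "lin_words k B = {pw u v | u v. u \<in> lists B \<and> v \<in> lists B \<and> k \<le> length u + length v}"

text \<open>
  The elements \<open>u \<otimes> 1\<close> and \<open>1 \<otimes> v\<close>.
\<close>

definition special_words :: "'b set \<Rightarrow> (unit + 'b) list set" where
  "special_words B = {pw u [] | u. u \<in> words (Suc 0) B} \<union> {pw [] v | v. v \<in> words (Suc 0) B}"

lemma map_Inr_eq: "filter isl w = [] \<Longrightarrow> \<exists>u. w = map Inr u"
proof (induction w)
  case (Cons a w)
  then show ?case by (cases a) (auto intro: exI[of _ "_ # _"])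
qed simp

text \<open>
  The marked letter is not of the form \<open>Inr b\<close>, so it can be found in the word.
\<close>

lemma pw_inj [simp]: "pw u v = pw u' v' \<longleftrightarrow> u = u' \<and> v = v'"
proof
  assume *: "pw u v = pw u' v'"
  \<comment> \<open>Both words are recovered by splitting at the first letter that satisfies \<open>isl\<close>.\<close>
  let ?P = "\<lambda>c::unit + 'a. \<not> isl c"
  have "takeWhile ?P (pw u v) = map Inr u" "dropWhile ?P (pw u v) = star # map Inr v" for u v :: "'a list"
    unfolding pw_def by (induction u) auto
  with * show "u = u' \<and> v = v'"
    by (metis inj_map_eq_map inj_Inr list.sel(3))
qed simp

lemma lin_words_eq: "{w \<in> lists (pt B). length (filter isl w) = 1} = lin_words 0 B"
proof (intro equalityI subsetI)
  fix w assume "w \<in> {w \<in> lists (pt B). length (filter isl w) = 1}"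
  then have w: "w \<in> lists (pt B)" "length (filter isl w) = 1" by auto
  then obtain c where c: "filter isl w = [c]" by (metis One_nat_def length_0_conv length_Suc_conv)
  then obtain u v where uv: "w = u @ c # v" "filter isl u = []" "isl c" "filter isl v = []"
    unfolding filter_eq_Cons_iff by (metis filter_False)
  moreover have "c = star" using uv(3) by (cases c) auto
  moreover obtain u' v' where "u = map Inr u'" "v = map Inr v'" using map_Inr_eq uv(2,4) by metis
  ultimately have "w = pw u' v'" "u' \<in> lists B" "v' \<in> lists B" using w(1) by (auto simp: pw_def)
  then show "w \<in> lin_words 0 B" by (auto simp: lin_words_def)
qed (auto simp: lin_words_def pw_def filter_empty_conv)

lemma ass_lin_eq: "ass_lin B {()} = supported (lin_words 0 B)"
  unfolding lin_words_eq[symmetric] by (auto simp: ass_lin_def carrier_ass_alg supported_def)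

lemma length_pw [simp]: "length (pw u v) = Suc (length u + length v)"
  by (simp add: pw_def)

lemma set_pw [simp]: "set (pw u v) = insert star (Inr ` (set u \<union> set v))"
  by (auto simp: pw_def)

lemma pw_in_lin_words [simp]:
  "pw u v \<in> lin_words k B \<longleftrightarrow> u \<in> lists B \<and> v \<in> lists B \<and> k \<le> length u + length v"
  by (auto simp: lin_words_def)

lemma lin_wordsE:
  assumes "w \<in> lin_words k B"
  obtains u v where "w = pw u v" "u \<in> lists B" "v \<in> lists B" "k \<le> length u + length v"
  using assms by (auto simp: lin_words_def)

lemma lin_words_words: "lin_words k B \<subseteq> words (Suc k) (pt B)"
  by (auto simp: words_def elim!: lin_wordsE)

lemma lin_words_mono: "j \<le> k \<Longrightarrow> lin_words k B \<subseteq> lin_words j B"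
  by (auto elim!: lin_wordsE)

lemma lin_words_inter: "lin_words 0 B \<inter> words (Suc k) (pt B) = lin_words k B"
  by (auto simp: words_def elim!: lin_wordsE)

lemma special_words_lin: "special_words B \<subseteq> lin_words (Suc 0) B"
  by (auto simp: special_words_def words_def)

text \<open>
  The pointed derivation given by its value on the marked letter: \<open>pt_der\<close> in the normal form \<open>dext\<close>.
\<close>

definition pd :: "'b set \<Rightarrow> (unit + 'b, 'r::comm_ring_1) tens \<Rightarrow> (unit + 'b, 'r) tens \<Rightarrow> (unit + 'b, 'r) tens" where
  "pd B p = dext (pt B) (at star p)"

lemma pd_star [simp]: "pd B p (mon [star]) = p"
  by (simp add: pd_def dext_mon at_def)

lemma pd_Inr: "b \<in> B \<Longrightarrow> pd B p (mon [Inr b]) = 0"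
  by (simp add: pd_def dext_mon at_def)

lemma pd_inj [simp]: "pd B p = pd B q \<longleftrightarrow> p = q"
  by (metis pd_star)

lemma pd_Der:
  assumes "p \<in> supported (lin_words k B)" shows "pd B p \<in> Der (pt B)"
proof -
  have "p \<in> supported (words (Suc 0) (pt B))"
    using assms lin_words_words[of k B] words_mono[of "Suc 0" "Suc k" "pt B"] by (auto simp: supported_def)
  then show ?thesis unfolding pd_def by (intro dext_in_Der) (auto simp: at_def)
qed

lemma pd_add: "(\<lambda>x. pd B p x + pd B q x) = pd B (p + q)"
  and pd_diff: "(\<lambda>x. pd B p x - pd B q x) = pd B (p - q)"
  and pd_scale: "(\<lambda>x. scale a (pd B p x)) = pd B (scale a p)"
  and pd_zero: "(\<lambda>x. 0) = pd B 0"
  unfolding pd_def at_add at_diff at_scale at_zero dext_add dext_diff dext_scale dext_zero by simp_all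

lemma pt_der_eq:
  fixes p :: "(unit + 'b, 'r::comm_ring_1) tens"
  assumes "p \<in> supported (lin_words k B)" shows "pt_der B p = pd B p"
proof -
  have "p \<in> supported (words (Suc 0) (pt B))"
    using assms lin_words_words[of k B] words_mono[of "Suc 0" "Suc k" "pt B"] by (auto simp: supported_def)
  then have "(\<lambda>u. scale (cf u star) p) \<in> lin_maps (free_mod (pt B)) (ass_alg (pt B))"
    by (auto simp: lin_maps_def carrier_ass_alg_words lookup_add scale_add_left lookup_scale scale_scale)
  then show ?thesis unfolding pt_der_def pd_def
    by (subst der_ext_eq) (auto simp: lookup_single at_def intro!: dext_cong)
qed

lemma Der_pt_eq: "Der_pt B = pd B ` supported (lin_words 0 B)"
proof (intro equalityI subsetI)
  fix D assume D: "D \<in> Der_pt B"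
  let ?p = "D (mon [star])"
  have p: "?p \<in> supported (lin_words 0 B)"
  proof -
    have "\<forall>x\<in>supported {()}. D (incl (push Inl x)) \<in> supported (lin_words 0 B)"
      using D by (simp add: Der_pt_def carrier_free_mod ass_lin_eq)
    from bspec[OF this, of "mon ()"] show ?thesis by (simp add: push_eq incl_trm)
  qed
  have "D (mon [Inr b]) = 0" if "b \<in> B" for b
  proof -
    have "\<forall>v\<in>supported B. D (incl (push Inr v)) = 0"
      using D by (simp add: Der_pt_def carrier_free_mod)
    from bspec[OF this, of "mon b"] that show ?thesis by (simp add: push_eq incl_trm)
  qed
  then have "D = pd B ?p"
    using D pd_Der[OF p] by (intro Der_eqI[where B = "pt B"]) (auto simp: Der_pt_def pd_Inr)
  with p show "D \<in> pd B ` supported (lin_words 0 B)" by blast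
next
  fix D assume "D \<in> pd B ` supported (lin_words 0 B)"
  then obtain p where p: "p \<in> supported (lin_words 0 B)" "D = pd B p" by auto
  have dmap0: "pd B p (trm [c] a) = scale a (at star p c)" if "c \<in> pt B" for c a
    using that by (simp add: pd_def dext_apply dmap_trm words_def)
  have "D (incl (push Inl x)) \<in> supported (lin_words 0 B)" if "x \<in> supported {()}" for x
  proof -
    have "x = trm () (cf x ())" by (rule poly_mapping_eqI) (simp add: lookup_single)
    then obtain a where x: "x = trm () a" by metis
    then show ?thesis using p by (simp add: push_eq incl_trm dmap0) (simp add: at_def)
  qed
  moreover have "D (incl (push Inr v)) = 0" if "v \<in> supported B" for v
  proof -
    have "push Inr v \<in> supported (pt B)"
      unfolding push_eq using that by (rule lin_ext_supported) auto
    then have "D (incl (push Inr v)) = dmap (at star p) (incl (push Inr v))"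
      using p by (simp add: pd_def dext_apply incl_supported)
    also have "\<dots> = 0" using that
      by (induction rule: supported_induct)
        (simp_all add: push_eq incl_eq lin_ext_add dmap_add dmap_trm at_def)
    finally show ?thesis .
  qed
  ultimately show "D \<in> Der_pt B" using p(2) pd_Der[OF p(1)]
    by (simp add: Der_pt_def carrier_free_mod ass_lin_eq)
qed

lemma Der_deg_values:
  assumes "D \<in> Der_deg k C" "b \<in> C"
  shows "D (mon [b]) \<in> supported {w \<in> lists C. length w = Suc k}"
proof -
  have "\<forall>v\<in>supported C. D (incl v) \<in> supported {w \<in> lists C. length w = Suc k}"
    using assms(1) by (simp add: Der_deg_def carrier_free_mod ass_homog_eq)
  from bspec[OF this, of "mon b"] show ?thesis using assms(2) by (simp add: incl_trm)
qed

text \<open>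
  Positive degree read off from the values on letters. For finite \<open>B\<close> this is \<open>Der_plus B\<close>; what is used
  is that it contains \<open>Der_plus B\<close> and the Lie algebra generated in degree one, and that an elementary
  derivation in it lies in \<open>Der_plus B\<close>.
\<close>

definition Der_pos :: "'b set \<Rightarrow> (('b, 'r::comm_ring_1) tens \<Rightarrow> ('b, 'r) tens) set" where
  "Der_pos C = {D \<in> Der C. \<forall>b\<in>C. D (mon [b]) \<in> supported (words 2 C)}"

lemma Der_pos_submodule: "submodule (Der_pos C) scalars (der_mod C)"
  by (rule scalar_submoduleI[OF module_der_mod]) (auto simp: Der_pos_def Der_zero Der_add Der_scale)

lemma Der_deg_pos:
  assumes "1 \<le> k" shows "Der_deg k C \<subseteq> Der_pos C"
proof
  fix D assume D: "D \<in> Der_deg k C"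
  have "D (mon [b]) \<in> supported (words 2 C)" if "b \<in> C" for b
    using that \<open>1 \<le> k\<close> by (intro supported_mono[OF Der_deg_values[OF D]]) (auto simp: words_def)
  then show "D \<in> Der_pos C" using D by (simp add: Der_deg_def Der_pos_def)
qed

lemma Der_plus_subset: "Der_plus C \<subseteq> Der_pos C"
  unfolding Der_plus_def
  by (rule gen_submodule_minimal[OF Der_pos_submodule]) (use Der_deg_pos in auto)

lemma Der_plus_submodule: "submodule (Der_plus C) scalars (der_mod C)"
  unfolding Der_plus_def
  by (rule gen_submodule_submodule[OF module_der_mod]) (auto simp: Der_deg_def)

text \<open>
  A derivation supported on a single letter is a finite sum of homogeneous ones, whatever the number of
  letters.
\<close>

lemma dext_at_in_Der_plus:
  assumes "p \<in> supported (words 2 C)"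
  shows "dext C (at b p) \<in> Der_plus C"
  using assms
proof (induction rule: supported_induct)
  case zero
  show ?case using submoduleD(1)[OF Der_plus_submodule] by (simp add: at_zero dext_zero)
next
  case (add p q)
  then show ?case using submoduleD(2)[OF Der_plus_submodule]
    by (fastforce simp: at_add dext_add[symmetric])
next
  case (trm w a)
  obtain k where k: "length w = Suc k" "1 \<le> k"
    using trm by (cases "length w") (auto simp: words_def)
  have "dext C (at b (trm w a)) \<in> Der_deg k C"
    using trm k by (intro dext_in_Der_deg) (auto simp: at_def words_def)
  then show ?case unfolding Der_plus_def using k by (intro gen_submodule_inc) auto
qed

lemma Der_pt_plus_eq: "Der_pt_plus B = pd B ` supported (lin_words (Suc 0) B)"
proof (intro equalityI subsetI)
  fix D assume "D \<in> Der_pt_plus B"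
  then have D: "D \<in> Der_pt B" "D \<in> Der_plus (pt B)" by (auto simp: Der_pt_plus_def)
  then obtain p where p: "D = pd B p" "p \<in> supported (lin_words 0 B)" by (auto simp: Der_pt_eq)
  have "D (mon [star]) \<in> supported (words (Suc (Suc 0)) (pt B))"
    using D(2) Der_plus_subset[of "pt B"] by (auto simp: Der_pos_def numeral_2_eq_2)
  then have "p \<in> supported (lin_words 0 B \<inter> words (Suc (Suc 0)) (pt B))"
    using p by (simp add: supported_def)
  then have "p \<in> supported (lin_words (Suc 0) B)" by (simp add: lin_words_inter)
  with p show "D \<in> pd B ` supported (lin_words (Suc 0) B)" by blast
next
  fix D assume "D \<in> pd B ` supported (lin_words (Suc 0) B)"
  then obtain p where p: "D = pd B p" "p \<in> supported (lin_words (Suc 0) B)" by auto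
  then have "p \<in> supported (words 2 (pt B))" "p \<in> supported (lin_words 0 B)"
    using lin_words_words[of "Suc 0" B] lin_words_mono[of 0 "Suc 0" B] by (auto simp: supported_def numeral_2_eq_2)
  with p show "D \<in> Der_pt_plus B"
    by (auto simp: Der_pt_plus_def Der_pt_eq) (simp add: pd_def dext_at_in_Der_plus)
qed

abbreviation L1 :: "'b set \<Rightarrow> (unit + 'b, 'r::comm_ring_1) tens set" where
  "L1 B \<equiv> supported (lin_words (Suc 0) B)"

lemma pt_plus_alg_simps [simp]: "carrier (pt_plus_alg B) = Der_pt_plus B"
  "add (pt_plus_alg B) = (\<lambda>d e p. d p + e p)" "zero (pt_plus_alg B) = (\<lambda>_. 0)"
  "smult (pt_plus_alg B) = (\<lambda>a d p. scale a (d p))" "mult (pt_plus_alg B) = prelie (pt B)"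
  by (simp_all add: pt_plus_alg_def)

lemma pd_in_carrier [simp]: "pd B p \<in> Der_pt_plus B \<longleftrightarrow> p \<in> L1 B"
  by (auto simp: Der_pt_plus_eq)

lemma submodule_Der_pt_plus: "submodule (Der_pt_plus B) scalars (der_mod (pt B))"
proof (rule scalar_submoduleI[OF module_der_mod])
  show "Der_pt_plus B \<subseteq> carrier (der_mod (pt B))" by (auto simp: Der_pt_plus_eq pd_Der)
qed (auto simp: Der_pt_plus_eq pd_add pd_scale pd_zero[of B])

lemma module_pt_plus_alg: "module scalars (pt_plus_alg B)"
  unfolding pt_plus_alg_def by (rule submodule_restrict[OF module_der_mod submodule_Der_pt_plus])

lemma pt_plus_alg_minus:
  assumes "p \<in> L1 B" "q \<in> L1 B"
  shows "pd B p \<ominus>\<^bsub>pt_plus_alg B\<^esub> pd B q = pd B (p - q)"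
  using module_minus_one[OF module_pt_plus_alg, of "pd B q" B] assms
  by (simp add: a_minus_def scale_uminus_left pd_diff[symmetric])

lemma pd_submoduleI:
  assumes "Z \<subseteq> L1 B" "0 \<in> Z" "\<And>p q. p \<in> Z \<Longrightarrow> q \<in> Z \<Longrightarrow> p + q \<in> Z" "\<And>a p. p \<in> Z \<Longrightarrow> scale a p \<in> Z"
  shows "submodule (pd B ` Z) scalars (pt_plus_alg B)"
  by (rule scalar_submoduleI[OF module_pt_plus_alg])
    (use assms in \<open>auto simp: pd_add pd_scale pd_zero[of B]\<close>)

lemma prelie_pd:
  fixes p q :: "(unit + 'b, 'r::comm_ring_1) tens"
  assumes p: "p \<in> L1 B" and q: "q \<in> L1 B"
  shows "prelie (pt B) (pd B p) (pd B q) = pd B (dmap (at star q) p)"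
proof -
  have w: "p \<in> supported (words (Suc 0) (pt B))" if "p \<in> L1 B" for p :: "(unit + 'b, 'r) tens"
    using that lin_words_words[of "Suc 0" B] words_mono[of "Suc 0" "Suc (Suc 0)" "pt B"] by (auto simp: supported_def)
  have "prelie (pt B) (pd B p) (pd B q) = dext (pt B) (\<lambda>c. dmap (at star q) (at star p c))"
    unfolding pd_def by (rule prelie_dext) (use w[OF p] w[OF q] in \<open>auto simp: at_def\<close>)
  also have "(\<lambda>c. dmap (at star q) (at star p c)) = at star (dmap (at star q) p)"
    by (auto simp: at_def)
  finally show ?thesis by (simp add: pd_def)
qed

lemma dword_star: "dword (at star q) (pw u v) = mon (map Inr u) * q * mon (map Inr v)"
  unfolding pw_def by (rule dword_at_once) auto

lemma pw_mult: "mon (map Inr u) * mon (pw u' v') * mon (map Inr v) = (mon (pw (u @ u') (v' @ v)) :: (unit + 'b, 'r::comm_ring_1) tens)"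
  by (simp add: mon_mult_mon pw_def)

text \<open>
  Substituting into the marked letter is the product of \<open>T(V) \<otimes> T(V)\<^sup>o\<^sup>p\<close>, and preserves positive degree.
\<close>

lemma dmap_star_L1:
  fixes p q :: "(unit + 'b, 'r::comm_ring_1) tens"
  assumes "p \<in> L1 B" "q \<in> L1 B"
  shows "dmap (at star q) p \<in> L1 B"
  using assms(1)
proof (induction rule: supported_induct)
  case (trm w a)
  then obtain u v where w: "w = pw u v" "u \<in> lists B" "v \<in> lists B" by (auto simp: lin_words_def)
  have "mon (map Inr u) * q * mon (map Inr v) \<in> L1 B" using assms(2)
  proof (induction rule: supported_induct)
    case (trm w' a')
    then obtain u' v' where w': "w' = pw u' v'" "u' \<in> lists B" "v' \<in> lists B" "1 \<le> length u' + length v'"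
      by (auto simp: lin_words_def)
    have a': "trm w' a' = scale a' (mon w')" by simp
    have "mon (map Inr u) * trm w' a' * mon (map Inr v) =
      scale a' (mon (map Inr u) * mon w' * mon (map Inr v) :: (unit + 'b, 'r) tens)"
      unfolding a' scale_mult_right scale_mult_left ..
    moreover have "pw (u @ u') (v' @ v) \<in> lin_words (Suc 0) B" using w w' unfolding lin_words_def by force
    ultimately show ?case by (simp add: w' pw_mult)
  qed (auto simp: distrib_left distrib_right)
  then show ?case by (simp add: dmap_trm w dword_star)
qed (auto simp: dmap_add)

section \<open>The special part\<close>

lemma map_key_mon_disjoint: "inj f \<Longrightarrow> c \<notin> range f \<Longrightarrow> Poly_Mapping.map_key f (trm c a) = 0"
  by (rule poly_mapping_eqI) (auto simp: map_key.rep_eq lookup_single when_def)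

lemma map_key_mon_image: "inj f \<Longrightarrow> Poly_Mapping.map_key f (trm (f b) a) = trm b a"
  by (rule poly_mapping_eqI) (auto simp: map_key.rep_eq lookup_single when_def inj_eq)

lemma map_key_add: "inj f \<Longrightarrow> Poly_Mapping.map_key f (p + q) = Poly_Mapping.map_key f p + Poly_Mapping.map_key f q"
  by (rule poly_mapping_eqI) (simp add: map_key.rep_eq lookup_add)

lemma map_key_scale: "inj f \<Longrightarrow> Poly_Mapping.map_key f (scale a p) = scale a (Poly_Mapping.map_key f p)"
  by (rule poly_mapping_eqI) (simp add: map_key.rep_eq lookup_scale)

lemma map_key_supported: "inj f \<Longrightarrow> p \<in> supported X \<Longrightarrow> Poly_Mapping.map_key f p \<in> supported (f -` X)"
  by (auto simp: supported_def in_keys_iff map_key.rep_eq)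

text \<open>
  Extension of a derivation by \<open>0\<close> along an injection of alphabets. This covers both the extension to
  the alphabet with the marked letter, in the action on pointed derivations, and stabilisation.
\<close>

lemma der_ext_transport:
  fixes D :: "('b, 'r::comm_ring_1) tens \<Rightarrow> ('b, 'r) tens" and f :: "'b \<Rightarrow> 'c"
  assumes D: "D \<in> Der B" and f: "inj f" "f ` B \<subseteq> C" "f -` C \<subseteq> B"
  shows "der_ext C (\<lambda>w. ass_map (push f) (D (incl (Poly_Mapping.map_key f w)))) =
    dext C (\<lambda>c. if c \<in> range f then wmap f (D (mon [the_inv f c])) else 0)"
    and "c \<in> C \<Longrightarrow> (if c \<in> range f then wmap f (D (mon [the_inv f c])) else 0) \<in> supported (words (Suc 0) C)"
proof -
  obtain g where g: "D = dext B g" "\<And>b. b \<in> B \<Longrightarrow> g b \<in> supported (words (Suc 0) B)"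
    using Der_dextE[OF D] by metis
  have D0: "D 0 = 0" by (simp add: g(1) dext_def dmap_zero)
  have key: "incl (Poly_Mapping.map_key f w) \<in> supported (words (Suc 0) B)" if "w \<in> supported C" for w :: "'c \<Rightarrow>\<^sub>0 'r"
    using map_key_supported[OF f(1) that] supported_mono[OF _ f(3)] by (intro incl_supported) blast
  have "(\<lambda>w. wmap f (D (incl (Poly_Mapping.map_key f w)))) \<in> lin_maps (free_mod C) (ass_alg C)"
    unfolding lin_maps_def mem_Collect_eq carrier_free_mod carrier_ass_alg_words free_mod_simps ass_alg_simps
  proof (intro conjI ballI allI funcsetI)
    fix v w :: "'c \<Rightarrow>\<^sub>0 'r" assume v: "v \<in> supported C"
    show "wmap f (D (incl (Poly_Mapping.map_key f v))) \<in> supported (words (Suc 0) C)"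
      by (rule wmap_words[OF Der_values[OF D key[OF v]] f(2)])
    show "wmap f (D (incl (Poly_Mapping.map_key f (scale a v)))) =
      scale a (wmap f (D (incl (Poly_Mapping.map_key f v))))" for a
      using key[OF v] by (simp add: map_key_scale[OF f(1)] incl_scale g(1) dext_apply dmap_scale wmap_scale)
    assume w: "w \<in> supported C"
    show "wmap f (D (incl (Poly_Mapping.map_key f (v + w)))) =
      wmap f (D (incl (Poly_Mapping.map_key f v))) + wmap f (D (incl (Poly_Mapping.map_key f w)))"
      using key[OF v] key[OF w]
      by (simp add: map_key_add[OF f(1)] incl_add g(1) dext_apply dmap_add wmap_add)
  qed
  moreover have "wmap f (D (incl (Poly_Mapping.map_key f (mon c)))) =
    (if c \<in> range f then wmap f (D (mon [the_inv f c])) else 0)" for c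
    using f(1) D0 by (auto simp: map_key_mon_disjoint map_key_mon_image incl_trm incl_eq the_inv_f_f)
  ultimately show "der_ext C (\<lambda>w. ass_map (push f) (D (incl (Poly_Mapping.map_key f w)))) =
    dext C (\<lambda>c. if c \<in> range f then wmap f (D (mon [the_inv f c])) else 0)"
    by (simp add: ass_map_push der_ext_eq)
  assume "c \<in> C"
  then show "(if c \<in> range f then wmap f (D (mon [the_inv f c])) else 0) \<in> supported (words (Suc 0) C)"
  proof (cases "c \<in> range f")
    case True
    then obtain b where b: "c = f b" by auto
    with \<open>c \<in> C\<close> f(3) have "[b] \<in> words (Suc 0) B" by (auto simp: words_def)
    then have "wmap f (D (mon [b])) \<in> supported (words (Suc 0) C)"
      by (intro wmap_words[OF Der_values[OF D] f(2)]) simp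
    with b show ?thesis by (simp add: the_inv_f_f[OF f(1)])
  qed simp
qed

lemma pt_action_eq:
  fixes e :: "('b, 'r::comm_ring_1) tens \<Rightarrow> ('b, 'r) tens"
  assumes p: "p \<in> L1 B" and e: "e \<in> Der B"
  defines "h \<equiv> \<lambda>c. if c \<in> range Inr then wmap Inr (e (mon [the_inv Inr c])) else 0"
  shows "pt_action B (pd B p) e = pd B (dmap h p)"
proof -
  have w: "p \<in> supported (words (Suc 0) (pt B))"
    using p lin_words_words[of "Suc 0" B] words_mono[of "Suc 0" "Suc (Suc 0)" "pt B"] by (auto simp: supported_def)
  have h: "c \<in> pt B \<Longrightarrow> h c \<in> supported (words (Suc 0) (pt B))" for c
    using der_ext_transport(2)[of e B Inr "pt B" c] e unfolding h_def by fastforce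
  have "pt_action B (pd B p) e = prelie (pt B) (pd B p) (dext (pt B) h)"
    unfolding pt_action_def h_def using e by (subst der_ext_transport(1)[where B = B]) auto
  also have "\<dots> = dext (pt B) (\<lambda>c. dmap h (at star p c))"
    unfolding pd_def by (rule prelie_dext) (use h w in \<open>auto simp: at_def\<close>)
  also have "(\<lambda>c. dmap h (at star p c)) = at star (dmap h p)"
    by (auto simp: at_def)
  finally show ?thesis by (simp add: pd_def)
qed

text \<open>
  The marked letter is killed by the acting derivation, which therefore acts by the Leibniz rule on the
  two sides of the mark.
\<close>

lemma dword_action:
  fixes e :: "('b, 'r::comm_ring_1) tens \<Rightarrow> ('b, 'r) tens"
  defines "h \<equiv> \<lambda>c. if c \<in> range Inr then wmap Inr (e (mon [the_inv Inr c])) else 0"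
  shows "dword h (pw u v) = wmap Inr (dword (\<lambda>b. e (mon [b])) u) * mon (star # map Inr v) +
    mon (map Inr u @ [star]) * wmap Inr (dword (\<lambda>b. e (mon [b])) v)"
proof -
  have "h (Inr b) = wmap Inr (e (mon [b]))" "h star = 0" for b
    by (auto simp: h_def the_inv_f_f inj_Inr)
  then show ?thesis
    by (simp add: pw_def dword_append dword_map[where h = "\<lambda>b. e (mon [b])"] mon_mult_mon_left flip: mult.assoc)
      (simp add: mon_mult_mon)
qed

text \<open>
  The span of the elements \<open>u \<otimes> 1\<close> and \<open>1 \<otimes> v\<close> contains the generators, and is stable under the action
  because a derivation kills the empty word.
\<close>

lemma Der_special_valid:
  fixes B :: "'b set"
  shows "submodule (pd B ` supported (special_words B)) scalars (pt_plus_alg B)"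
  "\<forall>x\<in>pd B ` supported (special_words B). \<forall>e\<in>Der B. pt_action B x e \<in> pd B ` supported (special_words B)"
  "Der_pt B \<inter> Der_deg 1 (pt B) \<subseteq> pd B ` supported (special_words B)"
proof -
  have L1: "p \<in> L1 B" if "p \<in> supported (special_words B)" for p :: "(unit + 'b, 'r::comm_ring_1) tens"
    by (rule supported_mono[OF that special_words_lin])
  then show "submodule (pd B ` supported (special_words B)) scalars (pt_plus_alg B)"
    by (intro pd_submoduleI) auto
  show "\<forall>x\<in>pd B ` supported (special_words B). \<forall>e\<in>Der B. pt_action B x e \<in> pd B ` supported (special_words B)"
  proof (intro ballI, elim imageE)
    fix x and e :: "('b, 'r::comm_ring_1) tens \<Rightarrow> ('b, 'r) tens"
      and p :: "(unit + 'b, 'r) tens"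
    assume e: "e \<in> Der B" and x: "x = pd B p" and p: "p \<in> supported (special_words B)"
    let ?h = "\<lambda>c. if c \<in> range Inr then wmap Inr (e (mon [the_inv Inr c])) else 0"
    have dw: "dword (\<lambda>b. e (mon [b])) u \<in> supported (words (Suc 0) B)" if "u \<in> words (Suc 0) B" for u
    proof -
      have "dmap (\<lambda>b. e (mon [b])) (mon u) \<in> supported (words (0 + Suc 0) B)"
        using that by (intro dmap_supported Der_values[OF e]) (auto simp: words_def)
      then show ?thesis by simp
    qed
    have wdw: "wmap Inr (dword (\<lambda>b. e (mon [b])) u) \<in> supported (map Inr ` words (Suc 0) B)"
      if "u \<in> words (Suc 0) B" for u
      by (rule wmap_supported[OF dw[OF that]]) simp
    have "dmap ?h p \<in> supported (special_words B)"
      unfolding dmap_def using p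
    proof (rule lin_ext_supported)
      fix w assume "w \<in> special_words B"
      then consider u where "w = pw u []" "u \<in> words (Suc 0) B" | v where "w = pw [] v" "v \<in> words (Suc 0) B"
        by (auto simp: special_words_def)
      then show "dword ?h w \<in> supported (special_words B)"
      proof cases
        case 1
        have "wmap Inr (dword (\<lambda>b. e (mon [b])) u) * mon [star] \<in> supported (special_words B)"
          by (rule mult_supported[OF wdw[OF 1(2)], where Y = "{[star]}"])
            (auto simp: special_words_def pw_def)
        with 1 show ?thesis by (simp only: dword_action) simp
      next
        case 2
        have "mon [star] * wmap Inr (dword (\<lambda>b. e (mon [b])) v) \<in> supported (special_words B)"
          by (rule mult_supported[OF _ wdw[OF 2(2)], where X = "{[star]}"])
            (auto simp: special_words_def pw_def)
        with 2 show ?thesis by (simp only: dword_action) simp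
      qed
    qed
    then show "pt_action B x e \<in> pd B ` supported (special_words B)"
      unfolding x pt_action_eq[OF L1[OF p] e] by (rule imageI)
  qed
  show "Der_pt B \<inter> Der_deg 1 (pt B) \<subseteq> pd B ` supported (special_words B)"
  proof clarify
    fix D assume D: "D \<in> Der_pt B" "D \<in> Der_deg 1 (pt B)"
    then obtain p where p: "D = pd B p" "p \<in> supported (lin_words 0 B)" by (auto simp: Der_pt_eq)
    have "D (mon [star]) \<in> supported {w \<in> lists (pt B). length w = Suc 1}"
      by (rule Der_deg_values[OF D(2)]) simp
    then have "p \<in> supported (lin_words 0 B \<inter> {w. length w = 2})"
      using p by (auto simp: supported_def)
    moreover have "lin_words 0 B \<inter> {w. length w = 2} \<subseteq> special_words B"
    proof
      fix w assume "w \<in> lin_words 0 B \<inter> {w. length w = 2}"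
      then obtain u v where uv: "w = pw u v" "length w = 2" "u \<in> lists B" "v \<in> lists B"
        using lin_wordsE by (metis Int_iff mem_Collect_eq)
      then have "u = [] \<or> v = []" by (cases u; cases v) auto
      with uv show "w \<in> special_words B" by (auto simp: special_words_def words_def)
    qed
    ultimately show "D \<in> pd B ` supported (special_words B)" using p supported_mono by blast
  qed
qed

lemma Der_special_submodule:
  "submodule (Der_special B) scalars (pt_plus_alg B :: ('r::comm_ring_1, (unit + 'b, 'r) tens \<Rightarrow> _) module)"
  unfolding Der_special_def
proof (rule submodule_hull[OF module_pt_plus_alg])
  let ?N = "pd B ` (supported (special_words B) :: (unit + 'b, 'r) tens set)"
  show "submodule ?N scalars (pt_plus_alg B) \<and> (\<forall>x\<in>?N. \<forall>e\<in>Der B. pt_action B x e \<in> ?N)"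
    using Der_special_valid(1,2) by blast
  show "Der_pt B \<inter> Der_deg 1 (pt B) \<subseteq> ?N" by (rule Der_special_valid(3))
qed blast

lemma Der_special_action: "x \<in> Der_special B \<Longrightarrow> e \<in> Der B \<Longrightarrow> pt_action B x e \<in> Der_special B"
  unfolding Der_special_def hull_def by auto

lemma Der_special_degree_one:
  assumes "w \<in> special_words B" "length w = 2"
  shows "pd B (mon w) \<in> Der_special B"
proof -
  have "w \<in> lin_words 0 B" using assms special_words_lin lin_words_mono[of 0 "Suc 0" B] by auto
  moreover have "w \<in> lists (pt B)"
    using \<open>w \<in> lin_words 0 B\<close> by (auto elim!: lin_wordsE)
  ultimately have "pd B (mon w) \<in> Der_pt B \<inter> Der_deg 1 (pt B)"
    using assms(2) by (auto simp: Der_pt_eq pd_def at_def intro!: dext_in_Der_deg)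
  then show ?thesis unfolding Der_special_def by (rule hull_inc)
qed

text \<open>
  All of the span is generated: a derivation of arbitrary degree may act, and \<open>b \<mapsto> u\<close> turns \<open>b \<otimes> 1\<close> into
  \<open>u \<otimes> 1\<close> and \<open>1 \<otimes> b\<close> into \<open>1 \<otimes> u\<close>.
\<close>

lemma Der_special_eq: "Der_special B = pd B ` supported (special_words B)"
proof (intro equalityI subsetI)
  fix D assume "D \<in> Der_special B"
  moreover have "Der_special B \<subseteq> pd B ` supported (special_words B)"
    unfolding Der_special_def by (rule hull_minimal[OF Der_special_valid(3)]) (rule conjI[OF Der_special_valid(1,2)])
  ultimately show "D \<in> pd B ` supported (special_words B)" by blast
next
  have word: "pd B (mon w :: (unit + 'a, 'b) tens) \<in> Der_special B" if w: "w \<in> special_words B" for w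
  proof -
    have *: "\<exists>b u'. u = b # u' \<and> b \<in> B \<and> u \<in> lists B" if "u \<in> words (Suc 0) B" for u :: "'a list"
      using that by (cases u) (auto simp: words_def)
    from w consider u where "w = pw u []" "u \<in> words (Suc 0) B" | v where "w = pw [] v" "v \<in> words (Suc 0) B"
      by (auto simp: special_words_def)
    then obtain b u x where u: "u \<in> words (Suc 0) B" "b \<in> B" "x = pw [b] [] \<and> w = pw u [] \<or> x = pw [] [b] \<and> w = pw [] u"
      using * by metis
    let ?e = "dext B (at b (mon u :: ('a, 'b) tens))"
    have e: "?e \<in> Der B" using u by (intro dext_in_Der) (auto simp: at_def)
    have x: "x \<in> special_words B" "length x = 2" using u by (auto simp: special_words_def words_def)
    have L1: "(mon x :: (unit + 'a, 'b) tens) \<in> L1 B" using x special_words_lin by auto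
    have eb: "?e (mon [b]) = mon u" using u(2) by (simp add: dext_mon) (simp add: at_def)
    have "pt_action B (pd B (mon x)) ?e = pd B (mon w)"
      unfolding pt_action_eq[OF L1 e] dmap_mon using u(3)
      by (elim disjE conjE; simp only: dword_action; simp add: eb mon_mult_mon pw_def)
    then show ?thesis using Der_special_action[OF Der_special_degree_one[OF x] e] by simp
  qed
  fix D :: "(unit + 'a, 'b) tens \<Rightarrow> (unit + 'a, 'b) tens"
  assume "D \<in> pd B ` supported (special_words B)"
  then obtain p where p: "D = pd B p" "p \<in> supported (special_words B)" by auto
  from p(2) have "pd B p \<in> Der_special B"
  proof (induction rule: supported_induct)
    case zero
    show ?case using submoduleD(1)[OF Der_special_submodule, of B] by (simp add: pd_zero[of B])
  next
    case (add p q)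
    show ?case using submoduleD(2)[OF Der_special_submodule add(3,4)] by (simp add: pd_add)
  next
    case (trm w a)
    show ?case using submoduleD(3)[OF Der_special_submodule word[OF trm], of a] by (simp add: pd_scale)
  qed
  with p show "D \<in> Der_special B" by simp
qed

section \<open>The kernel of the projection to the target of the divergence\<close>

text \<open>
  The commutator of \<open>T(V) \<otimes> T(V)\<^sup>o\<^sup>p\<close>, written through substitution into the marked letter.
\<close>

definition comm :: "(unit + 'b, 'r::comm_ring_1) tens \<Rightarrow> (unit + 'b, 'r) tens \<Rightarrow> (unit + 'b, 'r) tens" where
  "comm p q = dmap (at star q) p - dmap (at star p) q"

lemma comm_add_left: "comm (p + p') q = comm p q + comm p' q"
  and comm_add_right: "comm p (q + q') = comm p q + comm p q'"
  by (simp_all add: comm_def dmap_add at_add dmap_add_left)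

lemma comm_scale_left: "comm (scale a p) q = scale a (comm p q)"
  and comm_scale_right: "comm p (scale a q) = scale a (comm p q)"
  by (simp_all add: comm_def dmap_scale at_scale dmap_scale_left scale_diff_right)

lemma comm_pw:
  "comm (mon (pw u v)) (mon (pw u' v')) = mon (pw (u @ u') (v' @ v)) - mon (pw (u' @ u) (v @ v'))"
  by (simp add: comm_def dword_star pw_mult)

lemma comm_zero [simp]: "comm 0 q = 0" "comm p 0 = 0"
  by (simp_all add: comm_def at_zero) (simp_all add: dmap_def lin_ext_def)

lemma comm_L1: "p \<in> L1 B \<Longrightarrow> q \<in> L1 B \<Longrightarrow> comm p q \<in> L1 B"
  by (simp add: comm_def dmap_star_L1)

lemma commutator_gens:
  "{(x \<otimes>\<^bsub>pt_plus_alg B\<^esub> y) \<ominus>\<^bsub>pt_plus_alg B\<^esub> (y \<otimes>\<^bsub>pt_plus_alg B\<^esub> x) | x y.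
     x \<in> carrier (pt_plus_alg B) \<and> y \<in> carrier (pt_plus_alg B)} = {pd B (comm p q) | p q. p \<in> L1 B \<and> q \<in> L1 B}"
proof -
  have eq: "(pd B p \<otimes>\<^bsub>pt_plus_alg B\<^esub> pd B q) \<ominus>\<^bsub>pt_plus_alg B\<^esub> (pd B q \<otimes>\<^bsub>pt_plus_alg B\<^esub> pd B p) = pd B (comm p q)"
    if "p \<in> L1 B" "q \<in> L1 B" for p q :: "(unit + 'a, 'b) tens"
    using that by (simp add: prelie_pd pt_plus_alg_minus dmap_star_L1 comm_def)
  show ?thesis
  proof (intro equalityI subsetI)
    fix d :: "(unit + 'a, 'b) tens \<Rightarrow> (unit + 'a, 'b) tens"
    assume "d \<in> {pd B (comm p q) | p q. p \<in> L1 B \<and> q \<in> L1 B}"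
    then obtain p q where "d = pd B (comm p q)" "p \<in> L1 B" "q \<in> L1 B" by blast
    then show "d \<in> {(x \<otimes>\<^bsub>pt_plus_alg B\<^esub> y) \<ominus>\<^bsub>pt_plus_alg B\<^esub> (y \<otimes>\<^bsub>pt_plus_alg B\<^esub> x) | x y.
        x \<in> carrier (pt_plus_alg B) \<and> y \<in> carrier (pt_plus_alg B)}"
      by (intro CollectI exI[of _ "pd B p"] exI[of _ "pd B q"]) (simp add: eq del: pt_plus_alg_simps(5))
  qed (auto simp: Der_pt_plus_eq eq simp del: pt_plus_alg_simps(5), blast)
qed

lemma commutator_sub_pt:
  "commutator_sub (pt_plus_alg B) = gen_submodule (pt_plus_alg B) {pd B (comm p q) | p q. p \<in> L1 B \<and> q \<in> L1 B}"
  unfolding commutator_sub_def commutator_gens ..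

lemma commutator_sub_submodule:
  "submodule (commutator_sub (pt_plus_alg B)) scalars (pt_plus_alg B)"
  unfolding commutator_sub_pt
  by (rule gen_submodule_submodule[OF module_pt_plus_alg]) (auto simp: comm_L1)

text \<open>
  The elements of \<open>T(V) \<otimes> T(V)\<^sup>o\<^sup>p\<close> of positive degree that vanish in \<open>pt_quot B\<close>: sums of commutators
  and special elements.
\<close>

definition null :: "'b set \<Rightarrow> (unit + 'b, 'r::comm_ring_1) tens set" where
  "null B = {p + q | p q. pd B p \<in> commutator_sub (pt_plus_alg B) \<and> p \<in> L1 B \<and> q \<in> supported (special_words B)}"

lemma special_L1: "q \<in> supported (special_words B) \<Longrightarrow> q \<in> L1 B"
  by (erule supported_mono[OF _ special_words_lin])

lemma nullI: "pd B p \<in> commutator_sub (pt_plus_alg B) \<Longrightarrow> p \<in> L1 B \<Longrightarrow> q \<in> supported (special_words B) \<Longrightarrow>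
    p + q \<in> null B"
  unfolding null_def by blast

lemma null_comm: "p \<in> L1 B \<Longrightarrow> q \<in> L1 B \<Longrightarrow> comm p q \<in> null B"
  using nullI[of B "comm p q" 0] comm_L1[of p B q]
  by (auto simp: commutator_sub_pt intro!: gen_submodule_inc)

lemma null_special: "q \<in> supported (special_words B) \<Longrightarrow> q \<in> null B"
  using nullI[of B 0 q] submoduleD(1)[OF commutator_sub_submodule, of B] by (simp add: pd_zero[of B])

lemma null_zero: "0 \<in> null B"
  by (rule null_special) simp

lemma null_add:
  assumes "p \<in> null B" "q \<in> null B" shows "p + q \<in> null B"
proof -
  obtain p1 p2 q1 q2 where
    *: "p = p1 + p2" "pd B p1 \<in> commutator_sub (pt_plus_alg B)" "p1 \<in> L1 B" "p2 \<in> supported (special_words B)"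
      "q = q1 + q2" "pd B q1 \<in> commutator_sub (pt_plus_alg B)" "q1 \<in> L1 B" "q2 \<in> supported (special_words B)"
    using assms unfolding null_def by blast
  have "pd B (p1 + q1) \<in> commutator_sub (pt_plus_alg B)"
    using submoduleD(2)[OF commutator_sub_submodule *(2,6)] by (simp add: pd_add)
  then have "(p1 + q1) + (p2 + q2) \<in> null B" using * by (intro nullI) auto
  then show ?thesis by (simp add: *(1,5) algebra_simps)
qed

lemma null_scale:
  assumes "p \<in> null B" shows "scale a p \<in> null B"
proof -
  obtain p1 p2 where
    *: "p = p1 + p2" "pd B p1 \<in> commutator_sub (pt_plus_alg B)" "p1 \<in> L1 B" "p2 \<in> supported (special_words B)"
    using assms unfolding null_def by blast
  have "pd B (scale a p1) \<in> commutator_sub (pt_plus_alg B)"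
    using submoduleD(3)[OF commutator_sub_submodule *(2), of a] by (simp add: pd_scale)
  then show ?thesis using * by (auto simp: scale_add_right intro: nullI)
qed

text \<open>
  By bilinearity it suffices to know the commutators of words; a linear map thus vanishes on \<open>null B\<close> once
  it does so on these and on the special words.
\<close>

lemma null_induct [consumes 1, case_names zero add scale comm special]:
  fixes P :: "(unit + 'b, 'r::comm_ring_1) tens \<Rightarrow> bool"
  assumes "p \<in> null B" and zero: "P 0"
    and add: "\<And>p q. p \<in> L1 B \<Longrightarrow> q \<in> L1 B \<Longrightarrow> P p \<Longrightarrow> P q \<Longrightarrow> P (p + q)"
    and scl: "\<And>a p. p \<in> L1 B \<Longrightarrow> P p \<Longrightarrow> P (scale a p)"
    and com: "\<And>u v u' v'. u \<in> lists B \<Longrightarrow> v \<in> lists B \<Longrightarrow> u' \<in> lists B \<Longrightarrow> v' \<in> lists B \<Longrightarrow>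
      Suc 0 \<le> length u + length v \<Longrightarrow> Suc 0 \<le> length u' + length v' \<Longrightarrow>
      P (mon (pw (u @ u') (v' @ v)) - mon (pw (u' @ u) (v @ v')))"
    and spec: "\<And>w. w \<in> special_words B \<Longrightarrow> P (mon w)"
  shows "P p"
proof -
  let ?Z = "{p \<in> L1 B. P p}"
  have comm: "P (comm p q)" if "p \<in> L1 B" "q \<in> L1 B" for p q
    using that(1)
  proof (induction rule: supported_induct)
    case (add p p')
    then show ?case
      unfolding comm_add_left using that(2) by (intro assms(3) comm_L1)
  next
    case (trm w a)
    show ?case using that(2)
    proof (induction rule: supported_induct)
      case (add q q')
      have "trm w a \<in> L1 B" using trm by simp
      with add show ?case unfolding comm_add_right by (intro assms(3) comm_L1)
    next
      case (trm w' b)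
      obtain u v where w: "w = pw u v" "u \<in> lists B" "v \<in> lists B" "Suc 0 \<le> length u + length v"
        using \<open>w \<in> lin_words (Suc 0) B\<close> by (elim lin_wordsE)
      obtain u' v' where w': "w' = pw u' v'" "u' \<in> lists B" "v' \<in> lists B" "Suc 0 \<le> length u' + length v'"
        using trm by (elim lin_wordsE)
      have L: "mon (pw (u @ u') (v' @ v)) - mon (pw (u' @ u) (v @ v')) \<in> L1 B"
        using w w' by auto
      have "P (mon (pw (u @ u') (v' @ v)) - mon (pw (u' @ u) (v @ v')))"
        by (rule com) (use w w' in simp_all)
      moreover have "comm (trm w a) (trm w' b) = scale a (scale b (comm (mon w) (mon w')))"
      proof -
        have "trm w a = scale a (mon w)" "trm w' b = scale b (mon w')" by simp_all
        then show ?thesis by (simp only: comm_scale_left comm_scale_right scale_scale mult.commute)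
      qed
      ultimately show ?case
        unfolding w(1) w'(1) comm_pw using scl[OF supported_scale[OF L] scl[OF L]] by simp
    qed (simp add: zero)
  qed (simp add: zero)
  have sub: "submodule (pd B ` ?Z) scalars (pt_plus_alg B)"
    by (rule pd_submoduleI) (auto simp: zero add scl)
  have "commutator_sub (pt_plus_alg B) \<subseteq> pd B ` ?Z"
    unfolding commutator_sub_pt
    by (rule gen_submodule_minimal[OF sub]) (auto simp: comm comm_L1)
  moreover obtain c q where p: "p = c + q" "pd B c \<in> commutator_sub (pt_plus_alg B)" "q \<in> supported (special_words B)"
    using \<open>p \<in> null B\<close> unfolding null_def by blast
  ultimately have "pd B c \<in> pd B ` ?Z" by blast
  then have c: "c \<in> ?Z" by auto
  have "q \<in> ?Z" using p(3)
  proof (induction rule: supported_induct)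
    case (trm w a)
    then have "mon w \<in> L1 B" by (intro special_L1) simp
    from scl[OF this spec[OF trm], of a] trm special_words_lin show ?case by auto
  qed (auto simp: zero add)
  with c p show ?thesis using add by auto
qed

text \<open>
  The projection to \<open>pt_quot B\<close>, an iterated quotient, with kernel \<open>null B\<close>.
\<close>

definition cls :: "'b set \<Rightarrow> (unit + 'b, 'r::comm_ring_1) tens \<Rightarrow>
    ((unit + 'b, 'r) tens \<Rightarrow> (unit + 'b, 'r) tens) set set" where
  "cls B p = Im_special B +>\<^bsub>abs_quot (pt_plus_alg B)\<^esub> abs_class B (pd B p)"

lemma quotient_abs: "quotient (pt_plus_alg B) (commutator_sub (pt_plus_alg B))"
  by (intro quotient.intro module_pt_plus_alg commutator_sub_submodule)

lemma abs_class_simps: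
  assumes "p \<in> L1 B" "q \<in> L1 B"
  shows "abs_class B (pd B p) \<oplus>\<^bsub>abs_quot (pt_plus_alg B)\<^esub> abs_class B (pd B q) = abs_class B (pd B (p + q))"
    "abs_class B (pd B p) \<ominus>\<^bsub>abs_quot (pt_plus_alg B)\<^esub> abs_class B (pd B q) = abs_class B (pd B (p - q))"
    "abs_class B (pd B p) = abs_class B (pd B q) \<longleftrightarrow> pd B (p - q) \<in> commutator_sub (pt_plus_alg B)"
  using assms quotient.coset_add[OF quotient_abs, of "pd B p" B "pd B q"]
    quotient.quot_minus[OF quotient_abs, of "pd B p" B "pd B q"]
    quotient.coset_eq_iff[OF quotient_abs, of "pd B p" B "pd B q"]
  by (simp_all add: abs_class_def abs_quot_def pd_add pt_plus_alg_minus)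

lemma abs_class_scale:
  assumes "p \<in> L1 B"
  shows "a \<odot>\<^bsub>abs_quot (pt_plus_alg B)\<^esub> abs_class B (pd B p) = abs_class B (pd B (scale a p))"
    and "abs_class B (pd B p) \<in> carrier (abs_quot (pt_plus_alg B))"
  using assms quotient.coset_smult[OF quotient_abs, of "pd B p" B a]
    quotient.coset_carrier[OF quotient_abs, of "pd B p" B]
  by (simp_all add: abs_class_def abs_quot_def pd_scale)

lemma abs_class_zero: "\<zero>\<^bsub>abs_quot (pt_plus_alg B)\<^esub> = abs_class B (pd B 0)"
  using quotient.coset_zero[OF quotient_abs, of B] by (simp add: abs_class_def abs_quot_def pd_zero[of B])

lemma carrier_abs_quot: "carrier (abs_quot (pt_plus_alg B)) = (\<lambda>p. abs_class B (pd B p)) ` L1 B"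
  by (auto simp: abs_quot_def carrier_quot_module abs_class_def Der_pt_plus_eq)

lemma Im_special_eq: "Im_special B = (\<lambda>p. abs_class B (pd B p)) ` supported (special_words B)"
  by (auto simp: Im_special_def Der_special_eq)

lemma quotient_special: "quotient (abs_quot (pt_plus_alg B)) (Im_special B)"
proof (rule quotient.intro)
  show M: "module scalars (abs_quot (pt_plus_alg B))"
    unfolding abs_quot_def by (rule quotient.module_quot[OF quotient_abs])
  show "submodule (Im_special B) scalars (abs_quot (pt_plus_alg B))"
    by (rule scalar_submoduleI[OF M])
      (auto simp: Im_special_eq carrier_abs_quot abs_class_zero abs_class_simps abs_class_scale special_L1 intro!: imageI)
qed

lemma abs_class_in_Im_special:
  assumes p: "p \<in> L1 B" shows "abs_class B (pd B p) \<in> Im_special B \<longleftrightarrow> p \<in> null B"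
proof
  assume "abs_class B (pd B p) \<in> Im_special B"
  then obtain q where q: "q \<in> supported (special_words B)" "abs_class B (pd B p) = abs_class B (pd B q)"
    by (auto simp: Im_special_eq)
  then have "pd B (p - q) \<in> commutator_sub (pt_plus_alg B)"
    using p by (simp add: abs_class_simps(3) special_L1)
  from nullI[OF this _ q(1)] show "p \<in> null B" using p special_L1[OF q(1)] by simp
next
  assume "p \<in> null B"
  then obtain c q where *: "p = c + q" "pd B c \<in> commutator_sub (pt_plus_alg B)" "c \<in> L1 B"
      "q \<in> supported (special_words B)"
    unfolding null_def by blast
  then have "abs_class B (pd B p) = abs_class B (pd B q)"
    using p by (subst abs_class_simps(3)) (auto simp: special_L1)
  then show "abs_class B (pd B p) \<in> Im_special B" using *(4) by (auto simp: Im_special_eq)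
qed

lemma cls_simps:
  assumes "p \<in> L1 B" "q \<in> L1 B"
  shows "cls B p \<oplus>\<^bsub>pt_quot B\<^esub> cls B q = cls B (p + q)"
    "cls B p = cls B q \<longleftrightarrow> p - q \<in> null B"
  using assms quotient.coset_add[OF quotient_special, of "abs_class B (pd B p)" B "abs_class B (pd B q)"]
    quotient.coset_eq_iff[OF quotient_special, of "abs_class B (pd B p)" B "abs_class B (pd B q)"]
  by (simp_all add: cls_def pt_quot_def abs_class_simps abs_class_scale abs_class_in_Im_special)

lemma cls_scale:
  assumes "p \<in> L1 B"
  shows "a \<odot>\<^bsub>pt_quot B\<^esub> cls B p = cls B (scale a p)" and "cls B p \<in> carrier (pt_quot B)"
  using assms quotient.coset_smult[OF quotient_special, of "abs_class B (pd B p)" B a]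
    quotient.coset_carrier[OF quotient_special, of "abs_class B (pd B p)" B]
  by (simp_all add: cls_def pt_quot_def abs_class_scale)

lemma carrier_pt_quot: "carrier (pt_quot B) = cls B ` L1 B"
  by (auto simp: pt_quot_def carrier_quot_module carrier_abs_quot cls_def)

section \<open>The divergence on words\<close>

text \<open>
  The contribution of \<open>w \<otimes> b\<^sup>*\<close> to the divergence, the sum of \<open>p \<otimes> q\<close> over all factorisations
  \<open>w = p b q\<close>. It is the Leibniz rule for the substitution of the marked letter for \<open>b\<close>.
\<close>

definition occ :: "'b \<Rightarrow> 'b list \<Rightarrow> (unit + 'b, 'r::comm_ring_1) tens" where
  "occ b w = dword (at (Inr b) (mon [star])) (map Inr w)"

lemma occ_sum: "occ b w = (\<Sum>i<length w. if w ! i = b then mon (pw (take i w) (drop (Suc i) w)) else 0)"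
  unfolding occ_def dword_sum
  by (auto intro!: sum.cong simp: at_def pw_def mon_mult_mon take_map drop_map)

lemma occ_supported:
  assumes "w \<in> words (Suc k) B" shows "occ b w \<in> supported (lin_words k B)"
  unfolding occ_sum
proof (rule supported_sum)
  fix i assume i: "i \<in> {..<length w}"
  have "take i w \<in> lists B" "drop (Suc i) w \<in> lists B"
    using assms by (auto simp: words_def dest: in_set_takeD in_set_dropD)
  moreover have "k \<le> length (take i w) + length (drop (Suc i) w)" using assms i by (auto simp: words_def)
  ultimately show "(if w ! i = b then mon (pw (take i w) (drop (Suc i) w)) else 0) \<in> supported (lin_words k B)"
    by auto
qed

lemma ass_lin_map_delta_word: "ass_lin_map (\<lambda>v. cf v b) (delta_word w) = (occ b w :: (unit + 'b, 'r::comm_ring_1) tens)"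
proof -
  define f :: "('b + 'b \<Rightarrow>\<^sub>0 'r) \<Rightarrow> (unit + 'b \<Rightarrow>\<^sub>0 'r)" where
    "f = (\<lambda>u. trm star (cf (Poly_Mapping.map_key Inl u) b) + push Inr (Poly_Mapping.map_key Inr u))"
  have Inl: "incl (f (mon (Inl c))) = (if c = b then mon [star] else 0)" for c
    by (simp add: f_def map_key_mon_image map_key_mon_disjoint image_iff incl_trm lookup_single push_eq)
  have Inr: "incl (f (mon (Inr c))) = mon [Inr c]" for c
    by (simp add: f_def map_key_mon_image map_key_mon_disjoint image_iff incl_trm push_eq)
  have prod: "prod_list (map (\<lambda>x. incl (f (mon x))) (map Inr u)) = mon (map Inr u)" for u
    using prod_list_mon[of Inr u] by (simp add: comp_def Inr)
  have "ass_map f (delta_word w) = (\<Sum>i<length w. mon (map Inr (take i w)) *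
      ((if w ! i = b then mon [star] else 0) * mon (map Inr (drop (Suc i) w))))"
    by (simp add: ass_map_eq delta_word_def lin_ext_sum Inl prod del: map_map)
  also have "\<dots> = occ b w"
    unfolding occ_sum by (intro sum.cong refl) (simp add: mon_mult_mon pw_def)
  finally show ?thesis by (simp add: ass_lin_map_def f_def)
qed

lemma Phi_eq: "Phi B d = (\<Sum>b\<in>B. lin_ext (occ b) (d (mon [b])))"
  unfolding Phi_def
proof (rule sum.cong[OF refl])
  fix b
  have "ass_lin_map (\<lambda>v. cf v b) (delta p) = lin_ext (occ b) p" for p :: "('a, 'b) tens"
    unfolding ass_lin_map_def ass_map_eq delta_eq lin_ext_lin_ext
    by (simp add: ass_lin_map_delta_word[unfolded ass_lin_map_def ass_map_eq])
  then show "ass_lin_map (\<lambda>v. cf v b) (delta (d (incl (mon b)))) = lin_ext (occ b) (d (mon [b]))"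
    by (simp add: incl_trm)
qed

lemma Phi_L1:
  assumes "\<And>b. b \<in> B \<Longrightarrow> d (mon [b]) \<in> supported (words 2 B)"
  shows "Phi B d \<in> L1 B"
  unfolding Phi_eq
proof (rule supported_sum)
  fix b assume "b \<in> B"
  show "lin_ext (occ b) (d (mon [b])) \<in> L1 B"
    by (rule lin_ext_supported[OF assms[OF \<open>b \<in> B\<close>]]) (simp add: occ_supported numeral_2_eq_2)
qed

section \<open>Stabilisation\<close>

abbreviation stab :: "'b set \<Rightarrow> ('b + nat) set" where
  "stab B \<equiv> Sum_Type.Plus B {..<4}"

definition mark :: "unit + 'b \<Rightarrow> 'b + nat" where
  "mark = case_sum (\<lambda>_. Inr 0) Inl"

lemma mark_simps [simp]: "mark star = Inr 0" "mark (Inr b) = Inl b"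
  by (simp_all add: mark_def)

lemma map_mark [simp]: "map mark (pw u v) = map Inl u @ Inr 0 # map Inl v"
  by (simp add: pw_def)

interpretation stab: three_free_letters "Inl ` B" "stab B" "Inr 0" "Inr 1" "Inr 2" for B :: "'b set"
  by unfold_locales auto

text \<open>
  The relations that define the target of the divergence hold after stabilisation, by \<open>lie_commutator\<close>
  and \<open>lie_ends\<close>.
\<close>

lemma lie_mark_null:
  fixes p :: "(unit + 'b, 'r::comm_ring_1) tens"
  assumes "p \<in> null B"
  shows "lie (stab B) (at (Inr 0) (wmap mark p))"
  using assms
proof (induction rule: null_induct)
  case (comm u v u' v')
  then show ?case
    using stab.lie_commutator[where 'r = 'r, of "map Inl u'" B "map Inl v'" "map Inl u" "map Inl v"]
    by (simp add: wmap_diff image_subset_iff lists_image)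
next
  case (special w)
  then consider u where "w = pw u []" "u \<in> words (Suc 0) B" | v where "w = pw [] v" "v \<in> words (Suc 0) B"
    by (auto simp: special_words_def)
  then show ?case
  proof cases
    case 1
    then show ?thesis by (auto simp: words_def intro!: stab.lie_ends(2)[of _ B])
  next
    case 2
    then show ?thesis by (auto simp: words_def intro!: stab.lie_ends(1)[of _ B])
  qed
qed (simp_all add: at_zero lie_zero wmap_add at_add lie_add wmap_scale at_scale lie_scale)

lemma wmap_mark_occ:
  "wmap mark (occ b w :: (unit + 'b, 'r::comm_ring_1) tens) = dword (at (Inl b) (mon [Inr 0])) (map Inl w)"
proof -
  have "dword (at (Inl b) (mon [Inr 0])) (map mark (map Inr w)) =
      wmap mark (occ b w :: (unit + 'b, 'r) tens)"
    unfolding occ_def by (rule dword_map) (auto simp: at_def)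
  then show ?thesis by (simp add: comp_def)
qed

text \<open>
  Linear form of \<open>lie_divergence\<close>: up to the Lie algebra, \<open>b \<mapsto> p\<close> is its divergence with the marked
  letter turned into a new one.
\<close>

lemma lie_divergence_word:
  fixes p :: "('b, 'r::comm_ring_1) tens"
  assumes "b \<in> B" "p \<in> supported (words 2 B)"
  shows "lie (stab B) (\<lambda>x. at (Inl b) (wmap Inl p) x - at (Inr 0) (wmap mark (lin_ext (occ b) p)) x)"
  using assms(2)
proof (induction rule: supported_induct)
  case zero
  then show ?case by (simp add: at_zero lie_zero)
next
  case (add p q)
  from lie_add[OF add(3,4)] show ?case
    by (simp add: lin_ext_add wmap_add at_add algebra_simps)
next
  case (trm w a)
  then have "lie (stab B) (\<lambda>x. at (Inl b) (mon (map Inl w) :: ('b + nat, 'r) tens) x -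
      at (Inr 0) (dword (at (Inl b) (mon [Inr 0])) (map Inl w)) x)"
    using assms(1) by (intro stab.lie_divergence) (auto simp: words_def)
  from lie_scale[OF this, of a]
  have "lie (stab B) (\<lambda>x. at (Inl b) (wmap Inl (scale a (mon w :: ('b, 'r) tens))) x -
      at (Inr 0) (wmap mark (lin_ext (occ b) (scale a (mon w :: ('b, 'r) tens)))) x)"
    unfolding lin_ext_scale wmap_scale at_scale by (simp add: wmap_mark_occ scale_diff_right)
  then show ?case by simp
qed

lemma der_map_split_incl:
  fixes d :: "('b, 'r::comm_ring_1) tens \<Rightarrow> ('b, 'r) tens"
  assumes "d \<in> Der B"
  shows "der_map (stab B) split_incl d =
    dext (stab B) (\<lambda>c. if c \<in> range Inl then wmap Inl (d (mon [the_inv Inl c])) else 0)"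
  unfolding der_map_def split_incl_def prod.case
  using assms by (rule der_ext_transport(1)) auto

text \<open>
  The stabilised derivation is the sum over \<open>b\<close> of \<open>b \<mapsto> d(b)\<close>, hence congruent to the derivation that sends
  the new letter to the divergence of \<open>d\<close>, and this one lies in the Lie algebra.
\<close>

lemma stable_kernel:
  fixes d :: "('b, 'r::comm_ring_1) tens \<Rightarrow> ('b, 'r) tens"
  assumes "finite B" and d: "d \<in> Der B" "\<And>b. b \<in> B \<Longrightarrow> d (mon [b]) \<in> supported (words 2 B)"
    and null: "Phi B d \<in> null B"
  shows "der_map (stab B) split_incl d \<in> Der_Lie1 (stab B)"
proof -
  have "lie (stab B) (\<lambda>x. \<Sum>b\<in>B. at (Inl b) (wmap Inl (d (mon [b]))) x -
      at (Inr 0) (wmap mark (lin_ext (occ b) (d (mon [b])))) x)"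
    by (intro lie_sum lie_divergence_word d)
  then have "lie (stab B) (\<lambda>x. (\<Sum>b\<in>B. at (Inl b) (wmap Inl (d (mon [b]))) x) -
      at (Inr 0) (wmap mark (Phi B d)) x)"
    by (simp add: sum_subtractf Phi_eq wmap_sum at_sum)
  from lie_add[OF this lie_mark_null[OF null]]
  have "lie (stab B) (\<lambda>x. \<Sum>b\<in>B. at (Inl b) (wmap Inl (d (mon [b]))) x)" by simp
  also have "lie (stab B) (\<lambda>x. \<Sum>b\<in>B. at (Inl b) (wmap Inl (d (mon [b]))) x) =
    lie (stab B) (\<lambda>c. if c \<in> range Inl then wmap Inl (d (mon [the_inv Inl c])) else 0)"
  proof (rule lie_cong)
    fix c assume c: "c \<in> stab B"
    show "(\<Sum>b\<in>B. at (Inl b) (wmap Inl (d (mon [b]))) c) =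
      (if c \<in> range Inl then wmap Inl (d (mon [the_inv Inl c])) else 0)"
    proof (cases c)
      case (Inl b)
      with c have "b \<in> B" by simp
      have "(\<Sum>a\<in>B. at (Inl a) (wmap Inl (d (mon [a]))) c) =
          (\<Sum>a\<in>B. if a = b then wmap Inl (d (mon [b])) else 0)"
        by (intro sum.cong) (auto simp: at_def Inl)
      with \<open>finite B\<close> \<open>b \<in> B\<close> show ?thesis by (simp add: Inl the_inv_f_f)
    qed (auto simp: at_def)
  qed
  finally show ?thesis by (simp add: lie_def der_map_split_incl[OF d(1)])
qed

section \<open>Torsion of the kernel\<close>

lemma Der_Lie1_pos: "Der_Lie1 B \<subseteq> Der_pos B"
  unfolding Der_Lie1_def
proof (rule hull_minimal)
  show "Der_deg 1 B \<subseteq> Der_pos B" by (rule Der_deg_pos) simp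
  have "der_bracket B D E \<in> Der_pos B" if DE: "D \<in> Der_pos B" "E \<in> Der_pos B" for D E
  proof -
    have le: "supported (words 2 B) \<subseteq> supported (words (Suc 0) B)"
      using words_mono[of "Suc 0" 2 B] by (auto simp: supported_def)
    obtain g h where D: "D = dext B g" and E: "E = dext B h"
      and g2: "\<And>b. b \<in> B \<Longrightarrow> g b \<in> supported (words 2 B)" and h2: "\<And>b. b \<in> B \<Longrightarrow> h b \<in> supported (words 2 B)"
      using DE unfolding Der_pos_def mem_Collect_eq by (metis Der_dextE)
    have g: "b \<in> B \<Longrightarrow> g b \<in> supported (words (Suc 0) B)" and h: "b \<in> B \<Longrightarrow> h b \<in> supported (words (Suc 0) B)" for b
      using g2 h2 le by auto
    have val: "b \<in> B \<Longrightarrow> dmap h (g b) - dmap g (h b) \<in> supported (words 2 B)" for b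
      using dmap_supported[of B h 0 "g b" 2] dmap_supported[of B g 0 "h b" 2] g h g2 h2 by (auto simp: numeral_2_eq_2)
    with le have "dext B (\<lambda>b. dmap h (g b) - dmap g (h b)) \<in> Der B" by (intro dext_in_Der) auto
    moreover have "der_bracket B D E = dext B (\<lambda>b. dmap h (g b) - dmap g (h b))"
      unfolding D E by (rule bracket_dext[OF g h])
    ultimately show ?thesis using val by (simp add: Der_pos_def dext_mon)
  qed
  then show "submodule (Der_pos B) scalars (der_mod B) \<and> (\<forall>d\<in>Der_pos B. \<forall>e\<in>Der_pos B. der_bracket B d e \<in> Der_pos B)"
    using Der_pos_submodule by blast
qed

lemma Div_in_Im_special:
  assumes "D \<in> Der_pos B"
  shows "Div B D \<in> Im_special B \<longleftrightarrow> Phi B D \<in> null B" "Div B D \<in> carrier (abs_quot (pt_plus_alg B))"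
proof -
  have "Phi B D \<in> L1 B" using assms by (intro Phi_L1) (auto simp: Der_pos_def)
  then show "Div B D \<in> Im_special B \<longleftrightarrow> Phi B D \<in> null B" "Div B D \<in> carrier (abs_quot (pt_plus_alg B))"
    by (simp_all add: Div_def pt_der_eq abs_class_in_Im_special abs_class_scale)
qed

lemma Der_Lie1_coset:
  fixes e :: "('b, 'r::comm_ring_1) tens \<Rightarrow> ('b, 'r) tens"
  assumes "e \<in> Der_Lie1 C"
  shows "Der_Lie1 C +>\<^bsub>der_plus_mod C\<^esub> e = Der_Lie1 C"
proof (intro equalityI subsetI)
  fix d :: "('b, 'r) tens \<Rightarrow> ('b, 'r) tens"
  assume "d \<in> Der_Lie1 C +>\<^bsub>der_plus_mod C\<^esub> e"
  then show "d \<in> Der_Lie1 C"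
    using Der_Lie1_closed(1)[OF _ assms] by (auto simp: a_r_coset_def' der_plus_mod_def)
next
  fix d :: "('b, 'r) tens \<Rightarrow> ('b, 'r) tens"
  assume d: "d \<in> Der_Lie1 C"
  have "(\<lambda>p. d p + scale (-1) (e p)) \<in> Der_Lie1 C"
    by (intro Der_Lie1_closed d assms)
  moreover have "d = (\<lambda>p. (d p + scale (-1) (e p)) + e p)"
    by (simp add: scale_uminus_left)
  ultimately show "d \<in> Der_Lie1 C +>\<^bsub>der_plus_mod C\<^esub> e"
    by (auto simp: a_r_coset_def' der_plus_mod_def intro!: bexI[of _ "\<lambda>p. d p + scale (-1) (e p)"])
qed

text \<open>
  A class in the kernel consists of derivations of positive degree whose divergence lies in \<open>null B\<close>;
  all of them are killed by stabilisation, so the union of cosets in \<open>quot_map\<close> is a single coset.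
\<close>

lemma kernel_torsion:
  fixes B :: "'b set" and X :: "(('b, 'r::comm_ring_1) tens \<Rightarrow> ('b, 'r) tens) set"
  assumes "finite B" and X: "X \<in> a_kernel (der_quot B) (pt_quot B) (div_quot B)"
  shows "der_quot_map (stab B) split_incl X = \<zero>\<^bsub>der_quot (stab B)\<^esub>"
proof -
  have "X \<in> carrier (der_quot B)" and div: "div_quot B X = Im_special B"
    using X by (auto simp: a_kernel_def kernel_def pt_quot_def quot_module_def)
  then obtain d where d: "d \<in> Der_plus B" "X = Der_Lie1 B +>\<^bsub>der_plus_mod B\<^esub> d"
    by (auto simp: der_quot_def carrier_quot_module der_plus_mod_def)
  have X_eq: "X = {\<lambda>p. h p + d p | h. h \<in> Der_Lie1 B}"
    unfolding d(2) by (auto simp: a_r_coset_def' der_plus_mod_def)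
  have L: "der_map (stab B) split_incl x \<in> Der_Lie1 (stab B)" if x: "x \<in> X" for x
  proof -
    obtain h where "h \<in> Der_Lie1 B" "x = (\<lambda>p. h p + d p)" using x X_eq by blast
    then have pos: "x \<in> Der_pos B"
      using submoduleD(2)[OF Der_pos_submodule, of h B d] Der_Lie1_pos[of B] Der_plus_subset[of B] d(1) by auto
    have "Div B x \<in> Im_special B +>\<^bsub>abs_quot (pt_plus_alg B)\<^esub> Div B x"
      by (rule quotient.self_in_coset[OF quotient_special Div_in_Im_special(2)[OF pos]])
    also have "\<dots> \<subseteq> div_quot B X" using x by (auto simp: div_quot_def quot_map_def)
    finally have "Phi B x \<in> null B" using Div_in_Im_special(1)[OF pos] div by simp
    with pos show ?thesis using \<open>finite B\<close> by (intro stable_kernel) (auto simp: Der_pos_def)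
  qed
  have "X \<noteq> {}" using X_eq Der_Lie1_closed(3)[of B] by auto
  then have "der_quot_map (stab B) split_incl X = Der_Lie1 (stab B)"
    unfolding der_quot_map_def quot_map_def using L by (intro SUP_eq_const Der_Lie1_coset)
  then show ?thesis by (simp add: der_quot_def quot_module_def)
qed

section \<open>The target of the divergence as a tensor product\<close>

lemma module_free_mod: "module scalars (free_mod X :: ('r::comm_ring_1, 'x \<Rightarrow>\<^sub>0 'r) module)"
  by (rule scalar_moduleI)
    (auto simp: carrier_free_mod algebra_simps scale_add_left scale_add_right scale_scale scale_uminus_left)

lemma module_ass_alg: "module scalars (ass_alg X :: ('r::comm_ring_1, ('x, 'r) tens) module)"
  by (rule scalar_moduleI)
    (auto simp: carrier_ass_alg algebra_simps scale_add_left scale_add_right scale_scale scale_uminus_left)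

lemma ass_alg_minus: "p \<in> carrier (ass_alg B) \<Longrightarrow> q \<in> carrier (ass_alg B) \<Longrightarrow> p \<ominus>\<^bsub>ass_alg B\<^esub> q = p - q"
  using module_minus_one[OF module_ass_alg, of q B] by (simp add: a_minus_def scale_uminus_left)

lemma free_mod_minus: "p \<in> supported B \<Longrightarrow> q \<in> supported B \<Longrightarrow> p \<ominus>\<^bsub>free_mod B\<^esub> q = p - q"
  using module_minus_one[OF module_free_mod, of q B] by (simp add: a_minus_def scale_uminus_left carrier_free_mod)

abbreviation A1 :: "'b set \<Rightarrow> ('b, 'r::comm_ring_1) tens set" where
  "A1 B \<equiv> supported (words (Suc 0) B)"

lemma mult_A1: "p \<in> A1 B \<Longrightarrow> q \<in> A1 B \<Longrightarrow> p * q \<in> A1 B"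
  by (rule supported_mono[OF mult_supported_words words_mono]) auto

lemma commutator_sub_ass:
  "commutator_sub (ass_alg B) = gen_submodule (ass_alg B) {p * q - q * p | p q. p \<in> A1 B \<and> q \<in> A1 B}"
proof -
  have "(p \<otimes>\<^bsub>ass_alg B\<^esub> q) \<ominus>\<^bsub>ass_alg B\<^esub> (q \<otimes>\<^bsub>ass_alg B\<^esub> p) = p * q - q * p"
    if "p \<in> A1 B" "q \<in> A1 B" for p q :: "('a, 'b) tens"
    using that by (simp add: ass_alg_minus carrier_ass_alg_words mult_A1)
  then show ?thesis unfolding commutator_sub_def carrier_ass_alg_words
    by (intro arg_cong[where f = "gen_submodule (ass_alg B)"]) (metis (no_types, opaque_lifting))
qed

lemma quotient_ass: "quotient (ass_alg B) (commutator_sub (ass_alg B))"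
proof (intro quotient.intro module_ass_alg)
  show "submodule (commutator_sub (ass_alg B)) scalars (ass_alg B)"
    unfolding commutator_sub_ass
    by (rule gen_submodule_submodule[OF module_ass_alg]) (auto simp: carrier_ass_alg_words mult_A1)
qed

lemma submodule_opposite: "submodule H scalars (opposite A) \<longleftrightarrow> submodule H scalars A"
  by (simp add: submodule_def submodule_axioms_def opposite_def)

text \<open>
  Reversing the product only exchanges the two terms of each generating commutator.
\<close>

lemma commutator_sub_opposite: "commutator_sub (opposite A) = commutator_sub A"
proof -
  have "x \<ominus>\<^bsub>opposite A\<^esub> y = x \<ominus>\<^bsub>A\<^esub> y" for x y
    by (simp add: a_minus_def a_inv_def opposite_def)
  then show ?thesis
    unfolding commutator_sub_def gen_submodule_def submodule_opposite
    by (intro arg_cong[where f = "\<lambda>to_tensor. _ hull to_tensor"]) (auto simp: opposite_def)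
qed

lemma abs_quot_opposite: "abs_quot (opposite A) = abs_quot A"
  unfolding abs_quot_def commutator_sub_opposite
  by (simp add: quot_module_def A_RCOSETS_def set_add_def a_r_coset_def opposite_def)

text \<open>
  The class of \<open>p\<close> in \<open>|T|\<close>, where words that differ by a rotation agree.
\<close>

definition cyc :: "'b set \<Rightarrow> ('b, 'r::comm_ring_1) tens \<Rightarrow> ('b, 'r) tens set" where
  "cyc B p = commutator_sub (ass_alg B) +>\<^bsub>ass_alg B\<^esub> p"

abbreviation Cyc :: "'b set \<Rightarrow> ('r::comm_ring_1, ('b, 'r) tens set) module" where
  "Cyc B \<equiv> abs_quot (ass_alg B)"

lemma carrier_Cyc: "carrier (Cyc B) = cyc B ` A1 B"
  by (auto simp: abs_quot_def carrier_quot_module cyc_def carrier_ass_alg_words)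

lemma cyc_simps:
  assumes "p \<in> A1 B" "q \<in> A1 B"
  shows "cyc B p \<oplus>\<^bsub>Cyc B\<^esub> cyc B q = cyc B (p + q)"
    "cyc B p = cyc B q \<longleftrightarrow> p - q \<in> commutator_sub (ass_alg B)"
  using assms quotient.coset_add[OF quotient_ass, of p B q] quotient.coset_eq_iff[OF quotient_ass, of p B q]
  by (simp_all add: cyc_def abs_quot_def carrier_ass_alg_words ass_alg_minus)

lemma cyc_scale:
  assumes "p \<in> A1 B"
  shows "a \<odot>\<^bsub>Cyc B\<^esub> cyc B p = cyc B (scale a p)" "cyc B p \<in> carrier (Cyc B)"
  using assms quotient.coset_smult[OF quotient_ass, of p B a] quotient.coset_carrier[OF quotient_ass, of p B]
  by (simp_all add: cyc_def abs_quot_def carrier_ass_alg_words)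

definition cyc_rep :: "('b, 'r::comm_ring_1) tens set \<Rightarrow> ('b, 'r) tens" where
  "cyc_rep X = (SOME p. p \<in> X)"

lemma cyc_rep_cyc:
  assumes "p \<in> A1 B"
  shows "cyc_rep (cyc B p) - p \<in> commutator_sub (ass_alg B)" "cyc_rep (cyc B p) \<in> A1 B"
proof -
  have "p \<in> cyc B p" using quotient.self_in_coset[OF quotient_ass, of p B] assms by (simp add: cyc_def carrier_ass_alg_words)
  then have r: "cyc_rep (cyc B p) \<in> cyc B p" unfolding cyc_rep_def by (rule someI)
  then show "cyc_rep (cyc B p) \<in> A1 B"
    using quotient.coset_memD[OF quotient_ass, of _ B p] assms by (simp add: cyc_def carrier_ass_alg_words)
  from r show "cyc_rep (cyc B p) - p \<in> commutator_sub (ass_alg B)"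
    by (auto simp: cyc_def quotient.coset_mem[OF quotient_ass])
qed

lemma cyc_rep_Cyc: assumes "X \<in> carrier (Cyc B)" shows "cyc_rep X \<in> A1 B" "cyc B (cyc_rep X) = X"
proof -
  obtain p where p: "X = cyc B p" "p \<in> A1 B" using assms by (auto simp: carrier_Cyc)
  show "cyc_rep X \<in> A1 B" "cyc B (cyc_rep X) = X"
    using cyc_simps(2)[OF cyc_rep_cyc(2)[OF p(2)] p(2)] cyc_rep_cyc[OF p(2)] by (simp_all add: p(1))
qed

text \<open>
  The element \<open>p \<otimes> q\<close> of \<open>T(V) \<otimes> T(V)\<^sup>o\<^sup>p\<close>.
\<close>

definition around_star :: "('b, 'r::comm_ring_1) tens \<Rightarrow> ('b, 'r) tens \<Rightarrow> (unit + 'b, 'r) tens" where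
  "around_star p q = wmap Inr p * mon [star] * wmap Inr q"

lemma around_star_linear:
  "around_star (p + p') q = around_star p q + around_star p' q" "around_star p (q + q') = around_star p q + around_star p q'"
  "around_star (p - p') q = around_star p q - around_star p' q" "around_star p (q - q') = around_star p q - around_star p q'"
  "around_star (scale a p) q = scale a (around_star p q)" "around_star p (scale a q) = scale a (around_star p q)"
  "around_star 0 q = 0" "around_star p 0 = 0"
  by (simp_all add: around_star_def wmap_add wmap_diff wmap_scale algebra_simps scale_mult_left scale_mult_right)

lemma around_star_mon: "around_star (mon u) (mon v) = mon (pw u v)"
  by (simp add: around_star_def mon_mult_mon pw_def)

lemma around_star_L1:
  assumes "p \<in> supported (words j B)" "q \<in> supported (words k B)" "1 \<le> j + k"
  shows "around_star p q \<in> L1 B"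
  using assms(1)
proof (induction rule: supported_induct)
  case (trm u a)
  show ?case using assms(2)
  proof (induction rule: supported_induct)
    case (trm v b)
    have "around_star (scale a (mon u)) (scale b (mon v)) \<in> L1 B"
      unfolding around_star_linear around_star_mon using trm \<open>u \<in> words j B\<close> assms(3)
      by (intro supported_scale) (auto simp: words_def)
    then show ?case by simp
  qed (auto simp: around_star_linear)
qed (auto simp: around_star_linear)

lemma dmap_star_wmap: "dmap (at star z) (wmap Inr p) = 0"
  using supported_UNIV[of p] by (induction rule: supported_induct) (auto simp: wmap_add dmap_add dmap_trm image_iff)

lemma dmap_star_around_star: "dmap (at star z) (around_star p q) = wmap Inr p * z * wmap Inr q"
proof -
  have "dmap (at star z) (mon [star]) = z" by (simp add: at_def)
  then show ?thesis by (simp add: around_star_def dmap_mult dmap_star_wmap)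
qed

lemma around_star_sandwich: "wmap Inr p * around_star p' q' * wmap Inr q = around_star (p * p') (q' * q)"
  by (simp add: around_star_def wmap_mult mult.assoc)

lemma comm_around_star: "comm (around_star p q) (around_star p' q') = around_star (p * p') (q' * q) - around_star (p' * p) (q * q')"
  by (simp add: comm_def dmap_star_around_star around_star_sandwich)

lemma one_words: "(1 :: ('b, 'r::comm_ring_1) tens) \<in> supported (words 0 B)"
  by (simp add: words_def flip: mon_Nil)

text \<open>
  The reason is that \<open>[p \<otimes> 1, p' \<otimes> q] = [p, p'] \<otimes> q\<close> and \<open>[1 \<otimes> p', q \<otimes> p] = q \<otimes> [p, p']\<close> (with \<open>[p, p']\<close>
  taken in \<open>T(V)\<close>); the first factors have positive degree although their second, respectively first,
  component is the unit.
\<close>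

lemma around_star_commutator_null:
  fixes k q :: "('b, 'r::comm_ring_1) tens"
  assumes "k \<in> commutator_sub (ass_alg B)" "q \<in> A1 B"
  shows "around_star k q \<in> null B" "around_star q k \<in> null B"
proof -
  let ?N = "{k :: ('b, 'r) tens. k \<in> A1 B \<and> (\<forall>q\<in>A1 B. around_star k q \<in> null B \<and> around_star q k \<in> null B)}"
  have "commutator_sub (ass_alg B) \<subseteq> ?N"
    unfolding commutator_sub_ass
  proof (rule gen_submodule_minimal)
    show "submodule ?N scalars (ass_alg B)"
      by (rule scalar_submoduleI[OF module_ass_alg])
        (auto simp: carrier_ass_alg_words around_star_linear null_zero null_add null_scale)
    show "{p * q - q * p | p q. p \<in> A1 B \<and> q \<in> A1 B} \<subseteq> ?N"
    proof
      fix k :: "('b, 'r) tens" assume "k \<in> {p * q - q * p | p q. p \<in> A1 B \<and> q \<in> A1 B}"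
      then obtain p p' where k: "k = p * p' - p' * p" and p: "p \<in> A1 B" "p' \<in> A1 B" by blast
      have "around_star (p * p' - p' * p) q \<in> null B \<and> around_star q (p * p' - p' * p) \<in> null B" if q: "q \<in> A1 B" for q
      proof
        have "comm (around_star p 1) (around_star p' q) \<in> null B"
          by (intro null_comm around_star_L1[OF p(1) one_words] around_star_L1[OF p(2) q]) auto
        then show "around_star (p * p' - p' * p) q \<in> null B" by (simp add: comm_around_star around_star_linear)
        have "comm (around_star 1 p') (around_star q p) \<in> null B"
          by (intro null_comm around_star_L1[OF one_words p(2)] around_star_L1[OF q p(1)]) auto
        then show "around_star q (p * p' - p' * p) \<in> null B" by (simp add: comm_around_star around_star_linear)
      qed
      then show "k \<in> ?N" unfolding k using p by (auto simp: mult_A1)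
    qed
  qed
  with assms show "around_star k q \<in> null B" "around_star q k \<in> null B" by auto
qed

lemma commutator_sub_A1: "commutator_sub (ass_alg B) \<subseteq> A1 B"
  using submoduleD(4)[OF quotient.N[OF quotient_ass]] by (simp add: carrier_ass_alg_words)

abbreviation tensor_null :: "'b set \<Rightarrow> (('b, 'r::comm_ring_1) tens set \<times> ('b, 'r) tens set \<Rightarrow>\<^sub>0 'r) set" where
  "tensor_null B \<equiv> tensor_sub (Cyc B) (Cyc B)"

abbreviation Cyc2 :: "'b set \<Rightarrow> (('b, 'r::comm_ring_1) tens set \<times> ('b, 'r) tens set) set" where
  "Cyc2 B \<equiv> carrier (Cyc B) \<times> carrier (Cyc B)"

lemma module_Cyc: "module scalars (Cyc B)"
  unfolding abs_quot_def by (rule quotient.module_quot[OF quotient_ass])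

lemma quotient_tensor: "quotient (free_mod (Cyc2 B)) (tensor_null B)"
proof (intro quotient.intro module_free_mod)
  interpret Cyc: module scalars "Cyc B" by (rule module_Cyc)
  have "a \<odot>\<^bsub>Cyc B\<^esub> x \<in> carrier (Cyc B)" if "x \<in> carrier (Cyc B)" for a x using that Cyc.smult_closed by simp
  then have "tensor_rels (Cyc B) (Cyc B) \<subseteq> carrier (free_mod (Cyc2 B))"
    unfolding tensor_rels_def carrier_free_mod
    by (intro Un_least; clarify) (intro supported_diff supported_trm; simp)+
  then show "submodule (tensor_null B) scalars (free_mod (Cyc2 B))"
    unfolding tensor_sub_def by (rule gen_submodule_submodule[OF module_free_mod])
qed

lemmas tensor_null_submodule = quotient.N[OF quotient_tensor]

lemma tensor_null_add: "f \<in> tensor_null B \<Longrightarrow> g \<in> tensor_null B \<Longrightarrow> f + g \<in> tensor_null B"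
  and tensor_null_scale: "f \<in> tensor_null B \<Longrightarrow> scale a f \<in> tensor_null B"
  and tensor_null_zero: "0 \<in> tensor_null B"
  using submoduleD(1-3)[OF tensor_null_submodule] by simp_all

lemma tensor_null_diff: "f \<in> tensor_null B \<Longrightarrow> g \<in> tensor_null B \<Longrightarrow> f - g \<in> tensor_null B"
  using tensor_null_add[of f B "scale (-1) g"] tensor_null_scale[of g B "-1"] by (simp add: scale_uminus_left)

lemma tensor_null_rels:
  assumes "p \<in> A1 B" "p' \<in> A1 B" "q \<in> A1 B"
  shows "mon (cyc B (p + p'), cyc B q) - mon (cyc B p, cyc B q) - mon (cyc B p', cyc B q) \<in> tensor_null B"
    "mon (cyc B q, cyc B (p + p')) - mon (cyc B q, cyc B p) - mon (cyc B q, cyc B p') \<in> tensor_null B"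
  unfolding tensor_sub_def tensor_rels_def cyc_simps(1)[OF assms(1,2), symmetric]
  by (rule gen_submodule_inc; use assms cyc_scale(2) in blast)+

lemma tensor_null_rels_scale:
  assumes "p \<in> A1 B" "q \<in> A1 B"
  shows "mon (cyc B (scale a p), cyc B q) - trm (cyc B p, cyc B q) a \<in> tensor_null B"
    "mon (cyc B q, cyc B (scale a p)) - trm (cyc B q, cyc B p) a \<in> tensor_null B"
  unfolding tensor_sub_def tensor_rels_def cyc_scale(1)[OF assms(1), symmetric]
  by (rule gen_submodule_inc; use assms cyc_scale(2) in blast)+

text \<open>
  A lift of the isomorphism to free modules, in terms of chosen representatives. The next map is its
  inverse up to the submodules of relations; on the special words it is \<open>0\<close>.
\<close>

definition from_tensor :: "(('b, 'r::comm_ring_1) tens set \<times> ('b, 'r) tens set \<Rightarrow>\<^sub>0 'r) \<Rightarrow> (unit + 'b, 'r) tens" where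
  "from_tensor = lin_ext (\<lambda>(X, Y). around_star (cyc_rep X) (cyc_rep Y))"

definition to_tensor :: "'b set \<Rightarrow> (unit + 'b, 'r::comm_ring_1) tens \<Rightarrow>
    (('b, 'r) tens set \<times> ('b, 'r) tens set \<Rightarrow>\<^sub>0 'r)" where
  "to_tensor B = lin_ext (\<lambda>w. case the_inv (case_prod pw) w of (u, v) \<Rightarrow>
     if u = [] \<or> v = [] then 0 else mon (cyc B (mon u), cyc B (mon v)))"

lemma to_tensor_add: "to_tensor B (p + q) = to_tensor B p + to_tensor B q" and to_tensor_diff: "to_tensor B (p - q) = to_tensor B p - to_tensor B q"
  and to_tensor_scale: "to_tensor B (scale a p) = scale a (to_tensor B p)" and to_tensor_zero [simp]: "to_tensor B 0 = 0"
  by (simp_all add: to_tensor_def lin_ext_add lin_ext_diff lin_ext_scale)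

lemma from_tensor_add: "from_tensor (p + q) = from_tensor p + from_tensor q" and from_tensor_diff: "from_tensor (p - q) = from_tensor p - from_tensor q"
  and from_tensor_scale: "from_tensor (scale a p) = scale a (from_tensor p)" and from_tensor_zero [simp]: "from_tensor 0 = 0"
  by (simp_all add: from_tensor_def lin_ext_add lin_ext_diff lin_ext_scale)

lemma from_tensor_trm: "from_tensor (trm (X, Y) a) = scale a (around_star (cyc_rep X) (cyc_rep Y))"
  by (simp add: from_tensor_def)

lemma from_tensor_mon [simp]: "from_tensor (mon (X, Y)) = around_star (cyc_rep X) (cyc_rep Y)"
  by (simp add: from_tensor_def)

lemma to_tensor_mon [simp]: "to_tensor B (mon (pw u v)) = (if u = [] \<or> v = [] then 0 else mon (cyc B (mon u), cyc B (mon v)))"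
proof -
  have "the_inv (case_prod pw) (case_prod pw (u, v)) = (u, v)"
    by (rule the_inv_f_f) (auto simp: inj_def)
  then show ?thesis by (simp add: to_tensor_def)
qed

lemma from_tensor_L1: "f \<in> supported (Cyc2 B) \<Longrightarrow> from_tensor f \<in> L1 B"
  unfolding from_tensor_def by (erule lin_ext_supported) (auto intro!: around_star_L1[of _ "Suc 0" _ _ "Suc 0"] cyc_rep_Cyc)

lemma to_tensor_supported: "p \<in> L1 B \<Longrightarrow> to_tensor B p \<in> supported (Cyc2 B)"
proof (induction rule: supported_induct)
  case (trm w a)
  then obtain u v where w: "w = pw u v" "u \<in> lists B" "v \<in> lists B" by (elim lin_wordsE)
  have "to_tensor B (mon w) \<in> supported (Cyc2 B)"
    using w by (auto simp: words_def Suc_le_eq intro!: cyc_scale(2))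
  from supported_scale[OF this, of a] show ?case by (simp flip: to_tensor_scale)
qed (auto simp: to_tensor_add)

text \<open>
  Each bilinearity relation is sent to \<open>k \<otimes> q\<close> or \<open>q \<otimes> k\<close>, where \<open>k\<close> measures the failure of the
  representatives to be linear, and is therefore a sum of commutators.
\<close>

lemma from_tensor_tensor_null:
  fixes f :: "('b, 'r::comm_ring_1) tens set \<times> ('b, 'r) tens set \<Rightarrow>\<^sub>0 'r"
  assumes "f \<in> tensor_null B"
  shows "from_tensor f \<in> null B"
proof -
  let ?N = "{f :: ('b, 'r) tens set \<times> ('b, 'r) tens set \<Rightarrow>\<^sub>0 'r. f \<in> supported (Cyc2 B) \<and> from_tensor f \<in> null B}"
  have A1: "k \<in> A1 B" if "k \<in> commutator_sub (ass_alg B)" for k :: "('b, 'r) tens"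
    using that commutator_sub_A1 by blast
  interpret Cyc: module scalars "Cyc B :: ('r, ('b, 'r) tens set) module" by (rule module_Cyc)
  have sm: "a \<odot>\<^bsub>Cyc B\<^esub> x \<in> carrier (Cyc B)" if "x \<in> carrier (Cyc B)" for a and x :: "('b, 'r) tens set"
    using that Cyc.smult_closed by simp
  have add: "cyc_rep (X \<oplus>\<^bsub>Cyc B\<^esub> X') - cyc_rep X - cyc_rep X' \<in> commutator_sub (ass_alg B)"
    if X: "X \<in> carrier (Cyc B)" "X' \<in> carrier (Cyc B)" for X X' :: "('b, 'r) tens set"
  proof -
    have "cyc_rep (cyc B (cyc_rep X + cyc_rep X')) - (cyc_rep X + cyc_rep X') \<in> commutator_sub (ass_alg B)"
      using cyc_rep_Cyc[OF X(1)] cyc_rep_Cyc[OF X(2)] by (intro cyc_rep_cyc) auto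
    then show ?thesis using cyc_rep_Cyc[OF X(1)] cyc_rep_Cyc[OF X(2)] cyc_simps(1)[of "cyc_rep X" B "cyc_rep X'"]
      by (simp add: algebra_simps)
  qed
  have scl: "cyc_rep (a \<odot>\<^bsub>Cyc B\<^esub> X) - scale a (cyc_rep X) \<in> commutator_sub (ass_alg B)"
    if X: "X \<in> carrier (Cyc B)" for a and X :: "('b, 'r) tens set"
  proof -
    have "cyc_rep (cyc B (scale a (cyc_rep X))) - scale a (cyc_rep X) \<in> commutator_sub (ass_alg B)"
      using cyc_rep_Cyc[OF X] by (intro cyc_rep_cyc) auto
    then show ?thesis using cyc_rep_Cyc[OF X] cyc_scale(1)[of "cyc_rep X" B a] by simp
  qed
  have "tensor_null B \<subseteq> ?N" unfolding tensor_sub_def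
  proof (rule gen_submodule_minimal)
    show "submodule ?N scalars (free_mod (Cyc2 B))"
      by (rule scalar_submoduleI[OF module_free_mod])
        (auto simp: carrier_free_mod from_tensor_add from_tensor_scale null_zero null_add null_scale)
    show "tensor_rels (Cyc B) (Cyc B) \<subseteq> ?N"
      unfolding tensor_rels_def
    proof (intro Un_least subsetI)
      fix r :: "('b, 'r) tens set \<times> ('b, 'r) tens set \<Rightarrow>\<^sub>0 'r"
      assume "r \<in> {mon (X \<oplus>\<^bsub>Cyc B\<^esub> X', Y) - mon (X, Y) - mon (X', Y) | X X' Y.
        X \<in> carrier (Cyc B) \<and> X' \<in> carrier (Cyc B) \<and> Y \<in> carrier (Cyc B)}"
      then obtain X X' Y where r: "r = mon (X \<oplus>\<^bsub>Cyc B\<^esub> X', Y) - mon (X, Y) - mon (X', Y)"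
        and X: "X \<in> carrier (Cyc B)" "X' \<in> carrier (Cyc B)" "Y \<in> carrier (Cyc B)" by blast
      have "from_tensor r = around_star (cyc_rep (X \<oplus>\<^bsub>Cyc B\<^esub> X') - cyc_rep X - cyc_rep X') (cyc_rep Y)"
        by (simp add: r from_tensor_diff around_star_linear)
      moreover have "r \<in> supported (Cyc2 B)"
        unfolding r using X by (intro supported_diff supported_trm) auto
      ultimately show "r \<in> ?N"
        using around_star_commutator_null(1)[OF add[OF X(1,2)] cyc_rep_Cyc(1)[OF X(3)]] by simp
    next
      fix r :: "('b, 'r) tens set \<times> ('b, 'r) tens set \<Rightarrow>\<^sub>0 'r"
      assume "r \<in> {mon (X, Y \<oplus>\<^bsub>Cyc B\<^esub> Y') - mon (X, Y) - mon (X, Y') | X Y Y'.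
        X \<in> carrier (Cyc B) \<and> Y \<in> carrier (Cyc B) \<and> Y' \<in> carrier (Cyc B)}"
      then obtain X Y Y' where r: "r = mon (X, Y \<oplus>\<^bsub>Cyc B\<^esub> Y') - mon (X, Y) - mon (X, Y')"
        and X: "X \<in> carrier (Cyc B)" "Y \<in> carrier (Cyc B)" "Y' \<in> carrier (Cyc B)" by blast
      have "from_tensor r = around_star (cyc_rep X) (cyc_rep (Y \<oplus>\<^bsub>Cyc B\<^esub> Y') - cyc_rep Y - cyc_rep Y')"
        by (simp add: r from_tensor_diff around_star_linear)
      moreover have "r \<in> supported (Cyc2 B)"
        unfolding r using X by (intro supported_diff supported_trm) auto
      ultimately show "r \<in> ?N"
        using around_star_commutator_null(2)[OF add[OF X(2,3)] cyc_rep_Cyc(1)[OF X(1)]] by simp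
    next
      fix r :: "('b, 'r) tens set \<times> ('b, 'r) tens set \<Rightarrow>\<^sub>0 'r"
      assume "r \<in> {mon (a \<odot>\<^bsub>Cyc B\<^esub> X, Y) - trm (X, Y) a | a X Y. X \<in> carrier (Cyc B) \<and> Y \<in> carrier (Cyc B)}"
      then obtain a X Y where r: "r = mon (a \<odot>\<^bsub>Cyc B\<^esub> X, Y) - trm (X, Y) a"
        and X: "X \<in> carrier (Cyc B)" "Y \<in> carrier (Cyc B)" by blast
      have "from_tensor r = around_star (cyc_rep (a \<odot>\<^bsub>Cyc B\<^esub> X) - scale a (cyc_rep X)) (cyc_rep Y)"
        by (simp add: r from_tensor_diff from_tensor_trm around_star_linear)
      moreover have "r \<in> supported (Cyc2 B)"
        unfolding r using X sm by (intro supported_diff supported_trm) auto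
      ultimately show "r \<in> ?N"
        using around_star_commutator_null(1)[OF scl[OF X(1)] cyc_rep_Cyc(1)[OF X(2)]] by simp
    next
      fix r :: "('b, 'r) tens set \<times> ('b, 'r) tens set \<Rightarrow>\<^sub>0 'r"
      assume "r \<in> {mon (X, a \<odot>\<^bsub>Cyc B\<^esub> Y) - trm (X, Y) a | a X Y. X \<in> carrier (Cyc B) \<and> Y \<in> carrier (Cyc B)}"
      then obtain a X Y where r: "r = mon (X, a \<odot>\<^bsub>Cyc B\<^esub> Y) - trm (X, Y) a"
        and X: "X \<in> carrier (Cyc B)" "Y \<in> carrier (Cyc B)" by blast
      have "from_tensor r = around_star (cyc_rep X) (cyc_rep (a \<odot>\<^bsub>Cyc B\<^esub> Y) - scale a (cyc_rep Y))"
        by (simp add: r from_tensor_diff from_tensor_trm around_star_linear)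
      moreover have "r \<in> supported (Cyc2 B)"
        unfolding r using X sm by (intro supported_diff supported_trm) auto
      ultimately show "r \<in> ?N"
        using around_star_commutator_null(2)[OF scl[OF X(2)] cyc_rep_Cyc(1)[OF X(1)]] by simp
    qed
  qed
  with assms show ?thesis by blast
qed

lemma cyc_rotate:
  assumes "u \<in> lists B" "v \<in> lists B"
  shows "cyc B (mon (u @ v)) = cyc B (mon (v @ u) :: ('b, 'r::comm_ring_1) tens)"
proof (cases "u = [] \<or> v = []")
  case False
  then have uv: "(mon u :: ('b, 'r) tens) \<in> A1 B" "(mon v :: ('b, 'r) tens) \<in> A1 B"
    using assms by (auto simp: words_def Suc_le_eq)
  have "(mon u * mon v - mon v * mon u :: ('b, 'r) tens) \<in> commutator_sub (ass_alg B)"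
    unfolding commutator_sub_ass using uv by (intro gen_submodule_inc) blast
  moreover have "(mon (u @ v) :: ('b, 'r) tens) \<in> A1 B" "(mon (v @ u) :: ('b, 'r) tens) \<in> A1 B"
    using uv by (auto simp: words_def)
  ultimately show ?thesis by (simp add: cyc_simps(2) mon_mult_mon)
qed auto

text \<open>
  The commutator of \<open>u \<otimes> v\<close> and \<open>u' \<otimes> v'\<close> is a difference of two terms whose left words, and whose right
  words, agree up to rotation.
\<close>

lemma to_tensor_null:
  fixes p :: "(unit + 'b, 'r::comm_ring_1) tens"
  shows "p \<in> null B \<Longrightarrow> to_tensor B p \<in> tensor_null B"
proof (induction rule: null_induct)
  case (comm u v u' v')
  then show ?case using cyc_rotate[where 'r = 'r, of u B u'] cyc_rotate[where 'r = 'r, of v B v'] by (auto simp: to_tensor_diff tensor_null_zero)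
next
  case (special w)
  then show ?case by (auto simp: special_words_def tensor_null_zero)
qed (auto simp: to_tensor_add to_tensor_scale tensor_null_zero tensor_null_add tensor_null_scale)

lemma to_tensor_around_star:
  fixes p q :: "('b, 'r::comm_ring_1) tens"
  assumes "p \<in> A1 B" "q \<in> A1 B"
  shows "to_tensor B (around_star p q) - mon (cyc B p, cyc B q) \<in> tensor_null B"
  using assms(1)
proof (induction rule: supported_induct)
  case zero
  show ?case using tensor_null_rels_scale(1)[of 0 B q 0] tensor_null_scale[of _ B "-1"] assms(2)
    by (auto simp: around_star_linear scale_uminus_left)
next
  case (add p p')
  have "(to_tensor B (around_star p q) - mon (cyc B p, cyc B q)) + (to_tensor B (around_star p' q) - mon (cyc B p', cyc B q)) -
      (mon (cyc B (p + p'), cyc B q) - mon (cyc B p, cyc B q) - mon (cyc B p', cyc B q)) \<in> tensor_null B"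
    by (intro tensor_null_diff tensor_null_add add(3,4) tensor_null_rels(1) add(1,2) assms(2))
  then show ?case by (simp add: around_star_linear to_tensor_add algebra_simps)
next
  case (trm u a)
  then have u: "(mon u :: ('b, 'r) tens) \<in> A1 B" by simp
  have "to_tensor B (around_star (mon u) q) - mon (cyc B (mon u), cyc B q) \<in> tensor_null B"
    using assms(2)
  proof (induction rule: supported_induct)
    case zero
    show ?case using tensor_null_rels_scale(2)[of 0 B "mon u" 0] u tensor_null_scale[of _ B "-1"]
      by (auto simp: around_star_linear scale_uminus_left)
  next
    case (add q q')
    have "(to_tensor B (around_star (mon u) q) - mon (cyc B (mon u), cyc B q)) + (to_tensor B (around_star (mon u) q') - mon (cyc B (mon u), cyc B q')) -
      (mon (cyc B (mon u), cyc B (q + q')) - mon (cyc B (mon u), cyc B q) - mon (cyc B (mon u), cyc B q')) \<in> tensor_null B"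
      by (intro tensor_null_diff tensor_null_add add(3,4) tensor_null_rels(2) add(1,2) u)
    then show ?case by (simp add: around_star_linear to_tensor_add algebra_simps)
  next
    case (trm v b)
    then have v: "(mon v :: ('b, 'r) tens) \<in> A1 B" by simp
    have "u \<noteq> []" "v \<noteq> []" using \<open>u \<in> words _ _\<close> trm by (auto simp: words_def)
    then have "to_tensor B (around_star (mon u) (scale b (mon v))) - mon (cyc B (mon u), cyc B (scale b (mon v))) =
      scale (-1) (mon (cyc B (mon u), cyc B (scale b (mon v))) - trm (cyc B (mon u), cyc B (mon v)) b)"
      unfolding around_star_linear around_star_mon to_tensor_scale by (simp add: scale_uminus_left)
    also have "\<dots> \<in> tensor_null B" by (intro tensor_null_scale tensor_null_rels_scale(2) u v)
    finally show ?case by simp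
  qed
  from tensor_null_diff[OF tensor_null_scale[OF this, of a] tensor_null_rels_scale(1)[OF u assms(2), of a]]
  have "to_tensor B (around_star (scale a (mon u)) q) - mon (cyc B (scale a (mon u)), cyc B q) \<in> tensor_null B"
    unfolding around_star_linear to_tensor_scale scale_diff_right by (simp add: algebra_simps)
  then show ?case by simp
qed

lemma to_from_tensor: "f \<in> supported (Cyc2 B) \<Longrightarrow> to_tensor B (from_tensor f) - f \<in> tensor_null B"
proof (induction rule: supported_induct)
  case zero
  show ?case by (simp add: tensor_null_zero)
next
  case (add f g)
  from tensor_null_add[OF add(3,4)] show ?case by (simp add: from_tensor_add to_tensor_add algebra_simps)
next
  case (trm X a)
  then obtain Y Z where X: "X = (Y, Z)" "Y \<in> carrier (Cyc B)" "Z \<in> carrier (Cyc B)" by auto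
  have "to_tensor B (from_tensor (mon X)) - mon X \<in> tensor_null B"
    using to_tensor_around_star[OF cyc_rep_Cyc(1)[OF X(2)] cyc_rep_Cyc(1)[OF X(3)]] cyc_rep_Cyc(2)[OF X(2)] cyc_rep_Cyc(2)[OF X(3)] X(1) by simp
  from tensor_null_scale[OF this, of a] have "to_tensor B (from_tensor (scale a (mon X))) - scale a (mon X) \<in> tensor_null B"
    unfolding from_tensor_scale to_tensor_scale scale_diff_right .
  then show ?case by simp
qed

lemma around_star_rep:
  assumes "p \<in> A1 B" "q \<in> A1 B"
  shows "around_star (cyc_rep (cyc B p)) (cyc_rep (cyc B q)) - around_star p q \<in> null B"
proof -
  note r = cyc_rep_cyc[OF assms(1)] cyc_rep_cyc[OF assms(2)]
  have "around_star (cyc_rep (cyc B p) - p) (cyc_rep (cyc B q)) + around_star p (cyc_rep (cyc B q) - q) \<in> null B"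
    by (intro null_add around_star_commutator_null r assms)
  then show ?thesis by (simp add: around_star_linear)
qed

lemma from_to_tensor:
  fixes p :: "(unit + 'b, 'r::comm_ring_1) tens"
  shows "p \<in> L1 B \<Longrightarrow> from_tensor (to_tensor B p) - p \<in> null B"
proof (induction rule: supported_induct)
  case zero
  show ?case by (simp add: null_zero)
next
  case (add f g)
  from null_add[OF add(3,4)] show ?case by (simp add: from_tensor_add to_tensor_add algebra_simps)
next
  case (trm w a)
  then obtain u v where w: "w = pw u v" "u \<in> lists B" "v \<in> lists B" "Suc 0 \<le> length u + length v"
    by (elim lin_wordsE)
  have "from_tensor (to_tensor B (mon w)) - (mon w :: (unit + 'b, 'r) tens) \<in> null B"
  proof (cases "u = [] \<or> v = []")
    case True
    then have "w \<in> special_words B" using w by (auto simp: special_words_def words_def)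
    then have "- (mon w :: (unit + 'b, 'r) tens) \<in> null B" by (intro null_special) auto
    with True show ?thesis by (simp add: w(1))
  next
    case False
    then have "(mon u :: ('b, 'r) tens) \<in> A1 B" "(mon v :: ('b, 'r) tens) \<in> A1 B"
      using w by (auto simp: words_def Suc_le_eq)
    from around_star_rep[OF this] False show ?thesis by (simp add: w(1) around_star_mon)
  qed
  from null_scale[OF this, of a] have "from_tensor (to_tensor B (scale a (mon w))) - scale a (mon w) \<in> null B"
    unfolding from_tensor_scale to_tensor_scale scale_diff_right .
  then show ?case by simp
qed

text \<open>
  Both \<open>from_tensor\<close> and \<open>to_tensor\<close> respect the relations and are inverse to each other modulo them.
\<close>

lemma target_iso:
  fixes B :: "'b set"
  shows "\<exists>\<theta> \<in> lin_isos (bi_abs B :: ('r::comm_ring_1, _) module) (pt_quot B).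
    \<forall>p \<in> carrier (ass_alg B). \<forall>q \<in> carrier (ass_alg B). \<theta> (bi_abs_pure B p q) = pt_quot_class B p q"
proof -
  let ?F = "free_mod (Cyc2 B) :: ('r, ('b, 'r) tens set \<times> ('b, 'r) tens set \<Rightarrow>\<^sub>0 'r) module"
  have bi: "bi_abs B = quot_module ?F (tensor_null B)"
    by (simp add: bi_abs_def tensor_product_def abs_quot_opposite)
  define \<theta> :: "(('b, 'r) tens set \<times> ('b, 'r) tens set \<Rightarrow>\<^sub>0 'r) set \<Rightarrow> _" where
    "\<theta> = (\<lambda>Z. cls B (from_tensor (SOME f. f \<in> Z)))"
  have \<theta>: "\<theta> (tensor_null B +>\<^bsub>?F\<^esub> f) = cls B (from_tensor f)" if f: "f \<in> supported (Cyc2 B)" for f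
  proof -
    let ?g = "SOME g. g \<in> tensor_null B +>\<^bsub>?F\<^esub> f"
    have g: "?g \<in> tensor_null B +>\<^bsub>?F\<^esub> f"
      by (rule someI) (rule quotient.self_in_coset[OF quotient_tensor], use f in \<open>simp add: carrier_free_mod\<close>)
    then have "?g - f \<in> tensor_null B" "?g \<in> supported (Cyc2 B)"
      using quotient.coset_memD[OF quotient_tensor g] f
      by (auto simp: quotient.coset_mem[OF quotient_tensor] carrier_free_mod)
    with f show ?thesis
      using from_tensor_tensor_null[of "?g - f" B] by (simp add: \<theta>_def cls_simps(2) from_tensor_L1 from_tensor_diff)
  qed
  have carr: "carrier (bi_abs B) = (\<lambda>f. tensor_null B +>\<^bsub>?F\<^esub> f) ` supported (Cyc2 B)"
    by (simp add: bi carrier_quot_module carrier_free_mod)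
  have "\<theta> \<in> lin_maps (bi_abs B) (pt_quot B)"
    unfolding lin_maps_def carr
    by (auto simp: \<theta> bi quotient.coset_add[OF quotient_tensor] quotient.coset_smult[OF quotient_tensor]
      carrier_free_mod cls_simps cls_scale from_tensor_L1 from_tensor_add from_tensor_scale)
  moreover have "inj_on \<theta> (carrier (bi_abs B))"
    unfolding carr
  proof (intro inj_onI, elim imageE)
    fix X Y f g assume f: "X = tensor_null B +>\<^bsub>?F\<^esub> f" "f \<in> supported (Cyc2 B)" and g: "Y = tensor_null B +>\<^bsub>?F\<^esub> g" "g \<in> supported (Cyc2 B)"
      and "\<theta> X = \<theta> Y"
    then have "from_tensor (f - g) \<in> null B" by (simp add: \<theta> cls_simps(2) from_tensor_L1 from_tensor_diff)
    from tensor_null_diff[OF to_tensor_null[OF this] to_from_tensor[of "f - g"]] f(2) g(2) have "f - g \<in> tensor_null B" by simp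
    then show "X = Y" unfolding f g
      using f(2) g(2) by (subst quotient.coset_eq_iff[OF quotient_tensor]) (auto simp: carrier_free_mod free_mod_minus)
  qed
  moreover have "\<theta> ` carrier (bi_abs B) = carrier (pt_quot B)"
  proof (intro equalityI subsetI)
    fix X :: "((unit + 'b, 'r) tens \<Rightarrow> (unit + 'b, 'r) tens) set set" assume "X \<in> carrier (pt_quot B)"
    then obtain p where p: "X = cls B p" "p \<in> L1 B" by (auto simp: carrier_pt_quot)
    have "X = \<theta> (tensor_null B +>\<^bsub>?F\<^esub> to_tensor B p)"
      using p from_to_tensor[OF p(2)] to_tensor_supported[OF p(2)] cls_simps(2)[of "from_tensor (to_tensor B p)" B p] by (simp add: \<theta> from_tensor_L1)
    then show "X \<in> \<theta> ` carrier (bi_abs B)" using to_tensor_supported[OF p(2)] unfolding carr by blast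
  qed (auto simp: carr \<theta> cls_scale from_tensor_L1)
  ultimately have "\<theta> \<in> lin_isos (bi_abs B) (pt_quot B)"
    by (simp add: lin_isos_def bij_betw_def)
  moreover have "\<theta> (bi_abs_pure B p q) = pt_quot_class B p q"
    if pq: "p \<in> carrier (ass_alg B)" "q \<in> carrier (ass_alg B)" for p q
  proof -
    have p: "p \<in> A1 B" "q \<in> A1 B" using pq by (simp_all add: carrier_ass_alg_words)
    have around_star: "around_star p q \<in> L1 B" by (rule around_star_L1[OF p]) simp
    have coset: "a_r_coset (opposite (ass_alg B)) = a_r_coset (ass_alg B)"
      by (simp add: a_r_coset_def opposite_def)
    have "\<theta> (bi_abs_pure B p q) = \<theta> (tensor_null B +>\<^bsub>?F\<^esub> mon (cyc B p, cyc B q))"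
      by (simp add: bi_abs_pure_def pure_tensor_def abs_quot_opposite commutator_sub_opposite coset cyc_def)
    also have "\<dots> = cls B (around_star (cyc_rep (cyc B p)) (cyc_rep (cyc B q)))"
      using cyc_scale(2)[OF p(1)] cyc_scale(2)[OF p(2)] by (simp add: \<theta>)
    also have "\<dots> = cls B (around_star p q)"
      using around_star_rep[OF p] around_star around_star_L1[OF cyc_rep_cyc(2)[OF p(1)] cyc_rep_cyc(2)[OF p(2)]] by (simp add: cls_simps(2))
    also have "\<dots> = pt_quot_class B p q"
      using around_star pt_der_eq[OF around_star] by (simp add: pt_quot_class_def cls_def ass_map_push incl_trm around_star_def)
    finally show ?thesis .
  qed
  ultimately show ?thesis by blast
qed

theorem proposition12p10:
  fixes B :: "'b set"
  assumes "fg_stably_free_imp_free TYPE('r::comm_ring_1)"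
    and "finite B"
  shows "(\<forall>X \<in> a_kernel (der_quot B :: ('r, _) module) (pt_quot B) (div_quot B).
            der_quot_map (Sum_Type.Plus B {..<4::nat}) split_incl X =
              \<zero>\<^bsub>der_quot (Sum_Type.Plus B {..<4::nat})\<^esub>) \<and>
         (\<exists>\<theta> \<in> lin_isos (bi_abs B :: ('r, _) module) (pt_quot B).
            \<forall>p \<in> carrier (ass_alg B). \<forall>q \<in> carrier (ass_alg B).
              \<theta> (bi_abs_pure B p q) = pt_quot_class B p q)"
  using kernel_torsion[OF assms(2)] target_iso by blast

end
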